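(* Let $q$ be a primitive cube root of unity, $\mathfrak{q}=\left(\begin{smallmatrix} q & q \\ q & q \end{smallmatrix}\right)$, and let $\sigma_{\boldsymbol\lambda}\in Z^2(\mathfrak{B}_{\mathfrak{q}})^H$ be the braided Hopf 2-cocycle $\sigma_{\boldsymbol\lambda}(a,b)=\epsilon_0(\gamma_{\boldsymbol\lambda}(a)\gamma_{\boldsymbol\lambda}(b))$ attached to an admissible $\boldsymbol\lambda=(\lambda_1,\lambda_2,\lambda_{12},\lambda_{112},\lambda_{122})\in\Bbbk^5$ (see context). Then $\sigma_{\boldsymbol\lambda}$ is an exponential Hopf 2-cocycle, i.e. there exist an $H$-linear convolution unit $\alpha\in U_H(\mathfrak{B}_{\mathfrak{q}}^\ast)$ and a Hochschild 2-cocycle $\eta\in\mathrm{Z}^2(\mathfrak{B}_{\mathfrak{q}},\Bbbk)^H$ with $\alpha\rightharpoonup\sigma_{\boldsymbol\lambda}=e^\eta$, if and only if either: (a) $\lambda_{112}=\lambda_{122}=0$ and at most one of the parameters $\lambda_1,\lambda_2,\lambda_{12}$ is non-zero; or (b) $\lambda_{112}\lambda_{122}\ne0$ and $\lambda_1=\tfrac13\tfrac{\lambda_{112}^2}{\lambda_{122}}$, $\lambda_2=\tfrac13\tfrac{\lambda_{122}^2}{\lambda_{112}}$, $\lambda_{12}=\tfrac13(q^2-q)\lambda_{112}\lambda_{122}$.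
   Context: $\Bbbk$ is algebraically closed of characteristic zero. $H$ is a semisimple Hopf algebra with a principal YD-realization of $\mathfrak{q}$: pairs $(g_i,\chi_i)$, $i=1,2$, of a group-like $g_i\in H$ and an algebra map $\chi_i\colon H\to\Bbbk$ with $\chi_i(h)g_i=\chi_i(h_{(2)})h_{(1)}g_i\mathcal{S}(h_{(3)})$ for $h\in H$ and $\chi_j(g_i)=q$ for all $i,j$. $V$ has basis $x_1,x_2$ and is a Yetter–Drinfeld module via $h\cdot x_i=\chi_i(h)x_i$, $x_i\mapsto g_i\otimes x_i$. Its Nichols algebra $\mathfrak{B}_{\mathfrak{q}}$ is generated by $x_1,x_2$ (primitive) with relations $x_1^3=x_2^3=x_{12}^3=0$, $x_{112}=x_{122}=0$, where $x_{12}=x_1x_2-qx_2x_1$, $x_{112}=x_1x_{12}-q^2x_{12}x_1$, $x_{122}=x_{12}x_2-q^2x_2x_{12}$; PBW basis $\{x_2^{n_2}x_{12}^{n_{12}}x_1^{n_1}:0\le n_2,n_{12},n_1\le2\}$. $\boldsymbol\lambda$ is admissible if $\lambda_i\ne0$ only if $\chi_i^3=\epsilon$, $\lambda_{12}\ne0$ only if $(\chi_1\chi_2)^3=\epsilon$, $\lambda_{112}\ne0$ only if $\chi_1^2\chi_2=\epsilon$, $\lambda_{122}\ne0$ only if $\chi_1\chi_2^2=\epsilon$. $\mathcal{E}_{\boldsymbol\lambda}$ is the algebra generated by $y_1,y_2$ with relations $y_1^3=\lambda_1$, $y_2^3=\lambda_2$, $y_{12}^3=\lambda_{12}$, $y_{112}=\lambda_{112}$,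 $y_{122}=\lambda_{122}$ (with $y_{12},y_{112},y_{122}$ defined as for the $x$'s), with basis $\{y_2^{n_2}y_{12}^{n_{12}}y_1^{n_1}:0\le n_2,n_{12},n_1\le2\}$; $\epsilon_0\colon\mathcal{E}_{\boldsymbol\lambda}\to\Bbbk$ is the linear map sending $1\mapsto1$ and the other basis elements to $0$. The linear map $\gamma=\gamma_{\boldsymbol\lambda}\colon\mathfrak{B}_{\mathfrak{q}}\to\mathcal{E}_{\boldsymbol\lambda}$ is: $\gamma(x_{12}^2)=y_{12}^2-(q^2-q)\lambda_{112}y_2$; $\gamma(x_{12}^2x_1)=y_{12}^2y_1+3q^2\lambda_1y_2^2-(q^2-q)\lambda_{112}y_2y_1$; $\gamma(x_{12}x_1^2)=y_{12}y_1^2-(q^2-q)\lambda_1y_2$; $\gamma(x_2x_{12}^2)=y_2y_{12}^2-(q^2-q)\lambda_{112}y_2^2$; $\gamma(x_2x_{12}x_1^2)=y_2y_{12}y_1^2-(q^2-q)\lambda_1y_2^2$; $\gamma(x_2x_{12}^2x_1)=y_2y_{12}^2y_1-(q^2-q)\lambda_{112}y_2^2y_1$; $\gamma(x_{12}^2x_1^2)=y_{12}^2y_1^2-3q\lambda_1y_2^2y_1-(q-q^2)\lambda_1y_2y_{12}-(q^2-q)\lambda_{112}y_2y_1^2$; $\gamma(x_2x_{12}^2x_1^2)=y_2y_{12}^2y_1^2-(q-q^2)\lambda_1y_2^2y_{12}-(q^2-q)\lambda_{112}y_2^2y_1^2$; and $\gamma(x_2^{n_2}x_{12}^{n_{12}}x_1^{n_1})=y_2^{n_2}y_{12}^{n_{12}}y_1^{n_1}$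 for the remaining basis elements. $\mathfrak{B}_{\mathfrak{q}}\otimes\mathfrak{B}_{\mathfrak{q}}$ is a coalgebra with the braided coproduct $a\otimes b\mapsto\big(a_{(1)}\otimes a_{(2)(-1)}\cdot b_{(1)}\big)\otimes\big(a_{(2)(0)}\otimes b_{(2)}\big)$, and all convolution products of maps $\mathfrak{B}_{\mathfrak{q}}\otimes\mathfrak{B}_{\mathfrak{q}}\to\Bbbk$ use it. $Z^2(\mathfrak{B}_{\mathfrak{q}})^H$ is the set of convolution-invertible, $H$-linear maps $\sigma$ (i.e. $\sigma(h_{(1)}\cdot a,h_{(2)}\cdot b)=\epsilon(h)\sigma(a,b)$) with $\sigma(x,1)=\epsilon(x)=\sigma(1,x)$ and $\sigma(x_{(1)},y_{(1)})\sigma(x_{(2)}y_{(2)},z)=\sigma(y_{(1)},z_{(1)})\sigma(x,y_{(2)}z_{(2)})$ (braided coproducts). $U_H(\mathfrak{B}_{\mathfrak{q}}^\ast)$ is the group of $H$-linear convolution-invertible maps $\mathfrak{B}_{\mathfrak{q}}\to\Bbbk$, acting by $\alpha\rightharpoonup\sigma=(\alpha\otimes\alpha)\ast\sigma\ast(\alpha^{-1}\circ m)$, $m$ the multiplication. $\mathrm{Z}^2(\mathfrak{B}_{\mathfrak{q}},\Bbbk)^H$ is the set of $H$-linear maps $\eta\colon\mathfrak{B}_{\mathfrak{q}}\otimes\mathfrak{B}_{\mathfrak{q}}\to\Bbbk$ with $\eta(1,a)=\eta(a,1)=0$ and $\eta(a,bc)=\eta(ab,c)$ for $a,c\in\mathfrak{B}_{\mathfrak{q}}^+$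 (positive degree part), $b\in\mathfrak{B}_{\mathfrak{q}}$; and $e^\eta=\sum_{k\ge0}\frac1{k!}\eta^{\ast k}$. *)

theory Defs
  imports
    "HOL-Library.Poly_Mapping"
    "HOL-Computational_Algebra.Polynomial"
begin

section \<open>Algebras and elements of tensor products\<close>

text \<open>Multiplication comes from the type class; only the scalar action is a parameter.\<close>

definition algebra_over :: "('k::field \<Rightarrow> 'a::ring_1 \<Rightarrow> 'a) \<Rightarrow> bool" where
  "algebra_over s \<longleftrightarrow> vector_space s \<and>
     (\<forall>c a b. s c a * b = s c (a * b) \<and> a * s c b = s c (a * b))"

abbreviation linear_form :: "('k::field \<Rightarrow> 'a::ab_group_add \<Rightarrow> 'a) \<Rightarrow> ('a \<Rightarrow> 'k) \<Rightarrow> bool" where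
  "linear_form s f \<equiv> Vector_Spaces.linear s (*) f"

definition bilinear_form ::
  "('k::field \<Rightarrow> 'a::ab_group_add \<Rightarrow> 'a) \<Rightarrow> ('k \<Rightarrow> 'b::ab_group_add \<Rightarrow> 'b) \<Rightarrow> ('a \<Rightarrow> 'b \<Rightarrow> 'k) \<Rightarrow> bool" where
  "bilinear_form s t f \<longleftrightarrow> (\<forall>b. linear_form s (\<lambda>a. f a b)) \<and> (\<forall>a. linear_form t (f a))"

definition trilinear_form ::
  "('k::field \<Rightarrow> 'a::ab_group_add \<Rightarrow> 'a) \<Rightarrow> ('k \<Rightarrow> 'b::ab_group_add \<Rightarrow> 'b) \<Rightarrow>
   ('k \<Rightarrow> 'c::ab_group_add \<Rightarrow> 'c) \<Rightarrow> ('a \<Rightarrow> 'b \<Rightarrow> 'c \<Rightarrow> 'k) \<Rightarrow> bool" where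
  "trilinear_form s t u f \<longleftrightarrow>
     (\<forall>b c. linear_form s (\<lambda>a. f a b c)) \<and> (\<forall>a c. linear_form t (\<lambda>b. f a b c)) \<and>
     (\<forall>a b. linear_form u (f a b))"

text \<open>
  An element \<open>\<Sum>\<^sub>i a\<^sub>i \<otimes> b\<^sub>i\<close> of \<open>A \<otimes> B\<close> is represented by the list of the pairs \<open>(a\<^sub>i, b\<^sub>i)\<close>.
  Over a field, multilinear forms separate the points of a tensor product of vector spaces, so two
  lists represent the same tensor iff every bilinear form takes the same value on them.
  With this encoding a Sweedler sum is a sum over the list chosen to represent a coproduct.
\<close>

definition tensor_eq ::
  "('k::field \<Rightarrow> 'a::ab_group_add \<Rightarrow> 'a) \<Rightarrow> ('k \<Rightarrow> 'b::ab_group_add \<Rightarrow> 'b) \<Rightarrow>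
   ('a \<times> 'b) list \<Rightarrow> ('a \<times> 'b) list \<Rightarrow> bool" where
  "tensor_eq s t ps qs \<longleftrightarrow>
     (\<forall>f. bilinear_form s t f \<longrightarrow> (\<Sum>(a, b)\<leftarrow>ps. f a b) = (\<Sum>(a, b)\<leftarrow>qs. f a b))"

definition tensor3_eq ::
  "('k::field \<Rightarrow> 'a::ab_group_add \<Rightarrow> 'a) \<Rightarrow> ('k \<Rightarrow> 'b::ab_group_add \<Rightarrow> 'b) \<Rightarrow>
   ('k \<Rightarrow> 'c::ab_group_add \<Rightarrow> 'c) \<Rightarrow> ('a \<times> 'b \<times> 'c) list \<Rightarrow> ('a \<times> 'b \<times> 'c) list \<Rightarrow> bool" where
  "tensor3_eq s t u ps qs \<longleftrightarrow>
     (\<forall>f. trilinear_form s t u f \<longrightarrow>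
        (\<Sum>(a, b, c)\<leftarrow>ps. f a b c) = (\<Sum>(a, b, c)\<leftarrow>qs. f a b c))"

section \<open>Coalgebras and Hopf algebras\<close>

record ('k, 'a) coalg =
  scl :: "'k \<Rightarrow> 'a \<Rightarrow> 'a"
  cop :: "'a \<Rightarrow> ('a \<times> 'a) list"
  cou :: "'a \<Rightarrow> 'k"

record ('k, 'a) hopf = "('k, 'a) coalg" +
  antip :: "'a \<Rightarrow> 'a"

definition cop3 :: "('k, 'a, 'z) coalg_scheme \<Rightarrow> 'a \<Rightarrow> ('a \<times> 'a \<times> 'a) list" where
  "cop3 C a = [(u, v, w). (u, b) \<leftarrow> cop C a, (v, w) \<leftarrow> cop C b]"

definition coalgebra :: "('k::field, 'a::ab_group_add, 'z) coalg_scheme \<Rightarrow> bool" where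
  "coalgebra C \<longleftrightarrow>
     vector_space (scl C) \<and>
     (\<forall>a b. tensor_eq (scl C) (scl C) (cop C (a + b)) (cop C a @ cop C b)) \<and>
     (\<forall>c a. tensor_eq (scl C) (scl C) (cop C (scl C c a)) [(scl C c u, v). (u, v) \<leftarrow> cop C a]) \<and>
     (\<forall>a. tensor3_eq (scl C) (scl C) (scl C)
        [(u, v, w). (b, w) \<leftarrow> cop C a, (u, v) \<leftarrow> cop C b] (cop3 C a)) \<and>
     linear_form (scl C) (cou C) \<and>
     (\<forall>a. (\<Sum>(u, v)\<leftarrow>cop C a. scl C (cou C u) v) = a) \<and>
     (\<forall>a. (\<Sum>(u, v)\<leftarrow>cop C a. scl C (cou C v) u) = a)"

definition character :: "('k::field \<Rightarrow> 'a::ring_1 \<Rightarrow> 'a) \<Rightarrow> ('a \<Rightarrow> 'k) \<Rightarrow> bool" where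
  "character s f \<longleftrightarrow> linear_form s f \<and> f 1 = 1 \<and> (\<forall>a b. f (a * b) = f a * f b)"

definition is_antipode ::
  "('k::field, 'a::ring_1, 'z) coalg_scheme \<Rightarrow> ('a \<Rightarrow> 'a) \<Rightarrow> bool" where
  "is_antipode C S \<longleftrightarrow>
     Vector_Spaces.linear (scl C) (scl C) S \<and>
     (\<forall>a. (\<Sum>(u, v)\<leftarrow>cop C a. S u * v) = scl C (cou C a) 1) \<and>
     (\<forall>a. (\<Sum>(u, v)\<leftarrow>cop C a. u * S v) = scl C (cou C a) 1)"

definition hopf_algebra :: "('k::field, 'h::ring_1) hopf \<Rightarrow> bool" where
  "hopf_algebra H \<longleftrightarrow>
     algebra_over (scl H) \<and> coalgebra H \<and> character (scl H) (cou H) \<and>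
     tensor_eq (scl H) (scl H) (cop H 1) [(1, 1)] \<and>
     (\<forall>a b. tensor_eq (scl H) (scl H) (cop H (a * b))
        [(a1 * b1, a2 * b2). (a1, a2) \<leftarrow> cop H a, (b1, b2) \<leftarrow> cop H b]) \<and>
     is_antipode H (antip H)"

definition left_ideal :: "'a::ring_1 set \<Rightarrow> bool" where
  "left_ideal L \<longleftrightarrow> 0 \<in> L \<and> (\<forall>a\<in>L. \<forall>b\<in>L. a + b \<in> L) \<and> (\<forall>r. \<forall>a\<in>L. r * a \<in> L)"

text \<open>Semisimplicity of the underlying algebra: the left regular module is semisimple.\<close>

definition semisimple_hopf_algebra :: "('k::field, 'h::ring_1) hopf \<Rightarrow> bool" where
  "semisimple_hopf_algebra H \<longleftrightarrow> hopf_algebra H \<and>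
     (\<forall>L :: 'h set. left_ideal L \<longrightarrow>
        (\<exists>M. left_ideal M \<and> L \<inter> M = {0} \<and> {a + b | a b. a \<in> L \<and> b \<in> M} = UNIV))"

definition group_like :: "('k::field, 'a::ring_1, 'z) coalg_scheme \<Rightarrow> 'a \<Rightarrow> bool" where
  "group_like C g \<longleftrightarrow> g \<noteq> 0 \<and> tensor_eq (scl C) (scl C) (cop C g) [(g, g)]"

definition conv :: "('k::field, 'a, 'z) coalg_scheme \<Rightarrow> ('a \<Rightarrow> 'k) \<Rightarrow> ('a \<Rightarrow> 'k) \<Rightarrow> 'a \<Rightarrow> 'k" where
  "conv C f f' = (\<lambda>a. \<Sum>(u, v)\<leftarrow>cop C a. f u * f' v)"

primrec conv_pow :: "('k::field, 'a, 'z) coalg_scheme \<Rightarrow> ('a \<Rightarrow> 'k) \<Rightarrow> nat \<Rightarrow> 'a \<Rightarrow> 'k" where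
  "conv_pow C f 0 = cou C"
| "conv_pow C f (Suc n) = conv C f (conv_pow C f n)"

section \<open>Presented algebras on two generators\<close>

datatype idx = One | Two

text \<open>
  The free algebra on two generators is the algebra of the free monoid; the monoid operation on
  words is written additively because multiplication of polynomial mappings adds keys.
\<close>

datatype idx_word = Word (letters: "idx list")

instantiation idx_word :: monoid_add
begin

definition zero_idx_word :: idx_word where
  "0 = Word []"

definition plus_idx_word :: "idx_word \<Rightarrow> idx_word \<Rightarrow> idx_word" where
  "v + w = Word (letters v @ letters w)"

instance
  by standard (simp_all add: zero_idx_word_def plus_idx_word_def)

end

type_synonym 'k free_algebra = "idx_word \<Rightarrow>\<^sub>0 'k"

definition free_scl :: "'k::field \<Rightarrow> 'k free_algebra \<Rightarrow> 'k free_algebra" where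
  "free_scl c p = Poly_Mapping.single 0 c * p"

definition free_gen :: "idx \<Rightarrow> ('k::field) free_algebra" where
  "free_gen i = Poly_Mapping.single (Word [i]) 1"

definition free_eval ::
  "('k::field \<Rightarrow> 'a::ring_1 \<Rightarrow> 'a) \<Rightarrow> (idx \<Rightarrow> 'a) \<Rightarrow> 'k free_algebra \<Rightarrow> 'a" where
  "free_eval s x p =
     (\<Sum>w\<in>Poly_Mapping.keys p. s (Poly_Mapping.lookup p w) (prod_list (map x (letters w))))"

definition ideal_generated :: "'a::ring_1 set \<Rightarrow> 'a set" where
  "ideal_generated R =
     \<Inter> {I. R \<subseteq> I \<and> 0 \<in> I \<and> (\<forall>a\<in>I. \<forall>b\<in>I. a + b \<in> I) \<and> (\<forall>r. \<forall>a\<in>I. r * a \<in> I \<and> a * r \<in> I)}"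

definition presented_by ::
  "('k::field \<Rightarrow> 'a::ring_1 \<Rightarrow> 'a) \<Rightarrow> (idx \<Rightarrow> 'a) \<Rightarrow> 'k free_algebra set \<Rightarrow> bool" where
  "presented_by s x R \<longleftrightarrow>
     algebra_over s \<and> surj (free_eval s x) \<and> {p. free_eval s x p = 0} = ideal_generated R"

definition gen12 :: "('k \<Rightarrow> 'a::ring_1 \<Rightarrow> 'a) \<Rightarrow> 'k \<Rightarrow> (idx \<Rightarrow> 'a) \<Rightarrow> 'a" where
  "gen12 s q x = x One * x Two - s q (x Two * x One)"

definition gen112 :: "('k::field \<Rightarrow> 'a::ring_1 \<Rightarrow> 'a) \<Rightarrow> 'k \<Rightarrow> (idx \<Rightarrow> 'a) \<Rightarrow> 'a" where
  "gen112 s q x = x One * gen12 s q x - s (q\<^sup>2) (gen12 s q x * x One)"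

definition gen122 :: "('k::field \<Rightarrow> 'a::ring_1 \<Rightarrow> 'a) \<Rightarrow> 'k \<Rightarrow> (idx \<Rightarrow> 'a) \<Rightarrow> 'a" where
  "gen122 s q x = gen12 s q x * x Two - s (q\<^sup>2) (x Two * gen12 s q x)"

definition A2_relations :: "'k::field \<Rightarrow> 'k \<Rightarrow> 'k \<Rightarrow> 'k \<Rightarrow> 'k \<Rightarrow> 'k \<Rightarrow> 'k free_algebra set" where
  "A2_relations q l1 l2 l12 l112 l122 =
     {free_gen One ^ 3 - free_scl l1 1,
      free_gen Two ^ 3 - free_scl l2 1,
      gen12 free_scl q free_gen ^ 3 - free_scl l12 1,
      gen112 free_scl q free_gen - free_scl l112 1,
      gen122 free_scl q free_gen - free_scl l122 1}"

definition pbw ::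
  "('k \<Rightarrow> 'a::ring_1 \<Rightarrow> 'a) \<Rightarrow> 'k \<Rightarrow> (idx \<Rightarrow> 'a) \<Rightarrow> nat \<times> nat \<times> nat \<Rightarrow> 'a" where
  "pbw s q x = (\<lambda>(n2, n12, n1). x Two ^ n2 * gen12 s q x ^ n12 * x One ^ n1)"

definition pbw_exponents :: "(nat \<times> nat \<times> nat) set" where
  "pbw_exponents = {..2} \<times> {..2} \<times> {..2}"

definition pbw_basis :: "('k::field \<Rightarrow> 'a::ring_1 \<Rightarrow> 'a) \<Rightarrow> 'k \<Rightarrow> (idx \<Rightarrow> 'a) \<Rightarrow> bool" where
  "pbw_basis s q x \<longleftrightarrow>
     inj_on (pbw s q x) pbw_exponents \<and>
     \<not> module.dependent s (pbw s q x ` pbw_exponents) \<and>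
     module.span s (pbw s q x ` pbw_exponents) = UNIV"

section \<open>Hopf algebras in the category of Yetter--Drinfeld modules\<close>

record ('k, 'a, 'h) yd_hopf = "('k, 'a) coalg" +
  act :: "'h \<Rightarrow> 'a \<Rightarrow> 'a"
  coact :: "'a \<Rightarrow> ('h \<times> 'a) list"

definition yd_module ::
  "('k::field, 'h::ring_1) hopf \<Rightarrow> ('k, 'a::ring_1, 'h) yd_hopf \<Rightarrow> bool" where
  "yd_module H B \<longleftrightarrow>
     (\<forall>h. Vector_Spaces.linear (scl B) (scl B) (act B h)) \<and>
     (\<forall>a. Vector_Spaces.linear (scl H) (scl B) (\<lambda>h. act B h a)) \<and>
     (\<forall>a. act B 1 a = a) \<and>
     (\<forall>h h' a. act B (h * h') a = act B h (act B h' a)) \<and>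
     (\<forall>a b. tensor_eq (scl H) (scl B) (coact B (a + b)) (coact B a @ coact B b)) \<and>
     (\<forall>c a. tensor_eq (scl H) (scl B) (coact B (scl B c a))
        [(h, scl B c u). (h, u) \<leftarrow> coact B a]) \<and>
     (\<forall>a. tensor3_eq (scl H) (scl H) (scl B)
        [(h1, h2, u). (h, u) \<leftarrow> coact B a, (h1, h2) \<leftarrow> cop H h]
        [(h, h', v). (h, u) \<leftarrow> coact B a, (h', v) \<leftarrow> coact B u]) \<and>
     (\<forall>a. (\<Sum>(h, u)\<leftarrow>coact B a. scl B (cou H h) u) = a) \<and>
     (\<forall>h a. tensor_eq (scl H) (scl B) (coact B (act B h a))
        [(h1 * k * antip H h3, act B h2 u). (h1, h2, h3) \<leftarrow> cop3 H h, (k, u) \<leftarrow> coact B a])"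

definition yd_algebra ::
  "('k::field, 'h::ring_1) hopf \<Rightarrow> ('k, 'a::ring_1, 'h) yd_hopf \<Rightarrow> bool" where
  "yd_algebra H B \<longleftrightarrow>
     algebra_over (scl B) \<and>
     (\<forall>h. act B h 1 = scl B (cou H h) 1) \<and>
     (\<forall>h a b. act B h (a * b) = (\<Sum>(h1, h2)\<leftarrow>cop H h. act B h1 a * act B h2 b)) \<and>
     tensor_eq (scl H) (scl B) (coact B 1) [(1, 1)] \<and>
     (\<forall>a b. tensor_eq (scl H) (scl B) (coact B (a * b))
        [(h * k, u * v). (h, u) \<leftarrow> coact B a, (k, v) \<leftarrow> coact B b])"

definition yd_coalgebra ::
  "('k::field, 'h::ring_1) hopf \<Rightarrow> ('k, 'a::ring_1, 'h) yd_hopf \<Rightarrow> bool" where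
  "yd_coalgebra H B \<longleftrightarrow>
     coalgebra B \<and>
     (\<forall>h a. cou B (act B h a) = cou H h * cou B a) \<and>
     (\<forall>h a. tensor_eq (scl B) (scl B) (cop B (act B h a))
        [(act B h1 u, act B h2 v). (h1, h2) \<leftarrow> cop H h, (u, v) \<leftarrow> cop B a]) \<and>
     (\<forall>a. (\<Sum>(h, u)\<leftarrow>coact B a. scl H (cou B u) h) = scl H (cou B a) 1) \<and>
     (\<forall>a. tensor3_eq (scl H) (scl B) (scl B)
        [(h, u, v). (h, b) \<leftarrow> coact B a, (u, v) \<leftarrow> cop B b]
        [(h * k, u', v'). (u, v) \<leftarrow> cop B a, (h, u') \<leftarrow> coact B u, (k, v') \<leftarrow> coact B v])"

definition braided_cop :: "('k, 'a, 'h) yd_hopf \<Rightarrow> 'a \<Rightarrow> 'a \<Rightarrow> (('a \<times> 'a) \<times> ('a \<times> 'a)) list" where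
  "braided_cop B a b =
     [((a1, act B h b1), (a20, b2)).
        (a1, a2) \<leftarrow> cop B a, (b1, b2) \<leftarrow> cop B b, (h, a20) \<leftarrow> coact B a2]"

definition braided_hopf_algebra ::
  "('k::field, 'h::ring_1) hopf \<Rightarrow> ('k, 'a::ring_1, 'h) yd_hopf \<Rightarrow> bool" where
  "braided_hopf_algebra H B \<longleftrightarrow>
     yd_module H B \<and> yd_algebra H B \<and> yd_coalgebra H B \<and>
     character (scl B) (cou B) \<and>
     tensor_eq (scl B) (scl B) (cop B 1) [(1, 1)] \<and>
     (\<forall>a b. tensor_eq (scl B) (scl B) (cop B (a * b))
        [(u * v, u' * v'). ((u, v), (u', v')) \<leftarrow> braided_cop B a b]) \<and>
     (\<exists>S. is_antipode B S)"

definition principal_yd_realization ::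
  "('k::field, 'h::ring_1) hopf \<Rightarrow> (idx \<Rightarrow> 'h) \<Rightarrow> (idx \<Rightarrow> 'h \<Rightarrow> 'k) \<Rightarrow> (idx \<Rightarrow> idx \<Rightarrow> 'k) \<Rightarrow> bool" where
  "principal_yd_realization H g chi Q \<longleftrightarrow>
     (\<forall>i. group_like H (g i) \<and> character (scl H) (chi i) \<and>
        (\<forall>h. scl H (chi i h) (g i) =
           (\<Sum>(h1, h2, h3)\<leftarrow>cop3 H h. scl H (chi i h2) (h1 * g i * antip H h3)))) \<and>
     (\<forall>i j. chi j (g i) = Q i j)"

text \<open>
  The Nichols algebra of the braided vector space with all entries of the braiding matrix equal to
  a primitive cube root of unity \<open>q\<close>, via its presentation. The action, the coaction and the
  coproduct are determined by their values on the generators.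
\<close>

definition nichols_algebra_A2 ::
  "'k::field \<Rightarrow> ('k, 'h::ring_1) hopf \<Rightarrow> (idx \<Rightarrow> 'h) \<Rightarrow> (idx \<Rightarrow> 'h \<Rightarrow> 'k) \<Rightarrow>
   ('k, 'a::ring_1, 'h) yd_hopf \<Rightarrow> (idx \<Rightarrow> 'a) \<Rightarrow> bool" where
  "nichols_algebra_A2 q H g chi B x \<longleftrightarrow>
     braided_hopf_algebra H B \<and>
     presented_by (scl B) x (A2_relations q 0 0 0 0 0) \<and>
     pbw_basis (scl B) q x \<and>
     (\<forall>i h. act B h (x i) = scl B (chi i h) (x i)) \<and>
     (\<forall>i. tensor_eq (scl H) (scl B) (coact B (x i)) [(g i, x i)]) \<and>
     (\<forall>i. tensor_eq (scl B) (scl B) (cop B (x i)) [(x i, 1), (1, x i)])"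

section \<open>The cocycle attached to a deformation\<close>

definition admissible ::
  "('k::field, 'h::ring_1) hopf \<Rightarrow> (idx \<Rightarrow> 'h \<Rightarrow> 'k) \<Rightarrow> 'k \<Rightarrow> 'k \<Rightarrow> 'k \<Rightarrow> 'k \<Rightarrow> 'k \<Rightarrow> bool" where
  "admissible H chi l1 l2 l12 l112 l122 \<longleftrightarrow>
     (l1 \<noteq> 0 \<longrightarrow> conv_pow H (chi One) 3 = cou H) \<and>
     (l2 \<noteq> 0 \<longrightarrow> conv_pow H (chi Two) 3 = cou H) \<and>
     (l12 \<noteq> 0 \<longrightarrow> conv_pow H (conv H (chi One) (chi Two)) 3 = cou H) \<and>
     (l112 \<noteq> 0 \<longrightarrow> conv H (conv_pow H (chi One) 2) (chi Two) = cou H) \<and>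
     (l122 \<noteq> 0 \<longrightarrow> conv H (chi One) (conv_pow H (chi Two) 2) = cou H)"

definition deformed_algebra ::
  "'k::field \<Rightarrow> 'k \<Rightarrow> 'k \<Rightarrow> 'k \<Rightarrow> 'k \<Rightarrow> 'k \<Rightarrow> ('k \<Rightarrow> 'e::ring_1 \<Rightarrow> 'e) \<Rightarrow> (idx \<Rightarrow> 'e) \<Rightarrow> bool" where
  "deformed_algebra q l1 l2 l12 l112 l122 s y \<longleftrightarrow>
     presented_by s y (A2_relations q l1 l2 l12 l112 l122) \<and> pbw_basis s q y"

definition is_eps0 ::
  "'k::field \<Rightarrow> ('k \<Rightarrow> 'e::ring_1 \<Rightarrow> 'e) \<Rightarrow> (idx \<Rightarrow> 'e) \<Rightarrow> ('e \<Rightarrow> 'k) \<Rightarrow> bool" where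
  "is_eps0 q s y f \<longleftrightarrow>
     linear_form s f \<and> f 1 = 1 \<and> (\<forall>n \<in> pbw_exponents - {(0, 0, 0)}. f (pbw s q y n) = 0)"

definition is_section ::
  "'k::field \<Rightarrow> 'k \<Rightarrow> 'k \<Rightarrow> ('k \<Rightarrow> 'b::ring_1 \<Rightarrow> 'b) \<Rightarrow> (idx \<Rightarrow> 'b) \<Rightarrow>
   ('k \<Rightarrow> 'e::ring_1 \<Rightarrow> 'e) \<Rightarrow> (idx \<Rightarrow> 'e) \<Rightarrow> ('b \<Rightarrow> 'e) \<Rightarrow> bool" where
  "is_section q l1 l112 sB x s y \<gamma> \<longleftrightarrow>
     Vector_Spaces.linear sB s \<gamma> \<and>
     (let X = pbw sB q x; Y = pbw s q y in
        \<gamma> (X (0,2,0)) = Y (0,2,0) - s ((q\<^sup>2 - q) * l112) (Y (1,0,0)) \<and>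
        \<gamma> (X (0,2,1)) = Y (0,2,1) + s (3 * q\<^sup>2 * l1) (Y (2,0,0))
                          - s ((q\<^sup>2 - q) * l112) (Y (1,0,1)) \<and>
        \<gamma> (X (0,1,2)) = Y (0,1,2) - s ((q\<^sup>2 - q) * l1) (Y (1,0,0)) \<and>
        \<gamma> (X (1,2,0)) = Y (1,2,0) - s ((q\<^sup>2 - q) * l112) (Y (2,0,0)) \<and>
        \<gamma> (X (1,1,2)) = Y (1,1,2) - s ((q\<^sup>2 - q) * l1) (Y (2,0,0)) \<and>
        \<gamma> (X (1,2,1)) = Y (1,2,1) - s ((q\<^sup>2 - q) * l112) (Y (2,0,1)) \<and>
        \<gamma> (X (0,2,2)) = Y (0,2,2) - s (3 * q * l1) (Y (2,0,1)) - s ((q - q\<^sup>2) * l1) (Y (1,1,0))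
                          - s ((q\<^sup>2 - q) * l112) (Y (1,0,2)) \<and>
        \<gamma> (X (1,2,2)) = Y (1,2,2) - s ((q - q\<^sup>2) * l1) (Y (2,1,0))
                          - s ((q\<^sup>2 - q) * l112) (Y (2,0,2)) \<and>
        (\<forall>n \<in> pbw_exponents - {(0,2,0), (0,2,1), (0,1,2), (1,2,0),
                                (1,1,2), (1,2,1), (0,2,2), (1,2,2)}. \<gamma> (X n) = Y n))"

section \<open>Braided Hopf 2-cocycles and Hochschild 2-cocycles\<close>

text \<open>Linear maps on \<open>B \<otimes> B\<close> are bilinear forms on \<open>B\<close>.\<close>

definition conv2 ::
  "('k::field, 'a, 'h) yd_hopf \<Rightarrow> ('a \<Rightarrow> 'a \<Rightarrow> 'k) \<Rightarrow> ('a \<Rightarrow> 'a \<Rightarrow> 'k) \<Rightarrow> 'a \<Rightarrow> 'a \<Rightarrow> 'k" where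
  "conv2 B \<sigma> \<tau> = (\<lambda>a b. \<Sum>((u, v), (u', v'))\<leftarrow>braided_cop B a b. \<sigma> u v * \<tau> u' v')"

definition conv2_unit :: "('k::field, 'a, 'h) yd_hopf \<Rightarrow> 'a \<Rightarrow> 'a \<Rightarrow> 'k" where
  "conv2_unit B = (\<lambda>a b. cou B a * cou B b)"

primrec conv2_pow ::
  "('k::field, 'a, 'h) yd_hopf \<Rightarrow> ('a \<Rightarrow> 'a \<Rightarrow> 'k) \<Rightarrow> nat \<Rightarrow> 'a \<Rightarrow> 'a \<Rightarrow> 'k" where
  "conv2_pow B \<eta> 0 = conv2_unit B"
| "conv2_pow B \<eta> (Suc n) = conv2 B \<eta> (conv2_pow B \<eta> n)"

text \<open>
  The exponential series is finite at every pair of arguments when \<open>\<eta>\<close> vanishes as soon as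
  one argument is \<open>1\<close>; \<^const>\<open>Sum_any\<close> sums the non-zero terms.
\<close>

definition conv2_exp ::
  "('k::field_char_0, 'a, 'h) yd_hopf \<Rightarrow> ('a \<Rightarrow> 'a \<Rightarrow> 'k) \<Rightarrow> 'a \<Rightarrow> 'a \<Rightarrow> 'k" where
  "conv2_exp B \<eta> = (\<lambda>a b. Sum_any (\<lambda>k. conv2_pow B \<eta> k a b / fact k))"

definition H_linear2 ::
  "('k::field, 'h) hopf \<Rightarrow> ('k, 'a::ring_1, 'h) yd_hopf \<Rightarrow> ('a \<Rightarrow> 'a \<Rightarrow> 'k) \<Rightarrow> bool" where
  "H_linear2 H B \<sigma> \<longleftrightarrow> bilinear_form (scl B) (scl B) \<sigma> \<and>
     (\<forall>h a b. (\<Sum>(h1, h2)\<leftarrow>cop H h. \<sigma> (act B h1 a) (act B h2 b)) = cou H h * \<sigma> a b)"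

definition hopf_2_cocycles ::
  "('k::field, 'h) hopf \<Rightarrow> ('k, 'a::ring_1, 'h) yd_hopf \<Rightarrow> ('a \<Rightarrow> 'a \<Rightarrow> 'k) set" where
  "hopf_2_cocycles H B = {\<sigma>. H_linear2 H B \<sigma> \<and>
     (\<exists>\<tau>. bilinear_form (scl B) (scl B) \<tau> \<and>
        conv2 B \<sigma> \<tau> = conv2_unit B \<and> conv2 B \<tau> \<sigma> = conv2_unit B) \<and>
     (\<forall>a. \<sigma> a 1 = cou B a \<and> \<sigma> 1 a = cou B a) \<and>
     (\<forall>a b c. conv2 B \<sigma> (\<lambda>u v. \<sigma> (u * v) c) a b = conv2 B \<sigma> (\<lambda>u v. \<sigma> a (u * v)) b c)}"

definition conv_inverse ::
  "('k::field, 'a::ring_1, 'z) coalg_scheme \<Rightarrow> ('a \<Rightarrow> 'k) \<Rightarrow> ('a \<Rightarrow> 'k) \<Rightarrow> bool" where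
  "conv_inverse C \<alpha> \<beta> \<longleftrightarrow>
     linear_form (scl C) \<beta> \<and> conv C \<alpha> \<beta> = cou C \<and> conv C \<beta> \<alpha> = cou C"

definition H_linear_units ::
  "('k::field, 'h) hopf \<Rightarrow> ('k, 'a::ring_1, 'h) yd_hopf \<Rightarrow> ('a \<Rightarrow> 'k) set" where
  "H_linear_units H B = {\<alpha>. linear_form (scl B) \<alpha> \<and>
     (\<forall>h a. \<alpha> (act B h a) = cou H h * \<alpha> a) \<and> (\<exists>\<beta>. conv_inverse B \<alpha> \<beta>)}"

definition gauge ::
  "('k::field, 'a::ring_1, 'h) yd_hopf \<Rightarrow> ('a \<Rightarrow> 'k) \<Rightarrow> ('a \<Rightarrow> 'a \<Rightarrow> 'k) \<Rightarrow> 'a \<Rightarrow> 'a \<Rightarrow> 'k" where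
  "gauge B \<alpha> \<sigma> =
     conv2 B (conv2 B (\<lambda>a b. \<alpha> a * \<alpha> b) \<sigma>) (\<lambda>a b. (THE \<beta>. conv_inverse B \<alpha> \<beta>) (a * b))"

definition positive_part ::
  "('k::field \<Rightarrow> 'a::ring_1 \<Rightarrow> 'a) \<Rightarrow> (idx \<Rightarrow> 'a) \<Rightarrow> 'a set" where
  "positive_part s x = module.span s {prod_list (map x w) | w. w \<noteq> []}"

definition hochschild_2_cocycles ::
  "('k::field, 'h) hopf \<Rightarrow> ('k, 'a::ring_1, 'h) yd_hopf \<Rightarrow> (idx \<Rightarrow> 'a) \<Rightarrow> ('a \<Rightarrow> 'a \<Rightarrow> 'k) set" where
  "hochschild_2_cocycles H B x = {\<eta>. H_linear2 H B \<eta> \<and>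
     (\<forall>a. \<eta> 1 a = 0 \<and> \<eta> a 1 = 0) \<and>
     (\<forall>a \<in> positive_part (scl B) x. \<forall>c \<in> positive_part (scl B) x. \<forall>b. \<eta> a (b * c) = \<eta> (a * b) c)}"

definition exponential_cocycle ::
  "('k::field_char_0, 'h) hopf \<Rightarrow> ('k, 'a::ring_1, 'h) yd_hopf \<Rightarrow> (idx \<Rightarrow> 'a) \<Rightarrow>
   ('a \<Rightarrow> 'a \<Rightarrow> 'k) \<Rightarrow> bool" where
  "exponential_cocycle H B x \<sigma> \<longleftrightarrow>
     (\<exists>\<alpha> \<in> H_linear_units H B. \<exists>\<eta> \<in> hochschild_2_cocycles H B x. gauge B \<alpha> \<sigma> = conv2_exp B \<eta>)"

end

theory Submission
  imports Defs
begin

text \<open>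
  Pulled back to words in two letters, a Hopf 2-cocycle \<open>\<sigma>\<close> becomes a coboundary
  \<open>(\<phi> \<otimes> \<phi>)\<^sup>-\<^sup>1 * (\<phi> \<circ> m)\<close>, where \<open>\<phi>\<close> is the counit of the algebra twisted by \<open>\<sigma>\<close> and hence
  satisfies the deformed relations; a gauge transformation multiplies \<open>\<phi>\<close> by a functional on \<open>B\<close>,
  which preserves these relations. If the gauged coboundary is \<open>e\<^sup>\<eta>\<close>, then comparing the ways to cut
  words of length six shows that the degree three part of \<open>\<phi>\<close> is the cube of a linear form, and words
  of length nine show that its degree six part contributes nothing new to \<open>\<lambda>\<^sub>1\<^sub>2\<close> unless this cube
  vanishes. This forces the conditions on the parameters. Conversely, the powers of a cube of a
  linear form give the coboundary \<open>1 + \<eta> = e\<^sup>\<eta>\<close> with \<open>\<eta> * \<eta> = 0\<close>, and if only \<open>\<lambda>\<^sub>1\<^sub>2\<close> is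
  non-zero, then \<open>\<sigma>\<close> itself equals \<open>1 + \<eta> + \<eta> * \<eta> / 2 = e\<^sup>\<eta>\<close> for its degree six part \<open>\<eta>\<close>.
\<close>

section \<open>The braided coproduct of words\<close>

text \<open>All entries of the braiding matrix equal q, so words braid by the flip times q to the
  product of their lengths, and the coproduct of a word is a weighted sum over subwords. H-linear
  functionals live in lengths divisible by three, where products f(u) f'(v) convolve factor by
  factor. The obstacle is that \<eta> is unknown. By the Hochschild identity it depends on two
  nonempty words only through their concatenation, so two cuts of one word contain the same unknown
  value, and their difference is a relation in lower degrees. Length six gives quadrics solved by c
  times the cube of a linear form with coefficients m1, m2; the parameters of degree three are the
  coefficients c m1^3, 3 c m1^2 m2, 3 c m1 m2^2, c m2^3, whence condition (b). The factor q^2 - q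
  there comes from (1 - q)^3 = 3 (q^2 - q), the value of (x1 x2 - q x2 x1)^3 when x1 x2 and x2 x1
  are both replaced by 1. With \<lambda>12 alone the functional starts in degree six and is no cube;
  there \<phi> behaves like the exponential of \<open>z_form\<close>, which works because
  \<open>z_form\<close> commutes with enough functionals under convolution.\<close>

locale word_split =
  fixes q :: "'k::field_char_0"
  assumes q_cube: "q ^ 3 = 1" and q_neq_1: "q \<noteq> 1"
begin

lemma q_sum: "q\<^sup>2 + q + 1 = 0"
proof -
  have "(q - 1) * (q\<^sup>2 + q + 1) = 0"
    using q_cube by (simp add: algebra_simps power2_eq_square power3_eq_cube)
  then show ?thesis using q_neq_1 by simp
qed

lemma q_square: "q * q = - 1 - q"
  using q_sum by (simp add: power2_eq_square algebra_simps eq_neg_iff_add_eq_0)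

text \<open>Together with \<open>q_square\<close> this reduces polynomials in q to the basis 1, q
  inside nested products; the explicit word computations below are decided in this way.\<close>

lemma q_mult_left: "q * (q * c) = - c - q * c"
proof -
  have "q * (q * c) = (q * q) * c" by simp
  then show ?thesis by (simp only: q_square) (simp add: algebra_simps)
qed

lemma q_power_dvd: "3 dvd n \<Longrightarrow> q ^ n = 1"
  by (auto simp: dvd_def power_mult q_cube)

lemma q_power_mod: "q ^ n = q ^ (n mod 3)"
proof -
  have "q ^ n = q ^ (3 * (n div 3) + n mod 3)" by simp
  also have "\<dots> = q ^ (n mod 3)" by (simp only: power_add q_power_dvd dvd_triv_left mult_1_left)
  finally show ?thesis .
qed

lemma q_power_eq_1_iff: "q ^ n = 1 \<longleftrightarrow> 3 dvd n"
proof
  assume *: "q ^ n = 1"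
  have "n mod 3 = 0 \<or> n mod 3 = 1 \<or> n mod 3 = 2" by linarith
  moreover have "q\<^sup>2 \<noteq> 1"
    using q_cube q_neq_1 by (metis mult_1_left numeral_2_eq_2 numeral_3_eq_3 power_Suc power_Suc2)
  ultimately show "3 dvd n"
    using * q_power_mod[of n] q_neq_1 by (auto simp: dvd_eq_mod_eq_0)
qed (rule q_power_dvd)

text \<open>
  \<open>wsplit w F\<close> is \<open>F\<close> applied to the coproduct of the word \<open>w\<close> in the tensor algebra of \<open>V\<close>:
  a letter that goes to the right factor is moved past the letters of the left factor behind it.
\<close>

primrec wsplit :: "idx list \<Rightarrow> (idx list \<Rightarrow> idx list \<Rightarrow> 'k) \<Rightarrow> 'k" where
  "wsplit [] = (\<lambda>F. F [] [])"
| "wsplit (i # w) =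
     (\<lambda>F. wsplit w (\<lambda>a b. F (i # a) b) + wsplit w (\<lambda>a b. q ^ length a * F a (i # b)))"

declare wsplit.simps [simp del]

lemma wsplit_Nil [simp]: "wsplit [] F = F [] []"
  by (simp add: wsplit.simps)

lemma wsplit_Cons:
  "wsplit (i # w) F = wsplit w (\<lambda>a b. F (i # a) b) + wsplit w (\<lambda>a b. q ^ length a * F a (i # b))"
  by (simp add: wsplit.simps)

lemma wsplit_cong:
  assumes "\<And>a b. length a + length b = length w \<Longrightarrow> F a b = G a b"
  shows "wsplit w F = wsplit w G"
  using assms
proof (induction w arbitrary: F G)
  case (Cons i w)
  have "wsplit w (\<lambda>a b. F (i # a) b) = wsplit w (\<lambda>a b. G (i # a) b)"
    by (rule Cons.IH) (simp add: Cons.prems)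
  moreover have "wsplit w (\<lambda>a b. q ^ length a * F a (i # b)) = wsplit w (\<lambda>a b. q ^ length a * G a (i # b))"
    by (rule Cons.IH) (simp add: Cons.prems)
  ultimately show ?case by (simp add: wsplit_Cons)
qed simp

lemma wsplit_0 [simp]: "wsplit w (\<lambda>a b. 0) = 0"
  by (induction w) (simp_all add: wsplit_Cons)

lemma wsplit_eq_0:
  "(\<And>a b. length a + length b = length w \<Longrightarrow> F a b = 0) \<Longrightarrow> wsplit w F = 0"
  using wsplit_cong[of w F "\<lambda>a b. 0"] by simp

lemma wsplit_add: "wsplit w (\<lambda>a b. F a b + G a b) = wsplit w F + wsplit w G"
  by (induction w arbitrary: F G) (simp_all add: wsplit_Cons distrib_left algebra_simps)

lemma wsplit_mult_left: "wsplit w (\<lambda>a b. c * F a b) = c * wsplit w F"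
proof (induction w arbitrary: F)
  case (Cons i w)
  have "wsplit w (\<lambda>a b. q ^ length a * (c * F a (i # b)))
      = c * wsplit w (\<lambda>a b. q ^ length a * F a (i # b))"
    using Cons.IH[of "\<lambda>a b. q ^ length a * F a (i # b)"] by (simp add: mult.left_commute)
  then show ?case by (simp add: wsplit_Cons Cons.IH distrib_left)
qed simp

lemma wsplit_mult_right: "wsplit w (\<lambda>a b. F a b * c) = wsplit w F * c"
  using wsplit_mult_left[of w c F] by (simp add: mult.commute)

lemma wsplit_minus: "wsplit w (\<lambda>a b. - F a b) = - wsplit w F"
  using wsplit_mult_left[of w "- 1" F] by simp

lemma wsplit_diff: "wsplit w (\<lambda>a b. F a b - G a b) = wsplit w F - wsplit w G"
  using wsplit_add[of w F "\<lambda>a b. - G a b"] by (simp add: wsplit_minus)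

lemma wsplit_swap:
  "wsplit u (\<lambda>a b. wsplit v (\<lambda>c d. F a b c d)) = wsplit v (\<lambda>c d. wsplit u (\<lambda>a b. F a b c d))"
  by (induction u arbitrary: F) (simp_all add: wsplit_Cons wsplit_add wsplit_mult_left[symmetric])

lemma wsplit_left_Nil:
  "wsplit w (\<lambda>a b. (if a = [] then 1 else 0) * F b) = F w"
proof (induction w arbitrary: F)
  case (Cons i w)
  have "wsplit w (\<lambda>a b. q ^ length a * ((if a = [] then 1 else 0) * F (i # b))) =
      wsplit w (\<lambda>a b. (if a = [] then 1 else 0) * F (i # b))"
    by (rule wsplit_cong) simp
  then show ?case by (simp add: wsplit_Cons Cons.IH)
qed simp

lemma wsplit_right_Nil:
  "wsplit w (\<lambda>a b. F a * (if b = [] then 1 else 0)) = F w"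
proof (induction w arbitrary: F)
  case (Cons i w)
  then show ?case by (simp add: wsplit_Cons)
qed simp

text \<open>Coassociativity. The first letter lands in one of three factors; if it lands in the last
  it crosses the first two, and the weight for the unsplit left factor is the product of the weights
  for its two parts.\<close>

lemma wsplit_assoc:
  "wsplit w (\<lambda>a c. wsplit a (\<lambda>a b. F a b c)) = wsplit w (\<lambda>a b. wsplit b (\<lambda>b c. F a b c))"
proof (induction w arbitrary: F)
  case (Cons i w)
  have "wsplit (i # w) (\<lambda>a c. wsplit a (\<lambda>a b. F a b c)) =
     wsplit w (\<lambda>a c. wsplit a (\<lambda>a b. F (i # a) b c)) +
     wsplit w (\<lambda>a c. wsplit a (\<lambda>a b. q ^ length a * F a (i # b) c)) +
     wsplit w (\<lambda>a c. q ^ length a * wsplit a (\<lambda>a b. F a b (i # c)))"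
    by (simp add: wsplit_Cons wsplit_add)
  also have "wsplit w (\<lambda>a c. q ^ length a * wsplit a (\<lambda>a b. F a b (i # c))) =
     wsplit w (\<lambda>a c. wsplit a (\<lambda>a b. q ^ (length a + length b) * F a b (i # c)))"
    by (subst wsplit_mult_left[symmetric]) (intro wsplit_cong, simp)
  also have "wsplit w (\<lambda>a c. wsplit a (\<lambda>a b. F (i # a) b c)) +
     wsplit w (\<lambda>a c. wsplit a (\<lambda>a b. q ^ length a * F a (i # b) c)) +
     wsplit w (\<lambda>a c. wsplit a (\<lambda>a b. q ^ (length a + length b) * F a b (i # c))) =
     wsplit (i # w) (\<lambda>a b. wsplit b (\<lambda>b c. F a b c))"
    by (simp add: Cons.IH wsplit_Cons wsplit_add wsplit_mult_left[symmetric] power_add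
        mult.assoc distrib_left)
  finally show ?case .
qed simp

text \<open>Coproduct of the braided tensor product of the tensor algebra with itself: u2 passes v1,
  which in \<open>braided_cop\<close> happens through the action of the coaction of the second
  leg.\<close>

definition wsplit2 :: "idx list \<Rightarrow> idx list \<Rightarrow>
    (idx list \<Rightarrow> idx list \<Rightarrow> idx list \<Rightarrow> idx list \<Rightarrow> 'k) \<Rightarrow> 'k" where
  "wsplit2 u v G =
     wsplit u (\<lambda>u1 u2. wsplit v (\<lambda>v1 v2. q ^ (length u2 * length v1) * G u1 v1 u2 v2))"

lemma wsplit2_cong:
  assumes "\<And>a b c d. length a + length c = length u \<Longrightarrow> length b + length d = length v \<Longrightarrow>
    G a b c d = G' a b c d"
  shows "wsplit2 u v G = wsplit2 u v G'"
  unfolding wsplit2_def by (intro wsplit_cong) (simp add: assms)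

lemma wsplit2_eq_0:
  "(\<And>a b c d. length a + length c = length u \<Longrightarrow> length b + length d = length v \<Longrightarrow> G a b c d = 0)
    \<Longrightarrow> wsplit2 u v G = 0"
  using wsplit2_cong[of u v G "\<lambda>_ _ _ _. 0"] by (simp add: wsplit2_def)

lemma wsplit2_add:
  "wsplit2 u v (\<lambda>a b c d. G a b c d + G' a b c d) = wsplit2 u v G + wsplit2 u v G'"
  by (simp add: wsplit2_def distrib_left wsplit_add)

lemma wsplit2_mult_left: "wsplit2 u v (\<lambda>a b c d. r * G a b c d) = r * wsplit2 u v G"
  by (simp add: wsplit2_def mult.left_commute wsplit_mult_left)

lemma wsplit2_mult_right: "wsplit2 u v (\<lambda>a b c d. G a b c d * r) = wsplit2 u v G * r"
  using wsplit2_mult_left[of u v r G] by (simp add: mult.commute)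

lemma wsplit2_diff:
  "wsplit2 u v (\<lambda>a b c d. G a b c d - G' a b c d) = wsplit2 u v G - wsplit2 u v G'"
  using wsplit2_add[of u v G "\<lambda>a b c d. (- 1) * G' a b c d"]
  unfolding wsplit2_mult_left by simp

lemma wsplit2_Nil_left [simp]: "wsplit2 [] v G = wsplit v (\<lambda>c d. G [] c [] d)"
  by (simp add: wsplit2_def)

lemma wsplit2_Nil_right [simp]: "wsplit2 u [] G = wsplit u (\<lambda>a b. G a [] b [])"
  by (simp add: wsplit2_def)

lemma wsplit2_Cons:
  "wsplit2 (i # u) v G = wsplit2 u v (\<lambda>a b c d. G (i # a) b c d) +
     wsplit2 u v (\<lambda>a b c d. q ^ (length a + length b) * G a b (i # c) d)"
  by (simp add: wsplit2_def wsplit_Cons wsplit_mult_left[symmetric] power_add mult_ac)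

text \<open>Multiplicativity of the braided coproduct. The induction works because a letter of u
  that goes right crosses the letters of u1 and of v1 on both sides of the equation.\<close>

lemma wsplit_append:
  "wsplit (u @ v) F = wsplit2 u v (\<lambda>u1 v1 u2 v2. F (u1 @ v1) (u2 @ v2))"
proof (induction u arbitrary: F)
  case (Cons i u)
  then show ?case by (simp add: wsplit2_Cons wsplit_Cons)
qed simp

lemma wsplit2_assoc:
  "wsplit2 u v (\<lambda>a b a' b'. wsplit2 a b (\<lambda>c d c' d'. G c d c' d' a' b')) =
   wsplit2 u v (\<lambda>c d a b. wsplit2 a b (\<lambda>c' d' a' b'. G c d c' d' a' b'))"
proof -
  \<comment> \<open>Each part of u crosses the earlier parts of v: c' crosses d, and a' crosses d
    and d'. Both iterated splittings carry exactly this weight, so only coassociativity in u and in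
    v separately is left.\<close>
  let ?e = "\<lambda>c' a' d d'. q ^ (length c' * length d + length a' * length d + length a' * length d')"
  have "wsplit2 u v (\<lambda>a b a' b'. wsplit2 a b (\<lambda>c d c' d'. G c d c' d' a' b')) =
     wsplit u (\<lambda>a a'. wsplit v (\<lambda>b b'. wsplit a (\<lambda>c c'. wsplit b (\<lambda>d d'. ?e c' a' d d' * G c d c' d' a' b'))))"
    unfolding wsplit2_def wsplit_mult_left[symmetric]
  proof (intro wsplit_cong, goal_cases)
    case (1 a a' b b' c c' d d')
    show ?case by (simp add: algebra_simps power_add flip: 1)
  qed
  also have "\<dots> = wsplit u (\<lambda>a a'. wsplit a (\<lambda>c c'. wsplit v (\<lambda>b b'. wsplit b (\<lambda>d d'. ?e c' a' d d' * G c d c' d' a' b'))))"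
    by (subst wsplit_swap) simp
  also have "\<dots> = wsplit u (\<lambda>c a. wsplit a (\<lambda>c' a'. wsplit v (\<lambda>d b. wsplit b (\<lambda>d' b'. ?e c' a' d d' * G c d c' d' a' b'))))"
    by (simp only: wsplit_assoc)
  also have "\<dots> = wsplit u (\<lambda>c a. wsplit v (\<lambda>d b. wsplit a (\<lambda>c' a'. wsplit b (\<lambda>d' b'. ?e c' a' d d' * G c d c' d' a' b'))))"
    by (subst wsplit_swap) simp
  also have "\<dots> = wsplit2 u v (\<lambda>c d a b. wsplit2 a b (\<lambda>c' d' a' b'. G c d c' d' a' b'))"
    unfolding wsplit2_def wsplit_mult_left[symmetric]
  proof (intro wsplit_cong, goal_cases)
    case (1 a a' b b' c c' d d')
    show ?case by (simp add: algebra_simps power_add flip: 1)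
  qed
  finally show ?thesis .
qed

section \<open>Convolution algebras of functionals on words and on pairs of words\<close>

definition word_conv :: "(idx list \<Rightarrow> 'k) \<Rightarrow> (idx list \<Rightarrow> 'k) \<Rightarrow> idx list \<Rightarrow> 'k" where
  "word_conv f g w = wsplit w (\<lambda>a b. f a * g b)"

definition word_conv2 :: "(idx list \<Rightarrow> idx list \<Rightarrow> 'k) \<Rightarrow> (idx list \<Rightarrow> idx list \<Rightarrow> 'k) \<Rightarrow>
    idx list \<Rightarrow> idx list \<Rightarrow> 'k" where
  "word_conv2 s t u v = wsplit2 u v (\<lambda>a b c d. s a b * t c d)"

definition word_unit :: "idx list \<Rightarrow> 'k" where
  "word_unit w = (if w = [] then 1 else 0)"

definition word_unit2 :: "idx list \<Rightarrow> idx list \<Rightarrow> 'k" where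
  "word_unit2 u v = word_unit u * word_unit v"

lemma word_conv_assoc: "word_conv (word_conv f g) h = word_conv f (word_conv g h)"
proof
  fix w
  have "word_conv (word_conv f g) h w = wsplit w (\<lambda>a c. wsplit a (\<lambda>a b. f a * g b * h c))"
    by (simp add: word_conv_def wsplit_mult_right)
  also have "\<dots> = wsplit w (\<lambda>a b. wsplit b (\<lambda>b c. f a * g b * h c))"
    by (rule wsplit_assoc)
  also have "\<dots> = word_conv f (word_conv g h) w"
    by (simp add: word_conv_def wsplit_mult_left mult.assoc)
  finally show "word_conv (word_conv f g) h w = word_conv f (word_conv g h) w" .
qed

lemma word_conv_unit [simp]: "word_conv word_unit f = f" "word_conv f word_unit = f"
  by (simp_all add: fun_eq_iff word_conv_def word_unit_def wsplit_left_Nil wsplit_right_Nil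
      del: mult_cancel_right1)

lemma word_conv2_assoc: "word_conv2 (word_conv2 r s) t = word_conv2 r (word_conv2 s t)"
proof (intro ext)
  fix u v
  have "word_conv2 (word_conv2 r s) t u v =
     wsplit2 u v (\<lambda>a b a' b'. wsplit2 a b (\<lambda>c d c' d'. r c d * s c' d' * t a' b'))"
    by (simp add: word_conv2_def wsplit2_mult_right)
  also have "\<dots> = wsplit2 u v (\<lambda>c d a b. wsplit2 a b (\<lambda>c' d' a' b'. r c d * s c' d' * t a' b'))"
    by (rule wsplit2_assoc)
  also have "\<dots> = word_conv2 r (word_conv2 s t) u v"
    by (simp add: word_conv2_def wsplit2_mult_left mult.assoc)
  finally show "word_conv2 (word_conv2 r s) t u v = word_conv2 r (word_conv2 s t) u v" .
qed

lemma word_conv2_unit_left [simp]: "word_conv2 word_unit2 s = s"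
proof (intro ext)
  fix u v
  have "word_conv2 word_unit2 s u v =
      wsplit u (\<lambda>a c. word_unit a * wsplit v (\<lambda>b d. word_unit b * s c d))"
    unfolding word_conv2_def wsplit2_def word_unit2_def wsplit_mult_left[symmetric]
    by (intro wsplit_cong) (simp add: word_unit_def)
  then show "word_conv2 word_unit2 s u v = s u v"
    by (simp add: word_unit_def wsplit_left_Nil)
qed

lemma word_conv2_unit_right [simp]: "word_conv2 s word_unit2 = s"
proof (intro ext)
  fix u v
  have "word_conv2 s word_unit2 u v =
      wsplit u (\<lambda>a c. wsplit v (\<lambda>b d. s a b * word_unit d) * word_unit c)"
    unfolding word_conv2_def wsplit2_def word_unit2_def wsplit_mult_right[symmetric]
    by (intro wsplit_cong) (simp add: word_unit_def)
  then show "word_conv2 s word_unit2 u v = s u v"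
    by (simp add: word_unit_def wsplit_right_Nil)
qed

end

section \<open>Functionals supported in lengths divisible by three\<close>

context word_split
begin

text \<open>The trace of H-linearity on words: a group-like \<open>g i\<close> acts on a word of
  length n by q^n, so an invariant functional vanishes unless 3 divides n.\<close>

definition supp3 :: "(idx list \<Rightarrow> 'k) \<Rightarrow> bool" where
  "supp3 f \<longleftrightarrow> (\<forall>w. f w \<noteq> 0 \<longrightarrow> 3 dvd length w)"

lemma word_conv2_append:
  "word_conv2 (\<lambda>u v. f (u @ v)) (\<lambda>u v. g (u @ v)) = (\<lambda>u v. word_conv f g (u @ v))"
  by (simp add: fun_eq_iff word_conv2_def word_conv_def wsplit_append)

text \<open>Only words b with f' b nonzero count, and for them the braiding weight, a power of q
  with exponent divisible by the length of b, is 1.\<close>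

lemma word_conv2_tensor:
  assumes "supp3 f'"
  shows "word_conv2 (\<lambda>u v. f u * f' v) (\<lambda>u v. g u * g' v) =
    (\<lambda>u v. word_conv f g u * word_conv f' g' v)"
proof (intro ext)
  fix u v
  have "word_conv2 (\<lambda>u v. f u * f' v) (\<lambda>u v. g u * g' v) u v =
     wsplit u (\<lambda>a c. wsplit v (\<lambda>b d. f a * g c * (f' b * g' d)))"
    unfolding word_conv2_def wsplit2_def
  proof (intro wsplit_cong, goal_cases)
    case (1 a c b d)
    show ?case
      using assms by (cases "f' b = 0") (simp_all add: supp3_def q_power_dvd)
  qed
  then show "word_conv2 (\<lambda>u v. f u * f' v) (\<lambda>u v. g u * g' v) u v = word_conv f g u * word_conv f' g' v"
    by (simp add: word_conv_def wsplit_mult_left wsplit_mult_right)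
qed

lemma word_conv2_tensor_left:
  assumes "supp3 f'"
  shows "word_conv2 (\<lambda>u v. f u * f' v) s u v =
    wsplit u (\<lambda>a c. wsplit v (\<lambda>b d. f a * f' b * s c d))"
  unfolding word_conv2_def wsplit2_def
proof (intro wsplit_cong, goal_cases)
  case (1 a c b d)
  show ?case
    using assms by (cases "f' b = 0") (simp_all add: supp3_def q_power_dvd)
qed

lemma supp3_word_conv:
  assumes "supp3 f" "supp3 g"
  shows "supp3 (word_conv f g)"
  unfolding supp3_def
proof (intro allI impI)
  fix w
  assume nz: "word_conv f g w \<noteq> 0"
  show "3 dvd length w"
  proof (rule ccontr)
    assume *: "\<not> 3 dvd length w"
    have "word_conv f g w = 0"
      unfolding word_conv_def
    proof (rule wsplit_eq_0)
      fix a b :: "idx list"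
      assume "length a + length b = length w"
      then have "\<not> (3 dvd length a \<and> 3 dvd length b)" using * by (metis dvd_add)
      then show "f a * g b = 0" using assms by (auto simp: supp3_def)
    qed
    with nz show False by simp
  qed
qed

text \<open>Convolution with f(u) f(v) is unitriangular in the total length: the summand with both
  first legs empty is X u v - Y u v, all others involve shorter pairs.\<close>

lemma word_conv2_left_cancel:
  assumes "f [] = 1"
    and eq: "word_conv2 (\<lambda>u v. f u * f v) X = word_conv2 (\<lambda>u v. f u * f v) Y"
  shows "X u v = Y u v"
proof (induction "length u + length v" arbitrary: u v rule: less_induct)
  case less
  have "0 = word_conv2 (\<lambda>u v. f u * f v) X u v - word_conv2 (\<lambda>u v. f u * f v) Y u v"
    using eq by simp
  also have "\<dots> = wsplit2 u v (\<lambda>a b c d. f a * f b * (X c d - Y c d))"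
    by (simp add: word_conv2_def wsplit2_diff right_diff_distrib)
  also have "\<dots> = wsplit2 u v (\<lambda>a b c d. word_unit2 a b * (X c d - Y c d))"
  proof (rule wsplit2_cong, goal_cases)
    case (1 a b c d)
    show ?case
    proof (cases "a = [] \<and> b = []")
      case True
      then show ?thesis by (simp add: word_unit2_def word_unit_def assms(1))
    next
      case False
      then have "length c + length d < length u + length v"
        using 1 by (cases a; cases b) auto
      then show ?thesis using less by simp
    qed
  qed
  also have "\<dots> = word_conv2 word_unit2 (\<lambda>u v. X u v - Y u v) u v"
    unfolding word_conv2_def ..
  finally show ?case by simp
qed

end

section \<open>Hopf 2-cocycles on words are coboundaries\<close>

locale word_cocycle = word_split q for q :: "'k::field_char_0" +
  fixes \<sigma> :: "idx list \<Rightarrow> idx list \<Rightarrow> 'k"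
  assumes \<sigma>_supp: "\<sigma> u v \<noteq> 0 \<Longrightarrow> 3 dvd length u + length v"
    and \<sigma>_Nil_left: "\<sigma> [] v = word_unit v"
    and \<sigma>_Nil_right: "\<sigma> u [] = word_unit u"
    and \<sigma>_cocycle: "wsplit2 a b (\<lambda>a1 b1 a2 b2. \<sigma> a1 b1 * \<sigma> (a2 @ b2) c) =
          wsplit2 b c (\<lambda>b1 c1 b2 c2. \<sigma> b1 c1 * \<sigma> a (b2 @ c2))"
begin

text \<open>\<open>star a b f\<close> evaluates \<open>f\<close> at the product of \<open>a\<close> and \<open>b\<close> twisted by \<open>\<sigma>\<close>.\<close>

definition star :: "idx list \<Rightarrow> idx list \<Rightarrow> (idx list \<Rightarrow> 'k) \<Rightarrow> 'k" where
  "star a b f = wsplit2 a b (\<lambda>a1 b1 a2 b2. \<sigma> a1 b1 * f (a2 @ b2))"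

text \<open>Transpose of left twisted multiplication by a letter. As x_i is primitive and
  \<sigma>(1, b) is the counit of b, the twisted product of x_i and b is x_i b + \<sigma>(x_i, b1)
  b2.\<close>

definition left_mult :: "idx \<Rightarrow> (idx list \<Rightarrow> 'k) \<Rightarrow> idx list \<Rightarrow> 'k" where
  "left_mult i f b = f (i # b) + wsplit b (\<lambda>b1 b2. \<sigma> [i] b1 * f b2)"

text \<open>\<open>twisted w f\<close> evaluates \<open>f\<close> at the twisted product of the letters of \<open>w\<close>.\<close>

primrec twisted :: "idx list \<Rightarrow> (idx list \<Rightarrow> 'k) \<Rightarrow> 'k" where
  "twisted [] = (\<lambda>f. f [])"
| "twisted (i # w) = (\<lambda>f. twisted w (left_mult i f))"

definition \<phi> :: "idx list \<Rightarrow> 'k" where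
  "\<phi> w = twisted w word_unit"

text \<open>The cocycle identity with a letter as first argument. If the letter goes to the second
  leg, \<sigma> is applied to the empty word, which forces A1 to be empty.\<close>

lemma cocycle_letter:
  "\<sigma> (i # A) B + wsplit A (\<lambda>A1 A2. \<sigma> [i] A1 * \<sigma> A2 B) =
   wsplit2 A B (\<lambda>A1 B1 A2 B2. \<sigma> A1 B1 * \<sigma> [i] (A2 @ B2))"
proof -
  have "wsplit2 [i] A (\<lambda>a1 b1 a2 b2. \<sigma> a1 b1 * \<sigma> (a2 @ b2) B) =
      wsplit A (\<lambda>A1 A2. \<sigma> [i] A1 * \<sigma> A2 B) +
      wsplit A (\<lambda>A1 A2. q ^ length A1 * (word_unit A1 * \<sigma> (i # A2) B))"
    by (simp add: wsplit2_Cons \<sigma>_Nil_left)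
  also have "wsplit A (\<lambda>A1 A2. q ^ length A1 * (word_unit A1 * \<sigma> (i # A2) B)) =
      wsplit A (\<lambda>A1 A2. (if A1 = [] then 1 else 0) * \<sigma> (i # A2) B)"
    by (rule wsplit_cong) (simp add: word_unit_def)
  finally show ?thesis
    by (simp add: \<sigma>_cocycle wsplit_left_Nil)
qed

text \<open>Associativity x_i (a b) = (x_i a) b of the twisted product, in dual form:
  \<open>cocycle_letter\<close> regroups the terms in which \<sigma> sees the letter, and the
  support of \<sigma> lets the letter pass the legs of \<sigma> with weight 1.\<close>

lemma star_left_mult:
  "star a b (left_mult i f) = left_mult i (\<lambda>a. star a b f) a"
proof -
  have 1: "wsplit2 a b (\<lambda>a1 b1 a2 b2. q ^ (length a1 + length b1) * (\<sigma> a1 b1 * f (i # a2 @ b2))) =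
      wsplit2 a b (\<lambda>a1 b1 a2 b2. \<sigma> a1 b1 * f (i # a2 @ b2))"
    by (rule wsplit2_cong) (metis \<sigma>_supp mult_1_left mult_zero_left mult_zero_right q_power_dvd)
  have "wsplit2 a b (\<lambda>a1 b1 a2 b2. \<sigma> a1 b1 * wsplit (a2 @ b2) (\<lambda>s1 s2. \<sigma> [i] s1 * f s2)) =
      wsplit2 a b (\<lambda>A B a' b'. wsplit2 A B (\<lambda>A1 B1 A2 B2. \<sigma> A1 B1 * (\<sigma> [i] (A2 @ B2) * f (a' @ b'))))"
    by (simp add: wsplit_append wsplit2_assoc wsplit2_mult_left)
  also have "\<dots> = wsplit2 a b (\<lambda>A B a' b'.
      (\<sigma> (i # A) B + wsplit A (\<lambda>A1 A2. \<sigma> [i] A1 * \<sigma> A2 B)) * f (a' @ b'))"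
    by (simp add: cocycle_letter wsplit2_mult_right[symmetric] mult.assoc)
  also have "\<dots> = wsplit2 a b (\<lambda>A B a' b'. \<sigma> (i # A) B * f (a' @ b')) +
      wsplit2 a b (\<lambda>A B a' b'. wsplit A (\<lambda>A1 A2. \<sigma> [i] A1 * \<sigma> A2 B * f (a' @ b')))"
    by (simp add: distrib_right wsplit2_add wsplit_mult_right)
  also have "wsplit2 a b (\<lambda>A B a' b'. wsplit A (\<lambda>A1 A2. \<sigma> [i] A1 * \<sigma> A2 B * f (a' @ b'))) =
      wsplit a (\<lambda>A a'. wsplit A (\<lambda>A1 A2. wsplit b (\<lambda>B b'.
        q ^ (length a' * length B) * (\<sigma> [i] A1 * \<sigma> A2 B * f (a' @ b')))))"
    unfolding wsplit2_def wsplit_mult_left[symmetric] by (subst wsplit_swap) simp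
  also have "\<dots> = wsplit a (\<lambda>A1 A. wsplit A (\<lambda>A2 a'. wsplit b (\<lambda>B b'.
        q ^ (length a' * length B) * (\<sigma> [i] A1 * \<sigma> A2 B * f (a' @ b')))))"
    by (rule wsplit_assoc)
  also have "\<dots> = wsplit a (\<lambda>a1 a2. \<sigma> [i] a1 * star a2 b f)"
    by (simp add: star_def wsplit2_def mult_ac wsplit_mult_left[symmetric])
  finally have 2: "wsplit2 a b (\<lambda>a1 b1 a2 b2. \<sigma> a1 b1 * wsplit (a2 @ b2) (\<lambda>s1 s2. \<sigma> [i] s1 * f s2)) =
      wsplit2 a b (\<lambda>A B a' b'. \<sigma> (i # A) B * f (a' @ b')) +
      wsplit a (\<lambda>a1 a2. \<sigma> [i] a1 * star a2 b f)" .
  have "star a b (left_mult i f) = wsplit2 a b (\<lambda>a1 b1 a2 b2. \<sigma> a1 b1 * f (i # a2 @ b2)) +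
      wsplit2 a b (\<lambda>a1 b1 a2 b2. \<sigma> a1 b1 * wsplit (a2 @ b2) (\<lambda>s1 s2. \<sigma> [i] s1 * f s2))"
    by (simp add: star_def left_mult_def distrib_left wsplit2_add)
  moreover have "star (i # a) b f = wsplit2 a b (\<lambda>A B a' b'. \<sigma> (i # A) B * f (a' @ b')) +
      wsplit2 a b (\<lambda>a1 b1 a2 b2. \<sigma> a1 b1 * f (i # a2 @ b2))"
    by (simp add: star_def wsplit2_Cons 1)
  ultimately show ?thesis by (simp add: left_mult_def 2)
qed

lemma twisted_add: "twisted w (\<lambda>s. f s + g s) = twisted w f + twisted w g"
proof (induction w arbitrary: f g)
  case (Cons i w)
  have "left_mult i (\<lambda>s. f s + g s) = (\<lambda>s. left_mult i f s + left_mult i g s)"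
    by (simp add: fun_eq_iff left_mult_def distrib_left wsplit_add)
  then show ?case by (simp add: Cons.IH)
qed simp

lemma twisted_mult_left: "twisted w (\<lambda>s. c * f s) = c * twisted w f"
proof (induction w arbitrary: f)
  case (Cons i w)
  have "left_mult i (\<lambda>s. c * f s) = (\<lambda>s. c * left_mult i f s)"
    by (simp add: fun_eq_iff left_mult_def distrib_left mult.left_commute wsplit_mult_left)
  then show ?case by (simp add: Cons.IH)
qed simp

lemma twisted_wsplit: "twisted w (\<lambda>s. wsplit v (\<lambda>a b. F a b s)) = wsplit v (\<lambda>a b. twisted w (F a b))"
  by (induction v arbitrary: F) (simp_all add: wsplit_Cons twisted_add twisted_mult_left)

lemma twisted_append: "twisted (u @ v) f = twisted u (\<lambda>a. twisted v (\<lambda>b. star a b f))"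
proof (induction u arbitrary: f)
  case Nil
  have "star [] b f = f b" for b
    by (simp add: star_def \<sigma>_Nil_left word_unit_def wsplit_left_Nil)
  then show ?case by simp
next
  case (Cons i u)
  have "left_mult i (\<lambda>a. twisted v (\<lambda>b. star a b f)) =
      (\<lambda>a. twisted v (\<lambda>b. star a b (left_mult i f)))"
    by (simp add: fun_eq_iff star_left_mult left_mult_def twisted_add twisted_wsplit twisted_mult_left)
  then show ?case by (simp add: Cons.IH)
qed

lemma left_mult_unit: "left_mult i word_unit = \<sigma> [i]"
  by (simp add: fun_eq_iff left_mult_def word_unit_def wsplit_right_Nil)

text \<open>The twisted product of the letters of w is \<phi>(w1) w2, because passing to twisted
  products respects the right coaction and is thus determined by its composite \<phi> with the
  counit. Both claims share one induction: the step moves the first letter past a word a with \<phi>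
  a nonzero, and this must cost no power of q.\<close>

lemma twisted_eq_conv: "twisted w f = word_conv \<phi> f w" and \<phi>_supp: "\<phi> w \<noteq> 0 \<Longrightarrow> 3 dvd length w"
proof -
  have "(\<forall>f. twisted w f = word_conv \<phi> f w) \<and> (\<phi> w \<noteq> 0 \<longrightarrow> 3 dvd length w)"
  proof (induction "length w" arbitrary: w rule: less_induct)
    case less
    show ?case
    proof (cases w)
      case Nil
      then show ?thesis by (simp add: word_conv_def \<phi>_def word_unit_def)
    next
      case (Cons i v)
      have IH: "twisted a f = word_conv \<phi> f a" "\<phi> a \<noteq> 0 \<Longrightarrow> 3 dvd length a"
        if "length a \<le> length v" for a f
        using less[of a] that Cons by auto
      have \<phi>_Cons: "\<phi> (i # a) = wsplit a (\<lambda>b c. \<phi> b * \<sigma> [i] c)" if "length a \<le> length v" for a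
        using IH(1)[OF that, of "\<sigma> [i]"] by (simp add: \<phi>_def left_mult_unit word_conv_def)
      have "\<phi> w \<noteq> 0 \<longrightarrow> 3 dvd length w"
      proof (rule ccontr)
        assume *: "\<not> (\<phi> w \<noteq> 0 \<longrightarrow> 3 dvd length w)"
        have "wsplit v (\<lambda>b c. \<phi> b * \<sigma> [i] c) = 0"
        proof (rule wsplit_eq_0)
          fix a b :: "idx list"
          assume ab: "length a + length b = length v"
          show "\<phi> a * \<sigma> [i] b = 0"
          proof (rule ccontr)
            assume "\<phi> a * \<sigma> [i] b \<noteq> 0"
            then have "3 dvd length a" "3 dvd length [i] + length b"
              using IH(2)[of a] \<sigma>_supp[of "[i]" b] ab by auto
            then have "3 dvd length a + (length [i] + length b)" by (rule dvd_add)
            then show False using * ab Cons by (simp add: add.left_commute)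
          qed
        qed
        then show False using * \<phi>_Cons[of v] Cons by simp
      qed
      moreover have "twisted w f = word_conv \<phi> f w" for f
      proof -
        have "twisted w f = wsplit v (\<lambda>a b. \<phi> a * left_mult i f b)"
          using IH(1)[of v] Cons by (simp add: word_conv_def)
        also have "\<dots> = wsplit v (\<lambda>a b. \<phi> a * f (i # b)) +
            wsplit v (\<lambda>a b. wsplit b (\<lambda>b1 b2. \<phi> a * \<sigma> [i] b1 * f b2))"
          by (simp add: left_mult_def distrib_left wsplit_add wsplit_mult_left[symmetric] mult.assoc)
        also have "wsplit v (\<lambda>a b. wsplit b (\<lambda>b1 b2. \<phi> a * \<sigma> [i] b1 * f b2)) =
            wsplit v (\<lambda>a b. wsplit a (\<lambda>a1 a2. \<phi> a1 * \<sigma> [i] a2 * f b))"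
          by (rule wsplit_assoc[symmetric])
        also have "\<dots> = wsplit v (\<lambda>a b. \<phi> (i # a) * f b)"
          by (rule wsplit_cong) (simp add: \<phi>_Cons wsplit_mult_right)
        also have "wsplit v (\<lambda>a b. \<phi> a * f (i # b)) = wsplit v (\<lambda>a b. q ^ length a * (\<phi> a * f (i # b)))"
        proof (rule wsplit_cong)
          fix a b :: "idx list"
          assume "length a + length b = length v"
          then show "\<phi> a * f (i # b) = q ^ length a * (\<phi> a * f (i # b))"
            using IH(2)[of a] by (cases "\<phi> a = 0") (simp_all add: q_power_dvd)
        qed
        finally show ?thesis by (simp add: Cons word_conv_def wsplit_Cons add.commute)
      qed
      ultimately show ?thesis by blast
    qed
  qed
  then show "twisted w f = word_conv \<phi> f w" "\<phi> w \<noteq> 0 \<Longrightarrow> 3 dvd length w" by blast+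
qed

lemma supp3_\<phi>: "supp3 \<phi>"
  using \<phi>_supp by (auto simp: supp3_def)

lemma \<phi>_Nil [simp]: "\<phi> [] = 1"
  by (simp add: \<phi>_def word_unit_def)

lemma \<phi>_Cons: "\<phi> (i # w) = wsplit w (\<lambda>a b. \<phi> a * \<sigma> [i] b)"
  using twisted_eq_conv[of w "\<sigma> [i]"] by (simp add: \<phi>_def left_mult_unit word_conv_def)

lemma star_unit: "star a b word_unit = \<sigma> a b"
proof -
  have "star a b word_unit = word_conv2 \<sigma> word_unit2 a b"
    unfolding star_def word_conv2_def word_unit2_def
    by (rule wsplit2_cong) (simp add: word_unit_def)
  then show ?thesis by simp
qed

text \<open>The counit of the twisted product of a and b is \<sigma> a b. Evaluating this at the
  twisted products of the letters of u and of v gives the coboundary formula.\<close>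

lemma \<phi>_append_wsplit:
  "\<phi> (u @ v) = wsplit u (\<lambda>a c. wsplit v (\<lambda>b d. \<phi> a * \<phi> b * \<sigma> c d))"
proof -
  have "\<phi> (u @ v) = twisted u (\<lambda>a. twisted v (\<lambda>b. \<sigma> a b))"
    unfolding \<phi>_def twisted_append star_unit ..
  also have "\<dots> = wsplit u (\<lambda>a c. \<phi> a * wsplit v (\<lambda>b d. \<phi> b * \<sigma> c d))"
    by (simp add: twisted_eq_conv word_conv_def)
  finally show ?thesis by (simp add: wsplit_mult_left[symmetric] mult.assoc)
qed

lemma \<phi>_append: "(\<lambda>u v. \<phi> (u @ v)) = word_conv2 (\<lambda>u v. \<phi> u * \<phi> v) \<sigma>"
  by (simp add: fun_eq_iff \<phi>_append_wsplit word_conv2_tensor_left[OF supp3_\<phi>])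

end

section \<open>Obstructions in degrees six and nine\<close>

text \<open>States that the linear extension of f kills the ideal of deformed relations, with
  arbitrary words on both sides. The coefficients come from expanding x12 = 12 - q 21: its cube has
  coefficient (-q)^k at the words with k reversed pairs, where q^3 = 1, and in x112 and x122 the
  middle word has coefficient -q - q^2 = 1.\<close>

definition word_relations :: "('k::field \<Rightarrow> 'v::ab_group_add \<Rightarrow> 'v) \<Rightarrow> 'k \<Rightarrow>
    'k \<Rightarrow> 'k \<Rightarrow> 'k \<Rightarrow> 'k \<Rightarrow> 'k \<Rightarrow> (idx list \<Rightarrow> 'v) \<Rightarrow> bool" where
  "word_relations s q l1 l2 l12 l112 l122 f \<longleftrightarrow> (\<forall>a b.
     f (a @ [One, One, One] @ b) = s l1 (f (a @ b)) \<and>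
     f (a @ [Two, Two, Two] @ b) = s l2 (f (a @ b)) \<and>
     f (a @ [One, Two, One, Two, One, Two] @ b)
       - s q (f (a @ [One, Two, One, Two, Two, One] @ b) + f (a @ [One, Two, Two, One, One, Two] @ b)
            + f (a @ [Two, One, One, Two, One, Two] @ b))
       + s (q\<^sup>2) (f (a @ [One, Two, Two, One, Two, One] @ b) + f (a @ [Two, One, One, Two, Two, One] @ b)
            + f (a @ [Two, One, Two, One, One, Two] @ b))
       - f (a @ [Two, One, Two, One, Two, One] @ b) = s l12 (f (a @ b)) \<and>
     f (a @ [One, One, Two] @ b) + f (a @ [One, Two, One] @ b) + f (a @ [Two, One, One] @ b)
       = s l112 (f (a @ b)) \<and>
     f (a @ [One, Two, Two] @ b) + f (a @ [Two, One, Two] @ b) + f (a @ [Two, Two, One] @ b)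
       = s l122 (f (a @ b)))"

text \<open>Here \<phi> stands for the functional whose coboundary is the gauged cocycle. Since
  \<eta> lives in total length at least three, its k-th convolution power vanishes below length 3k,
  so up to length nine the exponential ends with the cubic term.\<close>

locale word_exponential = word_split q for q :: "'k::field_char_0" +
  fixes \<phi> :: "idx list \<Rightarrow> 'k" and \<eta> :: "idx list \<Rightarrow> idx list \<Rightarrow> 'k"
  assumes \<phi>_Nil: "\<phi> [] = 1"
    and \<phi>_supp: "supp3 \<phi>"
    and \<eta>_supp: "\<eta> u v \<noteq> 0 \<Longrightarrow> 3 dvd length u + length v"
    and \<eta>_Nil_left: "\<eta> [] v = 0"
    and \<eta>_Nil_right: "\<eta> u [] = 0"
    and \<eta>_hochschild: "a \<noteq> [] \<Longrightarrow> c \<noteq> [] \<Longrightarrow> \<eta> a (b @ c) = \<eta> (a @ b) c"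
    and \<phi>_append: "length u + length v \<le> 9 \<Longrightarrow> \<phi> (u @ v) =
          wsplit u (\<lambda>a c. wsplit v (\<lambda>b d. \<phi> a * \<phi> b * (word_unit2 c d + \<eta> c d
            + word_conv2 \<eta> \<eta> c d / 2 + word_conv2 \<eta> (word_conv2 \<eta> \<eta>) c d / 6)))"
begin

definition ex :: "idx list \<Rightarrow> idx list \<Rightarrow> 'k" where
  "ex u v = word_unit2 u v + \<eta> u v + word_conv2 \<eta> \<eta> u v / 2 + word_conv2 \<eta> (word_conv2 \<eta> \<eta>) u v / 6"

lemma \<phi>_0: "\<not> 3 dvd length w \<Longrightarrow> \<phi> w = 0"
  using \<phi>_supp by (auto simp: supp3_def)

lemma \<eta>_0: "\<not> 3 dvd length u + length v \<Longrightarrow> \<eta> u v = 0"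
  using \<eta>_supp by blast

lemma \<eta>_low: "\<eta> u v \<noteq> 0 \<Longrightarrow> u \<noteq> [] \<and> v \<noteq> [] \<and> 3 \<le> length u + length v"
proof -
  assume *: "\<eta> u v \<noteq> 0"
  then have "u \<noteq> []" "v \<noteq> []" using \<eta>_Nil_left \<eta>_Nil_right by auto
  moreover have "3 dvd length u + length v" using * \<eta>_supp by blast
  ultimately show ?thesis by (simp add: dvd_imp_le)
qed

lemma \<eta>2_low: "length u + length v < 6 \<Longrightarrow> word_conv2 \<eta> \<eta> u v = 0"
  unfolding word_conv2_def
proof (rule wsplit2_eq_0)
  fix a b c d :: "idx list"
  assume *: "length u + length v < 6" "length a + length c = length u" "length b + length d = length v"
  show "\<eta> a b * \<eta> c d = 0"
    using \<eta>_low[of a b] \<eta>_low[of c d] * by (cases "\<eta> a b = 0"; cases "\<eta> c d = 0") auto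
qed

lemma \<eta>3_low: "length u + length v < 9 \<Longrightarrow> word_conv2 \<eta> (word_conv2 \<eta> \<eta>) u v = 0"
  unfolding word_conv2_def[of _ "word_conv2 \<eta> \<eta>"]
proof (rule wsplit2_eq_0)
  fix a b c d :: "idx list"
  assume *: "length u + length v < 9" "length a + length c = length u" "length b + length d = length v"
  show "\<eta> a b * word_conv2 \<eta> \<eta> c d = 0"
    using \<eta>_low[of a b] \<eta>2_low[of c d] * by (cases "\<eta> a b = 0") auto
qed

lemma \<eta>2_Nil_left: "word_conv2 \<eta> s [] v = 0" and \<eta>2_Nil_right: "word_conv2 \<eta> s u [] = 0"
  by (simp_all add: word_conv2_def \<eta>_Nil_left \<eta>_Nil_right)

lemma ex_Nil_left: "ex [] v = word_unit v" and ex_Nil_right: "ex u [] = word_unit u"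
  by (simp_all add: ex_def word_unit2_def word_unit_def \<eta>_Nil_left \<eta>_Nil_right \<eta>2_Nil_left \<eta>2_Nil_right)

lemma \<phi>_append_ex:
  "length u + length v \<le> 9 \<Longrightarrow> \<phi> (u @ v) = wsplit u (\<lambda>a c. wsplit v (\<lambda>b d. \<phi> a * \<phi> b * ex c d))"
  using \<phi>_append by (simp add: ex_def)

lemma \<phi>_small: "\<phi> [a] = 0" "\<phi> [a, b] = 0" "\<phi> [a, b, c, d] = 0" "\<phi> [a, b, c, d, e] = 0"
  by (rule \<phi>_0; simp only: list.size; presburger)+

text \<open>By the Hochschild identity \<eta> u v depends on u @ v only; this functional of one word
  is read off at the cut after the first letter.\<close>

definition G :: "idx list \<Rightarrow> 'k" where
  "G w = \<eta> [hd w] (tl w)"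

lemma \<eta>_eq_G: "u \<noteq> [] \<Longrightarrow> v \<noteq> [] \<Longrightarrow> \<eta> u v = G (u @ v)"
proof -
  assume *: "u \<noteq> []" "v \<noteq> []"
  then obtain x u' where u: "u = x # u'" by (cases u) auto
  have "\<eta> [x] (u' @ v) = \<eta> ([x] @ u') v" using * by (intro \<eta>_hochschild) auto
  then show ?thesis by (simp add: G_def u)
qed

lemma ex_3: "length u + length v = 3 \<Longrightarrow> u \<noteq> [] \<Longrightarrow> v \<noteq> [] \<Longrightarrow> ex u v = G (u @ v)"
  by (simp add: ex_def \<eta>2_low \<eta>3_low \<eta>_eq_G word_unit2_def word_unit_def)

lemma ex_6: "length u + length v = 6 \<Longrightarrow> u \<noteq> [] \<Longrightarrow> v \<noteq> [] \<Longrightarrow>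
    ex u v = G (u @ v) + word_conv2 \<eta> \<eta> u v / 2"
  by (simp add: ex_def \<eta>3_low \<eta>_eq_G word_unit2_def word_unit_def)

lemma \<phi>_3: "\<phi> [i, j, k] = G [i, j, k]"
proof -
  have "\<phi> ([i] @ [j, k]) = ex [i] [j, k]"
    by (subst \<phi>_append_ex) (simp_all add: wsplit_Cons \<phi>_small \<phi>_Nil)
  then show ?thesis by (simp add: ex_3)
qed

lemma \<phi>_33: "\<phi> [i, j, k, a, b, c] = \<phi> [i, j, k] * \<phi> [a, b, c] + ex [i, j, k] [a, b, c]"
proof -
  have "\<phi> ([i, j, k] @ [a, b, c]) = \<phi> [i, j, k] * \<phi> [a, b, c] + ex [i, j, k] [a, b, c]"
    by (subst \<phi>_append_ex) (simp_all add: wsplit_Cons \<phi>_small \<phi>_Nil ex_Nil_left ex_Nil_right word_unit_def)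
  then show ?thesis by simp
qed

lemma \<eta>_small:
  "\<eta> [a] [b] = 0" "\<eta> [a] [b, c, d] = 0" "\<eta> [a] [b, c, d, e] = 0"
  "\<eta> [a, b] [c, d] = 0" "\<eta> [a, b] [c, d, e] = 0"
  "\<eta> [a, b, c] [d] = 0" "\<eta> [a, b, c] [d, e] = 0" "\<eta> [a, b, c, d] [e] = 0"
  by (rule \<eta>_0; simp only: list.size; presburger)+

lemma \<eta>_3: "\<eta> [i] [j, k] = \<phi> [i, j, k]" "\<eta> [i, j] [k] = \<phi> [i, j, k]"
  by (simp_all add: \<eta>_eq_G \<phi>_3)

lemmas \<eta>2_expand = word_conv2_def wsplit2_def wsplit_Cons \<eta>_small \<eta>_3 \<eta>_Nil_left \<eta>_Nil_right

text \<open>The square of 1 + 2q is -3. The comparisons of cuts below all yield their result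
  multiplied by this number.\<close>

lemma one_plus_2q: "1 + 2 * q \<noteq> 0"
proof
  assume "1 + 2 * q = 0"
  then have "(1 + 2 * q) * (1 + 2 * q) = 0" by simp
  then have "1 + 4 * q + 4 * (q * q) = 0" by (simp add: algebra_simps)
  then show False by (simp add: q_square algebra_simps)
qed

text \<open>Eliminates the unknown values e1 and e2 of the exponential, whose difference is known,
  from two expressions x for \<phi> of the same word, before any of the large sums is
  expanded.\<close>

lemma rearrange:
  fixes x :: 'k
  assumes "x = e1 + w" "e1 - n1 = e2 - n2" "x = p + e2"
  shows "p + n2 = n1 + w"
proof -
  have "p + n2 = (x - e2) + n2" using assms(3) by simp
  also have "\<dots> = (e1 + w) - (e2 - n2)" using assms(1) by simp
  also have "\<dots> = n1 + w" using assms(2) by (simp flip: assms(2))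
  finally show ?thesis .
qed

text \<open>The word i j k a b c is cut after two and after three letters. The values of G at the
  whole word cancel; what remains is quadratic in the values of \<phi> at words of length
  three.\<close>

lemma quadric_24: "\<phi> [i, j, a] * \<phi> [k, b, c] = \<phi> [i, j, b] * \<phi> [k, a, c]"
proof -
  \<comment> \<open>The terms where three letters of the second word go to \<phi> and the fourth
    joins i, j: in total length three \<open>ex\<close> is \<phi> of the concatenation.\<close>
  let ?W = "wsplit [k, a, b, c] (\<lambda>x y. (if length x = 3 then \<phi> x else 0) *
    (if length y = 1 then \<phi> ([i, j] @ y) else 0))"
  have 1: "\<phi> [i, j, k, a, b, c] = ex [i, j] [k, a, b, c] + ?W"
    using \<phi>_append_ex[of "[i, j]" "[k, a, b, c]"]
    by (simp add: wsplit_Cons \<phi>_small \<phi>_Nil ex_Nil_left ex_Nil_right word_unit_def ex_3 \<phi>_3)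
  have 2: "ex [i, j] [k, a, b, c] - word_conv2 \<eta> \<eta> [i, j] [k, a, b, c] / 2 =
      ex [i, j, k] [a, b, c] - word_conv2 \<eta> \<eta> [i, j, k] [a, b, c] / 2"
    by (simp add: ex_6)
  have "\<phi> [i, j, k] * \<phi> [a, b, c] + word_conv2 \<eta> \<eta> [i, j, k] [a, b, c] / 2 =
      word_conv2 \<eta> \<eta> [i, j] [k, a, b, c] / 2 + ?W"
    by (rule rearrange[OF 1 2 \<phi>_33])
  then have "(1 + 2 * q) * (\<phi> [i, j, a] * \<phi> [k, b, c] - \<phi> [i, j, b] * \<phi> [k, a, c]) = 0"
    by (simp add: \<eta>2_expand q_square q_mult_left) (use q_square in algebra)
  then show ?thesis using one_plus_2q by simp
qed

text \<open>The mirror image of \<open>quadric_24\<close>, from the cut after four letters.\<close>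

lemma quadric_42: "\<phi> [c, b, k] * \<phi> [a, j, i] = \<phi> [c, a, k] * \<phi> [b, j, i]"
proof -
  let ?W = "wsplit [c, b, a, k] (\<lambda>x y. (if length x = 3 then \<phi> x else 0) *
    (if length y = 1 then \<phi> (y @ [j, i]) else 0))"
  have 1: "\<phi> [c, b, a, k, j, i] = ex [c, b, a, k] [j, i] + ?W"
    using \<phi>_append_ex[of "[c, b, a, k]" "[j, i]"]
    by (simp add: wsplit_Cons \<phi>_small \<phi>_Nil ex_Nil_left ex_Nil_right word_unit_def ex_3 \<phi>_3)
  have 2: "ex [c, b, a, k] [j, i] - word_conv2 \<eta> \<eta> [c, b, a, k] [j, i] / 2 =
      ex [c, b, a] [k, j, i] - word_conv2 \<eta> \<eta> [c, b, a] [k, j, i] / 2"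
    by (simp add: ex_6)
  have "\<phi> [c, b, a] * \<phi> [k, j, i] + word_conv2 \<eta> \<eta> [c, b, a] [k, j, i] / 2 =
      word_conv2 \<eta> \<eta> [c, b, a, k] [j, i] / 2 + ?W"
    by (rule rearrange[OF 1 2 \<phi>_33])
  then have "(1 + 2 * q) * (\<phi> [c, b, k] * \<phi> [a, j, i] - \<phi> [c, a, k] * \<phi> [b, j, i]) = 0"
    by (simp add: \<eta>2_expand q_square q_mult_left) (use q_square in algebra)
  then show ?thesis using one_plus_2q by simp
qed

text \<open>By the quadrics every slot of the tensor of length three values depends on its index
  through the same function m, a slice through a nonzero value. Leaving the scalar c free avoids
  cube roots.\<close>

lemma cube_form: "\<exists>c m. \<forall>i j k. \<phi> [i, j, k] = c * m i * m j * m k"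
proof (cases "\<forall>i j k. \<phi> [i, j, k] = 0")
  case True
  then show ?thesis by (intro exI[of _ 0]) simp
next
  case False
  then obtain x y z where nz: "\<phi> [x, y, z] \<noteq> 0" by blast
  define m where "m p = \<phi> [x, p, z]" for p
  have my: "m y \<noteq> 0" using nz by (simp add: m_def)
  have last: "\<phi> [i, j, a] * m y = \<phi> [i, j, y] * m a" for i j a
    using quadric_24[of i j a x y z] by (simp add: m_def)
  have first: "\<phi> [a, j, i] * m y = \<phi> [y, j, i] * m a" for i j a
    using quadric_42[of x y z a j i] by (simp add: m_def mult.commute)
  have mid: "\<phi> [k, b, d] * m y = \<phi> [k, y, d] * m b" for k b d
  proof -
    \<comment> \<open>A second nonzero value, with repeated last index, makes the middle slot
      comparable with the last one.\<close>
    have "\<phi> [x, y, y] * m z = m y * m y"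
      using last[of x y z] by (simp add: m_def)
    then have xyy: "\<phi> [x, y, y] \<noteq> 0" using my by auto
    have "\<phi> [x, y, y] * \<phi> [k, b, d] = \<phi> [x, y, b] * \<phi> [k, y, d]"
      by (rule quadric_24)
    then have "\<phi> [x, y, y] * \<phi> [k, b, d] * m y = \<phi> [x, y, y] * m b * \<phi> [k, y, d]"
      using last[of x y b] by (simp add: mult_ac)
    then show ?thesis using xyy by (simp add: mult_ac)
  qed
  have "\<phi> [i, j, k] = \<phi> [y, y, y] / m y ^ 3 * m i * m j * m k" for i j k
  proof -
    have "\<phi> [i, j, k] * m y ^ 3 = (\<phi> [i, j, k] * m y) * m y * m y"
      by (simp add: power3_eq_cube mult_ac)
    also have "\<dots> = (\<phi> [y, j, k] * m y) * m i * m y"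
      by (subst first[of i j k]) (simp add: mult_ac)
    also have "\<dots> = (\<phi> [y, y, k] * m y) * m i * m j"
      by (subst mid[of y j k]) (simp add: mult_ac)
    also have "\<dots> = \<phi> [y, y, y] * m i * m j * m k"
      by (subst last[of y y k]) (simp add: mult_ac)
    finally show ?thesis using my by (simp add: field_simps)
  qed
  then show ?thesis by blast
qed

end

section \<open>Length nine: constraints on the degree six part\<close>

locale word_exponential_cube = word_exponential q \<phi> \<eta>
  for q :: "'k::field_char_0" and \<phi> \<eta> +
  fixes c :: 'k and m :: "idx \<Rightarrow> 'k"
  assumes cube: "\<phi> [i, j, k] = c * m i * m j * m k"
begin

text \<open>In total length six only the length three part of \<eta> enters, which is c (L \<otimes>
  L^2 + L^2 \<otimes> L) for the linear form L given by m. Each term of its square has a factor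
  divisible by 1 + q + q^2.\<close>

lemma \<eta>2_6: "length u + length v = 6 \<Longrightarrow> word_conv2 \<eta> \<eta> u v = 0"
proof -
  assume *: "length u + length v = 6"
  then have "length u = 0 \<or> length v = 0 \<or> length u = 1 \<and> length v = 5 \<or>
      length u = 2 \<and> length v = 4 \<or> length u = 3 \<and> length v = 3 \<or>
      length u = 4 \<and> length v = 2 \<or> length u = 5 \<and> length v = 1"
    by arith
  then consider "u = []" | "v = []" | "length u = 1" "length v = 5" | "length u = 2" "length v = 4"
    | "length u = 3" "length v = 3" | "length u = 4" "length v = 2" | "length u = 5" "length v = 1"
    by (elim disjE conjE) simp_all
  then show ?thesis
  proof cases
    case 3
    then obtain x1 y1 y2 y3 y4 y5 where "u = [x1]" "v = [y1, y2, y3, y4, y5]"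
      by (auto simp: length_Suc_conv numeral_eq_Suc)
    then show ?thesis by (simp add: \<eta>2_expand)
  next
    case 4
    then obtain x1 x2 y1 y2 y3 y4 where "u = [x1, x2]" "v = [y1, y2, y3, y4]"
      by (auto simp: length_Suc_conv numeral_eq_Suc)
    then show ?thesis by (simp add: \<eta>2_expand cube q_square q_mult_left algebra_simps)
  next
    case 5
    then obtain x1 x2 x3 y1 y2 y3 where "u = [x1, x2, x3]" "v = [y1, y2, y3]"
      by (auto simp: length_Suc_conv numeral_eq_Suc)
    then show ?thesis by (simp add: \<eta>2_expand cube q_square q_mult_left algebra_simps)
  next
    case 6
    then obtain x1 x2 x3 x4 y1 y2 where "u = [x1, x2, x3, x4]" "v = [y1, y2]"
      by (auto simp: length_Suc_conv numeral_eq_Suc)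
    then show ?thesis by (simp add: \<eta>2_expand cube q_square q_mult_left algebra_simps)
  next
    case 7
    then obtain x1 x2 x3 x4 x5 y1 where "u = [x1, x2, x3, x4, x5]" "v = [y1]"
      by (auto simp: length_Suc_conv numeral_eq_Suc)
    then show ?thesis by (simp add: \<eta>2_expand)
  qed (simp_all add: \<eta>2_Nil_left \<eta>2_Nil_right)
qed

lemma \<eta>3_9: "length u + length v = 9 \<Longrightarrow> word_conv2 \<eta> (word_conv2 \<eta> \<eta>) u v = 0"
  unfolding word_conv2_def[of _ "word_conv2 \<eta> \<eta>"]
proof (rule wsplit2_eq_0)
  fix a b d e :: "idx list"
  assume *: "length u + length v = 9" "length a + length d = length u" "length b + length e = length v"
  show "\<eta> a b * word_conv2 \<eta> \<eta> d e = 0"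
  proof (cases "\<eta> a b = 0")
    case False
    then have "3 \<le> length a + length b" using \<eta>_low by blast
    then have "length d + length e = 6 \<or> length d + length e < 6" using * by linarith
    then show ?thesis using \<eta>2_6 \<eta>2_low by auto
  qed simp
qed

text \<open>\<open>\<tau>\<close> and \<open>F\<close> are the parts of \<open>G\<close> in lengths
  three and six; \<open>G\<close> in length nine stays unknown and has to cancel.\<close>

definition \<tau> :: "idx list \<Rightarrow> 'k" where
  "\<tau> w = (if length w = 3 then G w else 0)"

definition F :: "idx list \<Rightarrow> 'k" where
  "F w = (if length w = 6 then G w else 0)"

lemma \<phi>_eq_G: "length w = 3 \<Longrightarrow> \<phi> w = G w"
  by (auto simp: length_Suc_conv numeral_eq_Suc \<phi>_3)

lemma \<phi>_eq_\<tau>: "length w = 3 \<Longrightarrow> \<phi> w = \<tau> w"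
  by (simp add: \<tau>_def \<phi>_eq_G)

lemma \<phi>_6: "length u = 3 \<Longrightarrow> length v = 3 \<Longrightarrow> \<phi> (u @ v) = \<tau> u * \<tau> v + F (u @ v)"
proof -
  assume *: "length u = 3" "length v = 3"
  then obtain i j k a b d where "u = [i, j, k]" "v = [a, b, d]"
    by (auto simp: length_Suc_conv numeral_eq_Suc)
  then show ?thesis
    using \<phi>_33[of i j k a b d] ex_6[of u v] \<eta>2_6[of u v] by (simp add: F_def \<tau>_def \<phi>_3)
qed

text \<open>Double splittings with an empty leg collapse to a single splitting; the legs are
  numbered in the order a, b, c, d. The braiding weight of c past b survives if a or d is the empty
  leg and is 1 if b or c is.\<close>

lemma wsplit2_unit_1:
  "wsplit2 u v (\<lambda>a b c d. word_unit a * H b c d) = wsplit v (\<lambda>b d. q ^ (length u * length b) * H b u d)"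
proof -
  have "wsplit2 u v (\<lambda>a b c d. word_unit a * H b c d) =
      wsplit u (\<lambda>a c. (if a = [] then 1 else 0) * wsplit v (\<lambda>b d. q ^ (length c * length b) * H b c d))"
    unfolding wsplit2_def wsplit_mult_left[symmetric] word_unit_def by (simp add: mult_ac)
  then show ?thesis by (simp add: wsplit_left_Nil)
qed

lemma wsplit2_unit_2:
  "wsplit2 u v (\<lambda>a b c d. word_unit b * H a c d) = wsplit u (\<lambda>a c. H a c v)"
proof -
  have "wsplit2 u v (\<lambda>a b c d. word_unit b * H a c d) =
      wsplit u (\<lambda>a c. wsplit v (\<lambda>b d. (if b = [] then 1 else 0) * H a c d))"
    unfolding wsplit2_def word_unit_def by (intro wsplit_cong) simp
  then show ?thesis by (simp add: wsplit_left_Nil)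
qed

lemma wsplit2_unit_3:
  "wsplit2 u v (\<lambda>a b c d. word_unit c * H a b d) = wsplit v (\<lambda>b d. H u b d)"
proof -
  have "wsplit2 u v (\<lambda>a b c d. word_unit c * H a b d) =
      wsplit u (\<lambda>a c. wsplit v (\<lambda>b d. H a b d) * (if c = [] then 1 else 0))"
    unfolding wsplit2_def wsplit_mult_right[symmetric] word_unit_def by (intro wsplit_cong) simp
  then show ?thesis by (simp add: wsplit_right_Nil)
qed

lemma wsplit2_unit_4:
  "wsplit2 u v (\<lambda>a b c d. word_unit d * H a b c) = wsplit u (\<lambda>a c. q ^ (length c * length v) * H a v c)"
proof -
  have "wsplit2 u v (\<lambda>a b c d. word_unit d * H a b c) =
      wsplit u (\<lambda>a c. wsplit v (\<lambda>b d. (q ^ (length c * length b) * H a b c) * (if d = [] then 1 else 0)))"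
    unfolding wsplit2_def word_unit_def by (simp add: mult_ac)
  then show ?thesis by (simp add: wsplit_right_Nil)
qed

text \<open>Convolving \<tau> and F on u @ v allows all splittings, whereas \<eta> vanishes if one
  of its legs is empty. In these lengths an empty leg at F forces an empty leg at \<tau>, and the
  two legs of \<tau> cannot both be empty; so the four sums with an empty leg at \<tau> remove each
  excess term exactly once.\<close>

lemma \<eta>2_9:
  assumes "length u = 3 \<and> length v = 6 \<or> length u = 6 \<and> length v = 3"
  shows "word_conv2 \<eta> \<eta> u v = word_conv \<tau> F (u @ v) + word_conv F \<tau> (u @ v)
    - wsplit v (\<lambda>b d. \<tau> b * F (u @ d)) - wsplit u (\<lambda>a e. \<tau> a * F (e @ v))
    - wsplit v (\<lambda>b d. F (u @ b) * \<tau> d) - wsplit u (\<lambda>a e. F (a @ v) * \<tau> e)"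
proof -
  have "word_conv2 \<eta> \<eta> u v = wsplit2 u v (\<lambda>a b e d. \<tau> (a @ b) * F (e @ d) + F (a @ b) * \<tau> (e @ d)
      - word_unit a * (\<tau> b * F (e @ d)) - word_unit b * (\<tau> a * F (e @ d))
      - word_unit e * (F (a @ b) * \<tau> d) - word_unit d * (F (a @ b) * \<tau> e))"
    unfolding word_conv2_def
  proof (rule wsplit2_cong, goal_cases)
    case (1 a b e d)
    have len: "length a + length b + (length e + length d) = 9"
      using 1 assms by linarith
    show ?case
    proof (cases "a = [] \<or> b = [] \<or> e = [] \<or> d = []")
      case True
      then show ?thesis
        using 1 assms by (auto simp: \<eta>_Nil_left \<eta>_Nil_right word_unit_def \<tau>_def F_def)
    next
      case False
      then have eq: "\<eta> a b = G (a @ b)" "\<eta> e d = G (e @ d)" by (auto simp: \<eta>_eq_G)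
      have "\<eta> a b * \<eta> e d = \<tau> (a @ b) * F (e @ d) + F (a @ b) * \<tau> (e @ d)"
      proof (cases "3 dvd length a + length b")
        case True
        moreover have "length a > 0" "length e > 0" using False by auto
        then have "length a + length b > 0" "length a + length b < 9" using len by linarith+
        ultimately have "length a + length b = 3 \<or> length a + length b = 6" by presburger
        then show ?thesis using len by (auto simp: eq \<tau>_def F_def)
      next
        case nd: False
        then have "length a + length b \<noteq> 3" "length a + length b \<noteq> 6" by auto
        then show ?thesis using \<eta>_0[OF nd] by (simp add: \<tau>_def F_def)
      qed
      then show ?thesis using False by (simp add: word_unit_def)
    qed
  qed
  also have "\<dots> = word_conv \<tau> F (u @ v) + word_conv F \<tau> (u @ v)
    - wsplit v (\<lambda>b d. q ^ (length u * length b) * (\<tau> b * F (u @ d))) - wsplit u (\<lambda>a e. \<tau> a * F (e @ v))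
    - wsplit v (\<lambda>b d. F (u @ b) * \<tau> d) - wsplit u (\<lambda>a e. q ^ (length e * length v) * (F (a @ v) * \<tau> e))"
    unfolding wsplit2_diff wsplit2_add
    by (simp only: wsplit2_unit_1 wsplit2_unit_2 wsplit2_unit_3 wsplit2_unit_4 word_conv_def wsplit_append)
  also have "wsplit v (\<lambda>b d. q ^ (length u * length b) * (\<tau> b * F (u @ d))) = wsplit v (\<lambda>b d. \<tau> b * F (u @ d))"
    using assms by (intro wsplit_cong) (auto simp: q_power_dvd)
  also have "wsplit u (\<lambda>a e. q ^ (length e * length v) * (F (a @ v) * \<tau> e)) = wsplit u (\<lambda>a e. F (a @ v) * \<tau> e)"
    using assms by (intro wsplit_cong) (auto simp: q_power_dvd)
  finally show ?thesis .
qed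

text \<open>The cut after three letters. Besides the full exponential at (u, v), whose cubic term is
  zero by \<open>\<eta>3_9\<close>, only first legs of length three inside v and the whole of u
  contribute.\<close>

lemma \<phi>_36:
  assumes u: "length u = 3" and v: "length v = 6"
  shows "\<phi> (u @ v) = G (u @ v) + word_conv2 \<eta> \<eta> u v / 2 + wsplit v (\<lambda>b d. \<tau> b * F (u @ d)) + \<tau> u * \<phi> v"
proof -
  define W where "W e = wsplit v (\<lambda>b d. \<phi> b * ex e d)" for e
  have ne: "u \<noteq> []" "v \<noteq> []" using u v by auto
  have "\<phi> (u @ v) = wsplit u (\<lambda>a e. \<phi> a * W e)"
    using \<phi>_append_ex[of u v] u v by (simp add: W_def wsplit_mult_left[symmetric] mult.assoc)
  also have "\<dots> = wsplit u (\<lambda>a e. (if a = [] then 1 else 0) * W e + \<tau> a * W [] * (if e = [] then 1 else 0))"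
  proof (rule wsplit_cong)
    fix a e :: "idx list"
    assume *: "length a + length e = length u"
    show "\<phi> a * W e = (if a = [] then 1 else 0) * W e + \<tau> a * W [] * (if e = [] then 1 else 0)"
    proof (cases "3 dvd length a")
      case True
      then have "length a = 0 \<or> length a = 3" using * u by presburger
      then show ?thesis using * u by (auto simp: \<phi>_eq_\<tau> \<phi>_Nil \<tau>_def)
    next
      case False
      then have "length a \<noteq> 0" "length a \<noteq> 3" by (auto intro: ccontr)
      then show ?thesis using \<phi>_0[OF False] by (auto simp: \<tau>_def)
    qed
  qed
  also have "\<dots> = W u + \<tau> u * W []"
    unfolding wsplit_add wsplit_left_Nil wsplit_right_Nil ..
  also have "W [] = \<phi> v"
    by (simp add: W_def ex_Nil_left word_unit_def wsplit_right_Nil)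
  also have "W u = wsplit v (\<lambda>b d. (if b = [] then 1 else 0) * ex u d + \<tau> b * F (u @ d))"
    unfolding W_def
  proof (rule wsplit_cong)
    fix b d :: "idx list"
    assume *: "length b + length d = length v"
    show "\<phi> b * ex u d = (if b = [] then 1 else 0) * ex u d + \<tau> b * F (u @ d)"
    proof (cases "3 dvd length b")
      case True
      then have "length b = 0 \<or> length b = 3 \<or> length b = 6" using * v by presburger
      moreover have "length b = 3 \<Longrightarrow> d \<noteq> []" using * u v by auto
      ultimately show ?thesis
        using * u v ne ex_6[of u d] \<eta>2_6[of u d]
        by (auto simp: \<phi>_eq_\<tau> \<phi>_Nil \<tau>_def F_def ex_Nil_right word_unit_def \<phi>_eq_G)
    next
      case False
      then have "length b \<noteq> 0" "length b \<noteq> 3" by (auto intro: ccontr)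
      then show ?thesis using \<phi>_0[OF False] by (auto simp: \<tau>_def)
    qed
  qed
  also have "\<dots> = ex u v + wsplit v (\<lambda>b d. \<tau> b * F (u @ d))"
    unfolding wsplit_add wsplit_left_Nil ..
  also have "ex u v = G (u @ v) + word_conv2 \<eta> \<eta> u v / 2"
    using u v ne by (simp add: ex_def \<eta>3_9 \<eta>_eq_G word_unit2_def word_unit_def)
  finally show ?thesis by (simp add: add_ac)
qed

lemma \<phi>_63:
  assumes u: "length u = 6" and v: "length v = 3"
  shows "\<phi> (u @ v) = G (u @ v) + word_conv2 \<eta> \<eta> u v / 2 + wsplit u (\<lambda>a e. \<tau> a * F (e @ v)) + \<phi> u * \<tau> v"
proof -
  define W where "W d = wsplit u (\<lambda>a e. \<phi> a * ex e d)" for d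
  have ne: "u \<noteq> []" "v \<noteq> []" using u v by auto
  have "\<phi> (u @ v) = wsplit v (\<lambda>b d. wsplit u (\<lambda>a e. \<phi> a * \<phi> b * ex e d))"
    using \<phi>_append_ex[of u v] u v by (simp add: wsplit_swap[of u v])
  also have "\<dots> = wsplit v (\<lambda>b d. \<phi> b * W d)"
    by (simp add: W_def wsplit_mult_left[symmetric] mult_ac)
  also have "\<dots> = wsplit v (\<lambda>b d. (if b = [] then 1 else 0) * W d + \<tau> b * W [] * (if d = [] then 1 else 0))"
  proof (rule wsplit_cong)
    fix a e :: "idx list"
    assume *: "length a + length e = length v"
    show "\<phi> a * W e = (if a = [] then 1 else 0) * W e + \<tau> a * W [] * (if e = [] then 1 else 0)"
    proof (cases "3 dvd length a")
      case True
      then have "length a = 0 \<or> length a = 3" using * v by presburger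
      then show ?thesis using * v by (auto simp: \<phi>_eq_\<tau> \<phi>_Nil \<tau>_def)
    next
      case False
      then have "length a \<noteq> 0" "length a \<noteq> 3" by (auto intro: ccontr)
      then show ?thesis using \<phi>_0[OF False] by (auto simp: \<tau>_def)
    qed
  qed
  also have "\<dots> = W v + \<tau> v * W []"
    unfolding wsplit_add wsplit_left_Nil wsplit_right_Nil ..
  also have "W [] = \<phi> u"
    by (simp add: W_def ex_Nil_right word_unit_def wsplit_right_Nil)
  also have "W v = wsplit u (\<lambda>a e. (if a = [] then 1 else 0) * ex e v + \<tau> a * F (e @ v))"
    unfolding W_def
  proof (rule wsplit_cong)
    fix b d :: "idx list"
    assume *: "length b + length d = length u"
    show "\<phi> b * ex d v = (if b = [] then 1 else 0) * ex d v + \<tau> b * F (d @ v)"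
    proof (cases "3 dvd length b")
      case True
      then have "length b = 0 \<or> length b = 3 \<or> length b = 6" using * u by presburger
      moreover have "length b = 3 \<Longrightarrow> d \<noteq> []" using * u v by auto
      ultimately show ?thesis
        using * u v ne ex_6[of d v] \<eta>2_6[of d v]
        by (auto simp: \<phi>_eq_\<tau> \<phi>_Nil \<tau>_def F_def ex_Nil_left word_unit_def \<phi>_eq_G)
    next
      case False
      then have "length b \<noteq> 0" "length b \<noteq> 3" by (auto intro: ccontr)
      then show ?thesis using \<phi>_0[OF False] by (auto simp: \<tau>_def)
    qed
  qed
  also have "\<dots> = ex u v + wsplit u (\<lambda>a e. \<tau> a * F (e @ v))"
    unfolding wsplit_add wsplit_left_Nil ..
  also have "ex u v = G (u @ v) + word_conv2 \<eta> \<eta> u v / 2"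
    using u v ne by (simp add: ex_def \<eta>3_9 \<eta>_eq_G word_unit2_def word_unit_def)
  finally show ?thesis by (simp add: add_ac mult.commute)
qed

text \<open>Two expressions for \<phi> (x @ y @ z), cut after x and after x @ y. The value of G at
  the whole word, the full convolutions of \<tau> and F, and the products over blocks cancel. A sum
  L of type \<tau> F enters once directly and with -1/2 from the quadratic term, its partner L' of
  type F \<tau> only with -1/2; hence the differences.\<close>

lemma commutator_balance:
  assumes x: "length x = 3" and y: "length y = 3" and z: "length z = 3"
  shows "wsplit (y @ z) (\<lambda>a b. \<tau> a * F (x @ b) - F (x @ a) * \<tau> b) =
    wsplit (x @ y) (\<lambda>a b. \<tau> a * F (b @ z) - F (a @ z) * \<tau> b)"
proof -
  define L where "L = wsplit (y @ z) (\<lambda>a b. \<tau> a * F (x @ b))"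
  define L' where "L' = wsplit (y @ z) (\<lambda>a b. F (x @ a) * \<tau> b)"
  define R where "R = wsplit (x @ y) (\<lambda>a b. \<tau> a * F (b @ z))"
  define R' where "R' = wsplit (x @ y) (\<lambda>a b. F (a @ z) * \<tau> b)"
  define M where "M = word_conv \<tau> F (x @ y @ z) + word_conv F \<tau> (x @ y @ z)"
  have 1: "wsplit x (\<lambda>a e. \<tau> a * F (e @ y @ z)) = \<tau> x * F (y @ z)"
  proof -
    have "wsplit x (\<lambda>a e. \<tau> a * F (e @ y @ z)) = wsplit x (\<lambda>a e. \<tau> a * F (y @ z) * (if e = [] then 1 else 0))"
      by (rule wsplit_cong) (use x y z in \<open>auto simp: F_def\<close>)
    then show ?thesis by (simp only: wsplit_right_Nil)
  qed
  have 2: "wsplit x (\<lambda>a e. F (a @ y @ z) * \<tau> e) = \<tau> x * F (y @ z)"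
  proof -
    have "wsplit x (\<lambda>a e. F (a @ y @ z) * \<tau> e) = wsplit x (\<lambda>a e. (if a = [] then 1 else 0) * (\<tau> e * F (y @ z)))"
      by (rule wsplit_cong) (use x y z in \<open>auto simp: F_def\<close>)
    then show ?thesis by (simp only: wsplit_left_Nil)
  qed
  have 3: "wsplit z (\<lambda>b d. \<tau> b * F ((x @ y) @ d)) = \<tau> z * F (x @ y)"
  proof -
    have "wsplit z (\<lambda>b d. \<tau> b * F ((x @ y) @ d)) = wsplit z (\<lambda>b d. \<tau> b * F (x @ y) * (if d = [] then 1 else 0))"
      by (rule wsplit_cong) (use x y z in \<open>auto simp: F_def\<close>)
    then show ?thesis by (simp only: wsplit_right_Nil)
  qed
  have 4: "wsplit z (\<lambda>b d. F ((x @ y) @ b) * \<tau> d) = \<tau> z * F (x @ y)"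
  proof -
    have "wsplit z (\<lambda>b d. F ((x @ y) @ b) * \<tau> d) = wsplit z (\<lambda>b d. (if b = [] then 1 else 0) * (\<tau> d * F (x @ y)))"
      by (rule wsplit_cong) (use x y z in \<open>auto simp: F_def\<close>)
    then show ?thesis by (simp only: wsplit_left_Nil)
  qed
  have "\<phi> (x @ y @ z) = G (x @ y @ z) + (M - L - \<tau> x * F (y @ z) - L' - \<tau> x * F (y @ z)) / 2 + L
      + \<tau> x * (\<tau> y * \<tau> z + F (y @ z))"
    using \<phi>_36[of x "y @ z"] \<eta>2_9[of x "y @ z"] x y z \<phi>_6[of y z]
    by (simp add: L_def L'_def M_def 1 2)
  moreover have "\<phi> (x @ y @ z) = G (x @ y @ z) + (M - \<tau> z * F (x @ y) - R - \<tau> z * F (x @ y) - R') / 2 + R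
      + (\<tau> x * \<tau> y + F (x @ y)) * \<tau> z"
    using \<phi>_63[of "x @ y" z] \<eta>2_9[of "x @ y" z] x y z \<phi>_6[of x y]
    by (simp add: R_def R'_def M_def 3[unfolded append_assoc] 4[unfolded append_assoc])
  ultimately have "2 * (L - L') = 2 * (R - R')" by (simp add: field_simps)
  then have "L - L' = R - R'" by (simp only: mult_cancel_left) simp
  then show ?thesis by (simp add: wsplit_diff L_def L'_def R_def R'_def)
qed

end

section \<open>Consequences for the parameters\<close>

locale word_exponential_relations = word_exponential_cube q \<phi> \<eta> c m
  for q :: "'k::field_char_0" and \<phi> \<eta> c m +
  fixes l1 l2 l12 l112 l122 :: 'k
  assumes rel: "word_relations (*) q l1 l2 l12 l112 l122 \<phi>"
begin

lemma \<phi>_6': "\<phi> [i, j, k, a, b, d] = c * m i * m j * m k * (c * m a * m b * m d) + F [i, j, k, a, b, d]"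
  using \<phi>_6[of "[i, j, k]" "[a, b, d]"] by (simp add: cube[symmetric] \<phi>_eq_\<tau>)

lemma rel_111: "\<phi> (a @ [One, One, One] @ b) = l1 * \<phi> (a @ b)"
  and rel_222: "\<phi> (a @ [Two, Two, Two] @ b) = l2 * \<phi> (a @ b)"
  and rel_112: "\<phi> (a @ [One, One, Two] @ b) + \<phi> (a @ [One, Two, One] @ b) + \<phi> (a @ [Two, One, One] @ b)
      = l112 * \<phi> (a @ b)"
  and rel_122: "\<phi> (a @ [One, Two, Two] @ b) + \<phi> (a @ [Two, One, Two] @ b) + \<phi> (a @ [Two, Two, One] @ b)
      = l122 * \<phi> (a @ b)"
  using rel by (auto simp: word_relations_def)

text \<open>The relations without surrounding letters, where \<phi> [] = 1: the parameters of degree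
  three are the coefficients of c (m1 X + m2 Y)^3, the factor 3 counting words.\<close>

lemma coeffs: "l1 = c * m One ^ 3" "l2 = c * m Two ^ 3"
    "l112 = 3 * c * (m One)\<^sup>2 * m Two" "l122 = 3 * c * m One * (m Two)\<^sup>2"
  using rel_111[of "[]" "[]"] rel_222[of "[]" "[]"] rel_112[of "[]" "[]"] rel_122[of "[]" "[]"]
  by (simp_all add: cube \<phi>_Nil power2_eq_square power3_eq_cube algebra_simps)

text \<open>In length six the product of two cubes already satisfies the deformed relations of
  degree three, so the remainder F satisfies the undeformed ones.\<close>

lemma F_111:
  "F [One, One, One, i, j, k] = 0" "F [i, One, One, One, j, k] = 0"
  "F [i, j, One, One, One, k] = 0" "F [i, j, k, One, One, One] = 0"
  using rel_111[of "[]" "[i, j, k]"] rel_111[of "[i]" "[j, k]"] rel_111[of "[i, j]" "[k]"]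
    rel_111[of "[i, j, k]" "[]"]
  by (simp_all add: \<phi>_6' cube coeffs power3_eq_cube algebra_simps)

lemma F_222:
  "F [Two, Two, Two, i, j, k] = 0" "F [i, Two, Two, Two, j, k] = 0"
  "F [i, j, Two, Two, Two, k] = 0" "F [i, j, k, Two, Two, Two] = 0"
  using rel_222[of "[]" "[i, j, k]"] rel_222[of "[i]" "[j, k]"] rel_222[of "[i, j]" "[k]"]
    rel_222[of "[i, j, k]" "[]"]
  by (simp_all add: \<phi>_6' cube coeffs power3_eq_cube algebra_simps)

lemma F_211_sum:
  "F [One, One, Two, i, j, k] + F [One, Two, One, i, j, k] + F [Two, One, One, i, j, k] = 0"
  "F [i, One, One, Two, j, k] + F [i, One, Two, One, j, k] + F [i, Two, One, One, j, k] = 0"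
  "F [i, j, One, One, Two, k] + F [i, j, One, Two, One, k] + F [i, j, Two, One, One, k] = 0"
  "F [i, j, k, One, One, Two] + F [i, j, k, One, Two, One] + F [i, j, k, Two, One, One] = 0"
  using rel_112[of "[]" "[i, j, k]"] rel_112[of "[i]" "[j, k]"] rel_112[of "[i, j]" "[k]"]
    rel_112[of "[i, j, k]" "[]"]
  by (simp_all add: \<phi>_6' cube coeffs power2_eq_square algebra_simps)

lemma F_221_sum:
  "F [One, Two, Two, i, j, k] + F [Two, One, Two, i, j, k] + F [Two, Two, One, i, j, k] = 0"
  "F [i, One, Two, Two, j, k] + F [i, Two, One, Two, j, k] + F [i, Two, Two, One, j, k] = 0"
  "F [i, j, One, Two, Two, k] + F [i, j, Two, One, Two, k] + F [i, j, Two, Two, One, k] = 0"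
  "F [i, j, k, One, Two, Two] + F [i, j, k, Two, One, Two] + F [i, j, k, Two, Two, One] = 0"
  using rel_122[of "[]" "[i, j, k]"] rel_122[of "[i]" "[j, k]"] rel_122[of "[i, j]" "[k]"]
    rel_122[of "[i, j, k]" "[]"]
  by (simp_all add: \<phi>_6' cube coeffs power2_eq_square algebra_simps)

text \<open>The undeformed relations oriented as rewrite rules that eliminate the blocks 211, and in
  \<open>F_221\<close> the blocks 221.\<close>

lemma F_211:
  "F [Two, One, One, i, j, k] = - (F [One, One, Two, i, j, k] + F [One, Two, One, i, j, k])"
  "F [i, Two, One, One, j, k] = - (F [i, One, One, Two, j, k] + F [i, One, Two, One, j, k])"
  "F [i, j, Two, One, One, k] = - (F [i, j, One, One, Two, k] + F [i, j, One, Two, One, k])"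
  "F [i, j, k, Two, One, One] = - (F [i, j, k, One, One, Two] + F [i, j, k, One, Two, One])"
  using F_211_sum[THEN minus_unique] by (simp_all only:)

lemma F_221:
  "F [Two, Two, One, i, j, k] = - (F [One, Two, Two, i, j, k] + F [Two, One, Two, i, j, k])"
  "F [i, Two, Two, One, j, k] = - (F [i, One, Two, Two, j, k] + F [i, Two, One, Two, j, k])"
  "F [i, j, Two, Two, One, k] = - (F [i, j, One, Two, Two, k] + F [i, j, Two, One, Two, k])"
  "F [i, j, k, Two, Two, One] = - (F [i, j, k, One, Two, Two] + F [i, j, k, Two, One, Two])"
  using F_221_sum[THEN minus_unique] by (simp_all only:)

text \<open>F at the expansion of x12^3: the part of \<lambda>12 that the cube does not
  explain.\<close>

definition Fz :: 'k where
  "Fz = F [One, Two, One, Two, One, Two]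
       - q * (F [One, Two, One, Two, Two, One] + F [One, Two, Two, One, One, Two]
            + F [Two, One, One, Two, One, Two])
       + q\<^sup>2 * (F [One, Two, Two, One, Two, One] + F [Two, One, One, Two, Two, One]
            + F [Two, One, Two, One, One, Two])
       - F [Two, One, Two, One, Two, One]"

lemma l12_eq: "l12 = Fz + 3 * (q\<^sup>2 - q) * c\<^sup>2 * m One ^ 3 * m Two ^ 3"
proof -
  have "\<phi> [One, Two, One, Two, One, Two]
       - q * (\<phi> [One, Two, One, Two, Two, One] + \<phi> [One, Two, Two, One, One, Two]
            + \<phi> [Two, One, One, Two, One, Two])
       + q\<^sup>2 * (\<phi> [One, Two, Two, One, Two, One] + \<phi> [Two, One, One, Two, Two, One]
            + \<phi> [Two, One, Two, One, One, Two])
       - \<phi> [Two, One, Two, One, Two, One] = l12 * \<phi> []"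
    using rel[unfolded word_relations_def, rule_format, of "[]" "[]"] by simp
  \<comment> \<open>All eight words contain three letters of each kind, so the cubes contribute the
    same product to each, times the coefficient sum 1 - 3q + 3q^2 - 1.\<close>
  then have "l12 = Fz + (c * m One ^ 2 * m Two * (c * m One * m Two ^ 2)) * (1 - 3 * q + 3 * q\<^sup>2 - 1)"
    unfolding \<phi>_6' \<phi>_Nil Fz_def by (simp add: algebra_simps power2_eq_square)
  then show ?thesis by (simp add: algebra_simps power2_eq_square power3_eq_cube)
qed

lemma \<tau>_3: "\<tau> [i, j, k] = c * m i * m j * m k"
  using cube by (simp add: \<phi>_eq_\<tau>)

lemma \<tau>_0: "length w \<noteq> 3 \<Longrightarrow> \<tau> w = 0" and F_0: "length w \<noteq> 6 \<Longrightarrow> F w = 0"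
  by (simp_all add: \<tau>_def F_def)

text \<open>The instance of \<open>commutator_balance\<close> at the word in the name, cut into
  blocks of three. The four words are chosen in pairs with equal right-hand sides, whose elimination
  leaves a multiple of \<open>Fz\<close>.\<close>

lemma balance_121112121: "c * m One ^ 3 * (2 * F [One, One, Two, One, Two, Two] - F [One, Two, One, Two, One, Two]) = c * (m One)\<^sup>2 * m Two * F [One, One, Two, One, Two, One]"
proof -
  have "(1 + 2 * q) * (c * m One ^ 3 * (2 * F [One, One, Two, One, Two, Two] - F [One, Two, One, Two, One, Two]) - (c * (m One)\<^sup>2 * m Two * F [One, One, Two, One, Two, One])) = 0"
    using commutator_balance[of "[One, Two, One]" "[One, One, Two]" "[One, Two, One]"]
    by (simp add: wsplit_Cons \<tau>_3 \<tau>_0 F_0 F_111 F_222 cong: if_cong del: mult_eq_0_iff,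
        simp add: F_211 F_221 F_111 F_222 del: mult_eq_0_iff,
        simp add: power2_eq_square power3_eq_cube algebra_simps q_square q_mult_left
          del: mult_eq_0_iff mult_cancel_left mult_cancel_right)
  then show ?thesis using one_plus_2q by simp
qed

lemma balance_121211211: "c * m One ^ 3 * (F [One, Two, One, Two, One, Two] + F [Two, One, Two, One, Two, One] - F [One, One, Two, One, Two, Two]) = c * (m One)\<^sup>2 * m Two * F [One, One, Two, One, Two, One]"
proof -
  have "(1 + 2 * q) * (c * m One ^ 3 * (F [One, Two, One, Two, One, Two] + F [Two, One, Two, One, Two, One] - F [One, One, Two, One, Two, Two]) - (c * (m One)\<^sup>2 * m Two * F [One, One, Two, One, Two, One])) = 0"
    using commutator_balance[of "[One, Two, One]" "[Two, One, One]" "[Two, One, One]"]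
    by (simp add: wsplit_Cons \<tau>_3 \<tau>_0 F_0 F_111 F_222 cong: if_cong del: mult_eq_0_iff,
        simp add: F_211 F_221 F_111 F_222 del: mult_eq_0_iff,
        simp add: power2_eq_square power3_eq_cube algebra_simps q_square q_mult_left
          del: mult_eq_0_iff mult_cancel_left mult_cancel_right)
  then show ?thesis using one_plus_2q by simp
qed

lemma balance_212122122: "c * m Two ^ 3 * F [One, One, Two, One, Two, Two] = c * m One * (m Two)\<^sup>2 * F [Two, One, Two, One, Two, Two]"
proof -
  have "(1 + 2 * q) * (c * m Two ^ 3 * F [One, One, Two, One, Two, Two] - (c * m One * (m Two)\<^sup>2 * F [Two, One, Two, One, Two, Two])) = 0"
    using commutator_balance[of "[Two, One, Two]" "[One, Two, Two]" "[One, Two, Two]"]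
    by (simp add: wsplit_Cons \<tau>_3 \<tau>_0 F_0 F_111 F_222 cong: if_cong del: mult_eq_0_iff,
        simp add: F_211 F_221 F_111 F_222 del: mult_eq_0_iff,
        simp add: power2_eq_square power3_eq_cube algebra_simps q_square q_mult_left
          del: mult_eq_0_iff mult_cancel_left mult_cancel_right)
  then show ?thesis using one_plus_2q by simp
qed

lemma balance_212221212: "c * m Two ^ 3 * (F [Two, One, Two, One, Two, One] + 2 * F [One, Two, One, Two, One, Two] - 2 * F [One, One, Two, One, Two, Two]) = c * m One * (m Two)\<^sup>2 * F [Two, One, Two, One, Two, Two]"
proof -
  have "(1 + 2 * q) * (c * m Two ^ 3 * (F [Two, One, Two, One, Two, One] + 2 * F [One, Two, One, Two, One, Two] - 2 * F [One, One, Two, One, Two, Two]) - (c * m One * (m Two)\<^sup>2 * F [Two, One, Two, One, Two, Two])) = 0"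
    using commutator_balance[of "[Two, One, Two]" "[Two, Two, One]" "[Two, One, Two]"]
    by (simp add: wsplit_Cons \<tau>_3 \<tau>_0 F_0 F_111 F_222 cong: if_cong del: mult_eq_0_iff,
        simp add: F_211 F_221 F_111 F_222 del: mult_eq_0_iff,
        simp add: power2_eq_square power3_eq_cube algebra_simps q_square q_mult_left
          del: mult_eq_0_iff mult_cancel_left mult_cancel_right)
  then show ?thesis using one_plus_2q by simp
qed

lemma Fz_eq: "Fz = 3 * F [One, One, Two, One, Two, Two] - 2 * F [One, Two, One, Two, One, Two] - F [Two, One, Two, One, Two, One]"
  unfolding Fz_def by (simp add: F_211 F_221 F_111 F_222)
    (simp add: power2_eq_square algebra_simps q_square q_mult_left)

text \<open>The left-hand sides of the two balances differ by c m1^3 times the combination in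
  \<open>Fz_eq\<close>, while their right-hand sides agree; \<open>Fz_Two\<close> is
  analogous.\<close>

lemma Fz_One: "c * m One ^ 3 * Fz = 0"
  using balance_121112121 balance_121211211 unfolding Fz_eq by algebra

lemma Fz_Two: "c * m Two ^ 3 * Fz = 0"
  using balance_212122122 balance_212221212 unfolding Fz_eq by algebra

lemma l12_cube:
  assumes "l1 \<noteq> 0 \<or> l2 \<noteq> 0 \<or> l112 \<noteq> 0 \<or> l122 \<noteq> 0"
  shows "l12 = 3 * (q\<^sup>2 - q) * c\<^sup>2 * m One ^ 3 * m Two ^ 3"
proof -
  have "c \<noteq> 0 \<and> (m One \<noteq> 0 \<or> m Two \<noteq> 0)" using assms by (auto simp: coeffs)
  then have "Fz = 0" using Fz_One Fz_Two by auto
  then show ?thesis by (simp add: l12_eq)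
qed

text \<open>If all parameters of degree three vanish, (a) holds for every \<lambda>12. Otherwise c
  is nonzero, and (a) or (b) results according to whether the linear form involves one letter or
  both.\<close>

lemma parameters:
  "(l112 = 0 \<and> l122 = 0 \<and> (l1 = 0 \<and> l2 = 0 \<or> l1 = 0 \<and> l12 = 0 \<or> l2 = 0 \<and> l12 = 0)) \<or>
   (l112 * l122 \<noteq> 0 \<and> l1 = 1 / 3 * (l112\<^sup>2 / l122) \<and> l2 = 1 / 3 * (l122\<^sup>2 / l112) \<and>
     l12 = 1 / 3 * (q\<^sup>2 - q) * l112 * l122)"
proof (cases "l1 \<noteq> 0 \<or> l2 \<noteq> 0 \<or> l112 \<noteq> 0 \<or> l122 \<noteq> 0")
  case True
  then have l12: "l12 = 3 * (q\<^sup>2 - q) * c\<^sup>2 * m One ^ 3 * m Two ^ 3" by (rule l12_cube)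
  have "c \<noteq> 0" using True by (auto simp: coeffs)
  show ?thesis
  proof (cases "m One = 0 \<or> m Two = 0")
    case True
    then show ?thesis by (auto simp: coeffs l12)
  next
    case False
    then have nz: "m One \<noteq> 0" "m Two \<noteq> 0" by auto
    have "l112 * l122 \<noteq> 0" using nz \<open>c \<noteq> 0\<close> by (simp add: coeffs)
    moreover have "l1 = 1 / 3 * (l112\<^sup>2 / l122)" "l2 = 1 / 3 * (l122\<^sup>2 / l112)"
      using nz \<open>c \<noteq> 0\<close> by (simp_all add: coeffs field_simps power2_eq_square power3_eq_cube)
    moreover have "l12 = 1 / 3 * (q\<^sup>2 - q) * l112 * l122"
      by (simp add: coeffs l12 power2_eq_square power3_eq_cube)
    ultimately show ?thesis by blast
  qed
qed auto

end

lemma (in word_exponential) exponential_parameters: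
  assumes "word_relations (*) q l1 l2 l12 l112 l122 \<phi>"
  shows "(l112 = 0 \<and> l122 = 0 \<and> (l1 = 0 \<and> l2 = 0 \<or> l1 = 0 \<and> l12 = 0 \<or> l2 = 0 \<and> l12 = 0)) \<or>
   (l112 * l122 \<noteq> 0 \<and> l1 = 1 / 3 * (l112\<^sup>2 / l122) \<and> l2 = 1 / 3 * (l122\<^sup>2 / l112) \<and>
     l12 = 1 / 3 * (q\<^sup>2 - q) * l112 * l122)"
proof -
  obtain c m where cm: "\<And>i j k. \<phi> [i, j, k] = c * m i * m j * m k" using cube_form by blast
  interpret word_exponential_relations q \<phi> \<eta> c m l1 l2 l12 l112 l122
    by unfold_locales (fact cm assms)+
  show ?thesis by (rule parameters)
qed

section \<open>Cubes of linear forms\<close>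

context word_split
begin

context
  fixes lin :: "idx \<Rightarrow> 'k"
begin

definition weight :: "idx list \<Rightarrow> 'k" where
  "weight w = prod_list (map lin w)"

text \<open>The sum of all powers of the linear form with exponent congruent to r modulo 3; for r =
  0 it is the geometric series of the cube.\<close>

definition weight_mod :: "nat \<Rightarrow> idx list \<Rightarrow> 'k" where
  "weight_mod r w = (if length w mod 3 = r then weight w else 0)"

definition weight_len :: "nat \<Rightarrow> idx list \<Rightarrow> 'k" where
  "weight_len n w = (if length w = n then weight w else 0)"

text \<open>The cube of the linear form evaluated at u @ v for nonempty u and v, hence a Hochschild
  cocycle.\<close>

definition weight_form :: "idx list \<Rightarrow> idx list \<Rightarrow> 'k" where
  "weight_form u v = weight_len 1 u * weight_len 2 v + weight_len 2 u * weight_len 1 v"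

lemma weight_simps [simp]: "weight [] = 1" "weight (i # w) = lin i * weight w" "weight (u @ v) = weight u * weight v"
  by (simp_all add: weight_def)

lemma weight_mod_Cons: "r < 3 \<Longrightarrow> weight_mod r (i # w) = lin i * weight_mod ((r + 2) mod 3) w"
proof -
  assume "r < 3"
  then have "Suc (length w) mod 3 = r \<longleftrightarrow> length w mod 3 = (r + 2) mod 3" by presburger
  then show ?thesis by (simp add: weight_mod_def)
qed

lemma weight_mod_q: "q ^ length w * weight_mod r w = q ^ r * weight_mod r w"
  by (simp add: weight_mod_def q_power_mod[of "length w"])

lemma weight_len_Cons: "weight_len (Suc n) (i # w) = lin i * weight_len n w"
  by (simp add: weight_len_def)

lemma weight_len_0: "weight_len 0 w = (if w = [] then 1 else 0)"
  by (simp add: weight_len_def)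

text \<open>The q-Pascal recursion: the first letter goes left, or goes right past a word of length
  r modulo 3.\<close>

lemma weight_mod_conv_Cons:
  assumes "r < 3"
  shows "word_conv (weight_mod r) (weight_len (Suc n)) (i # w) =
    lin i * (word_conv (weight_mod ((r + 2) mod 3)) (weight_len (Suc n)) w +
      q ^ r * word_conv (weight_mod r) (weight_len n) w)"
proof -
  have "word_conv (weight_mod r) (weight_len (Suc n)) (i # w) =
    wsplit w (\<lambda>a b. lin i * (weight_mod ((r + 2) mod 3) a * weight_len (Suc n) b)) +
    wsplit w (\<lambda>a b. lin i * (q ^ length a * weight_mod r a * weight_len n b))"
    by (simp add: word_conv_def wsplit_Cons weight_mod_Cons[OF assms] weight_len_Cons mult_ac)
  then show ?thesis
    by (simp add: word_conv_def weight_mod_q wsplit_mult_left distrib_left mult.assoc)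
qed

lemma weight_mod_conv_0: "word_conv (weight_mod r) (weight_len 0) w = weight_mod r w"
  by (simp add: word_conv_def weight_len_0 wsplit_right_Nil)

text \<open>The coefficients are the Gaussian binomials \<open>(r + 1 choose 1)\<close> and \<open>(r + 2 choose 2)\<close> at \<open>q\<close>.\<close>

lemma weight_mod_conv_1:
  "r < 3 \<Longrightarrow> word_conv (weight_mod r) (weight_len 1) w =
    (if r = 0 then 1 else if r = 1 then 1 + q else 0) * weight_mod ((r + 1) mod 3) w"
proof (induction w arbitrary: r)
  case Nil
  then show ?case by (auto simp: word_conv_def weight_len_def weight_mod_def)
next
  case (Cons i w)
  from Cons.prems consider "r = 0" | "r = 1" | "r = 2" by linarith
  then show ?case
  proof cases
    case 1
    then show ?thesis
      using weight_mod_conv_Cons[of r 0 i w] Cons.IH[of 2] weight_mod_Cons[of 1 i w]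
      by (simp add: weight_mod_conv_0 numeral_2_eq_2)
  next
    case 2
    then show ?thesis
      using weight_mod_conv_Cons[of r 0 i w] Cons.IH[of 0] weight_mod_Cons[of 2 i w]
      by (simp add: weight_mod_conv_0 numeral_2_eq_2 algebra_simps)
  next
    case 3
    then show ?thesis
      using weight_mod_conv_Cons[of r 0 i w] Cons.IH[of 1]
      by (simp add: weight_mod_conv_0 numeral_2_eq_2 q_square q_mult_left algebra_simps)
  qed
qed

lemma weight_mod_conv_2:
  "r < 3 \<Longrightarrow> word_conv (weight_mod r) (weight_len 2) w =
    (if r = 0 then weight_mod 2 w else 0)"
proof (induction w arbitrary: r)
  case Nil
  then show ?case by (auto simp: word_conv_def weight_len_def weight_mod_def)
next
  case (Cons i w)
  from Cons.prems consider "r = 0" | "r = 1" | "r = 2" by linarith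
  then show ?case
  proof cases
    case 1
    then show ?thesis
      using weight_mod_conv_Cons[of r 1 i w] Cons.IH[of 2] weight_mod_Cons[of 2 i w]
        weight_mod_conv_1[of 0 w]
      by (simp add: numeral_2_eq_2)
  next
    case 2
    then show ?thesis
      using weight_mod_conv_Cons[of r 1 i w] Cons.IH[of 0] weight_mod_conv_1[of 1 w]
      by (simp add: numeral_2_eq_2 q_square q_mult_left algebra_simps)
  next
    case 3
    then show ?thesis
      using weight_mod_conv_Cons[of r 1 i w] Cons.IH[of 1] weight_mod_conv_1[of 2 w]
      by (simp add: numeral_2_eq_2)
  qed
qed

lemma supp3_weight_mod: "supp3 (weight_mod 0)"
  by (auto simp: supp3_def weight_mod_def)

lemma weight_mod_append:
  "weight_mod 0 (u @ v) = weight_mod 0 u * weight_mod 0 v +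
     weight_mod 1 u * weight_mod 2 v + weight_mod 2 u * weight_mod 1 v"
proof -
  have *: "(length u + length v) mod 3 = 0 \<longleftrightarrow> length u mod 3 = 0 \<and> length v mod 3 = 0 \<or>
      length u mod 3 = 1 \<and> length v mod 3 = 2 \<or> length u mod 3 = 2 \<and> length v mod 3 = 1"
    by presburger
  show ?thesis
    unfolding weight_mod_def length_append * by auto
qed

text \<open>The lengths of u and v have residues (0,0), (1,2) or (2,1). Convolving the geometric
  series with the first and second power of the linear form yields exactly the parts of residues 1
  and 2, with coefficient 1.\<close>

lemma weight_mod_coboundary:
  "(\<lambda>u v. weight_mod 0 (u @ v)) =
     word_conv2 (\<lambda>u v. weight_mod 0 u * weight_mod 0 v) (\<lambda>u v. word_unit2 u v + weight_form u v)"
proof (intro ext)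
  fix u v
  let ?\<theta> = "weight_mod 0"
  have add: "word_conv2 s (\<lambda>u v. t u v + t' u v) = (\<lambda>u v. word_conv2 s t u v + word_conv2 s t' u v)" for s t t'
    by (simp add: fun_eq_iff word_conv2_def distrib_left wsplit2_add)
  have "word_conv2 (\<lambda>u v. ?\<theta> u * ?\<theta> v) (\<lambda>u v. word_unit2 u v + weight_form u v) u v =
      ?\<theta> u * ?\<theta> v + word_conv ?\<theta> (weight_len 1) u * word_conv ?\<theta> (weight_len 2) v
        + word_conv ?\<theta> (weight_len 2) u * word_conv ?\<theta> (weight_len 1) v"
    unfolding weight_form_def add by (simp add: word_conv2_tensor[OF supp3_weight_mod])
  then show "?\<theta> (u @ v) = word_conv2 (\<lambda>u v. ?\<theta> u * ?\<theta> v) (\<lambda>u v. word_unit2 u v + weight_form u v) u v"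
    using weight_mod_conv_1[of 0] weight_mod_conv_2[of 0] by (simp add: weight_mod_append)
qed

text \<open>Powers m and n of the linear form convolve to the Gaussian binomial (m + n choose m)
  times power m + n; 3 choose 1, 3 choose 2 and 4 choose 2 contain the factor 1 + q + q^2.\<close>

lemma weight_len_conv_0:
  assumes "(m, n) \<in> {(1, 2), (2, 1), (2, 2)}"
  shows "word_conv (weight_len m) (weight_len n) w = 0"
proof (cases "length w = m + n")
  case True
  then consider a b c where "m = 1" "n = 2" "w = [a, b, c]" | a b c where "m = 2" "n = 1" "w = [a, b, c]"
    | a b c d where "m = 2" "n = 2" "w = [a, b, c, d]"
    using assms by (auto simp: numeral_eq_Suc length_Suc_conv)
  then show ?thesis
    by cases (simp_all add: word_conv_def wsplit_Cons weight_len_def algebra_simps q_square q_mult_left)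
next
  case False
  then show ?thesis
    unfolding word_conv_def by (intro wsplit_eq_0) (auto simp: weight_len_def)
qed

text \<open>Each of the four products has a vanishing factor in u or in v: the exponents (1,2) and
  (2,1) vanish by themselves, and (1,1) in one argument is accompanied by (2,2) in the
  other.\<close>

lemma weight_form_square: "word_conv2 weight_form weight_form u v = 0"
proof -
  let ?c = "\<lambda>i k. word_conv (weight_len i) (weight_len k)"
  have *: "wsplit2 u v (\<lambda>a b c d. weight_len i a * weight_len j b * (weight_len k c * weight_len l d)) =
      q ^ (k * j) * (?c i k u * ?c j l v)" for i j k l
  proof -
    have "wsplit2 u v (\<lambda>a b c d. weight_len i a * weight_len j b * (weight_len k c * weight_len l d)) =
      wsplit u (\<lambda>a c. wsplit v (\<lambda>b d. q ^ (k * j) * (weight_len i a * weight_len k c) * (weight_len j b * weight_len l d)))"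
      unfolding wsplit2_def by (intro wsplit_cong) (simp add: weight_len_def)
    then show ?thesis unfolding word_conv_def
      by (simp only: wsplit_mult_left wsplit_mult_right) (simp only: mult.assoc)
  qed
  show ?thesis
    unfolding word_conv2_def weight_form_def
    by (simp add: distrib_left distrib_right wsplit2_add * weight_len_conv_0)
qed

text \<open>A block of three letters keeps the length modulo 3, so it contributes only the product
  of the values of the linear form. In the relation of degree six all eight products agree and the
  coefficients add up to 3 (q^2 - q).\<close>

lemma weight_mod_relations:
  "word_relations (*) q (lin One ^ 3) (lin Two ^ 3) (3 * (q\<^sup>2 - q) * lin One ^ 3 * lin Two ^ 3)
     (3 * (lin One)\<^sup>2 * lin Two) (3 * lin One * (lin Two)\<^sup>2) (weight_mod 0)"
proof -
  have 3: "weight_mod 0 (a @ [i, j, k] @ b) = lin i * lin j * lin k * weight_mod 0 (a @ b)" for a i j k b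
  proof -
    have "length (a @ [i, j, k] @ b) = length (a @ b) + 3" by simp
    then have "length (a @ [i, j, k] @ b) mod 3 = length (a @ b) mod 3" by (simp only: mod_add_self2)
    then show ?thesis unfolding weight_mod_def by simp
  qed
  have 6: "weight_mod 0 (a @ [i, j, k, i', j', k'] @ b) =
      lin i * lin j * lin k * (lin i' * lin j' * lin k') * weight_mod 0 (a @ b)" for a i j k i' j' k' b
    using 3[of a i j k "[i', j', k'] @ b"] 3[of a i' j' k' b] by simp
  show ?thesis
    unfolding word_relations_def 3 6
    by (simp add: power2_eq_square power3_eq_cube algebra_simps)
qed

end

end

section \<open>The deformation of the cube of \<open>x\<^sub>1\<^sub>2\<close>\<close>

context word_split
begin

definition letter :: "idx \<Rightarrow> idx list \<Rightarrow> 'k" where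
  "letter i w = (if w = [i] then 1 else 0)"

lemma conv_letter_left:
  "word_conv (letter i) f [] = 0"
  "word_conv (letter i) f (j # w) = (if i = j then f w else 0) + q * word_conv (letter i) (\<lambda>b. f (j # b)) w"
proof -
  show "word_conv (letter i) f [] = 0" by (simp add: word_conv_def letter_def)
  have "wsplit w (\<lambda>a b. letter i (j # a) * f b) = wsplit w (\<lambda>a b. (if a = [] then 1 else 0) * ((if i = j then 1 else 0) * f b))"
    by (rule wsplit_cong) (simp add: letter_def)
  also have "\<dots> = (if i = j then f w else 0)" by (subst wsplit_left_Nil) simp
  finally have 1: "wsplit w (\<lambda>a b. letter i (j # a) * f b) = (if i = j then f w else 0)" .
  have "wsplit w (\<lambda>a b. q ^ length a * (letter i a * f (j # b))) = wsplit w (\<lambda>a b. q * (letter i a * f (j # b)))"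
    by (rule wsplit_cong) (simp add: letter_def)
  then show "word_conv (letter i) f (j # w) = (if i = j then f w else 0) + q * word_conv (letter i) (\<lambda>b. f (j # b)) w"
    by (simp add: word_conv_def wsplit_Cons 1 wsplit_mult_left)
qed

text \<open>Quantum shuffle product with a letter: a sum over the positions of that letter, weighted
  by q to the number of letters before it.\<close>

lemma conv_letter_list:
  "word_conv (letter i) f [a] = (if i = a then f [] else 0)"
  "word_conv (letter i) f [a, b] = (if i = a then f [b] else 0)
     + q * (if i = b then f [a] else 0)"
  "word_conv (letter i) f [a, b, c] = (if i = a then f [b, c] else 0)
     + q * (if i = b then f [a, c] else 0)
     + q ^ 2 * (if i = c then f [a, b] else 0)"
  "word_conv (letter i) f [a, b, c, d] = (if i = a then f [b, c, d] else 0)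
     + q * (if i = b then f [a, c, d] else 0)
     + q ^ 2 * (if i = c then f [a, b, d] else 0)
     + q ^ 3 * (if i = d then f [a, b, c] else 0)"
  "word_conv (letter i) f [a, b, c, d, e] = (if i = a then f [b, c, d, e] else 0)
     + q * (if i = b then f [a, c, d, e] else 0)
     + q ^ 2 * (if i = c then f [a, b, d, e] else 0)
     + q ^ 3 * (if i = d then f [a, b, c, e] else 0)
     + q ^ 4 * (if i = e then f [a, b, c, d] else 0)"
  by (simp_all add: conv_letter_left numeral_eq_Suc algebra_simps)

lemma conv_letter_right:
  "word_conv f (letter i) [] = 0"
  "word_conv f (letter i) (j # w) = word_conv (\<lambda>a. f (j # a)) (letter i) w + (if i = j then q ^ length w * f w else 0)"
proof -
  show "word_conv f (letter i) [] = 0" by (simp add: word_conv_def letter_def)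
  have "wsplit w (\<lambda>a b. q ^ length a * (f a * letter i (j # b))) =
      wsplit w (\<lambda>a b. ((if i = j then 1 else 0) * (q ^ length a * f a)) * (if b = [] then 1 else 0))"
    by (rule wsplit_cong) (simp add: letter_def)
  also have "\<dots> = (if i = j then q ^ length w * f w else 0)" by (subst wsplit_right_Nil) simp
  finally show "word_conv f (letter i) (j # w) = word_conv (\<lambda>a. f (j # a)) (letter i) w + (if i = j then q ^ length w * f w else 0)"
    by (simp add: word_conv_def wsplit_Cons)
qed

text \<open>In tensor notation \<open>z_form l\<close> is \<open>l\<close> times \<open>1 \<otimes> (12 - 21) \<otimes> (12 - 21) \<otimes> 2\<close>.\<close>

definition z_form :: "'k \<Rightarrow> idx list \<Rightarrow> 'k" where
  "z_form l w =
     (if w = [One, One, Two, One, Two, Two] \<or> w = [One, Two, One, Two, One, Two] then l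
      else if w = [One, One, Two, Two, One, Two] \<or> w = [One, Two, One, One, Two, Two] then - l else 0)"

lemma z_form_len: "length w \<noteq> 6 \<Longrightarrow> z_form l w = 0"
  by (auto simp: z_form_def)

lemma q_power_small: "q ^ 2 = - 1 - q" "q ^ 3 = 1" "q ^ 4 = q" "q ^ 5 = - 1 - q" "q ^ 6 = 1"
  using q_power_mod[of 4] q_power_mod[of 5] q_power_mod[of 6] q_square
  by (simp_all add: power2_eq_square q_cube)

lemma conv_eq_0_length:
  assumes "\<And>w. length w \<noteq> m \<Longrightarrow> f w = 0" "\<And>w. length w \<noteq> n \<Longrightarrow> g w = 0" "length w \<noteq> m + n"
  shows "word_conv f g w = 0"
  unfolding word_conv_def
proof (rule wsplit_eq_0)
  fix a b :: "idx list"
  assume "length a + length b = length w"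
  then have "length a \<noteq> m \<or> length b \<noteq> n" using assms(3) by auto
  then show "f a * g b = 0" using assms(1,2) by auto
qed

text \<open>Both sides can be nonzero only in length seven, where the identity is checked word by
  word. So \<open>z_form\<close> commutes with everything generated by letters under
  convolution.\<close>

lemma z_form_letter: "word_conv (z_form l) (letter i) = word_conv (letter i) (z_form l)"
proof
  fix w
  show "word_conv (z_form l) (letter i) w = word_conv (letter i) (z_form l) w"
  proof (cases "length w = 7")
    case True
    then obtain a b c d e f g where w: "w = [a, b, c, d, e, f, g]"
      by (auto simp: numeral_eq_Suc length_Suc_conv)
    show ?thesis
      unfolding w conv_letter_left conv_letter_right z_form_def
      by (cases i; cases a; cases b; cases c; cases d; cases e; cases f; cases g;
          simp; simp add: algebra_simps q_square q_mult_left)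
  next
    case False
    have "word_conv (z_form l) (letter i) w = 0"
      by (rule conv_eq_0_length[of 6 _ 1]) (use False z_form_len in \<open>auto simp: letter_def\<close>)
    moreover have "word_conv (letter i) (z_form l) w = 0"
      by (rule conv_eq_0_length[of 1 _ 6]) (use False z_form_len in \<open>auto simp: letter_def\<close>)
    ultimately show ?thesis by simp
  qed
qed

lemma z_form_commute_conv:
  assumes "word_conv (z_form l) f = word_conv f (z_form l)" "word_conv (z_form l) g = word_conv g (z_form l)"
  shows "word_conv (z_form l) (word_conv f g) = word_conv (word_conv f g) (z_form l)"
  by (metis assms word_conv_assoc)

lemma z_form_commute_linear:
  assumes "word_conv (z_form l) f = word_conv f (z_form l)" "word_conv (z_form l) g = word_conv g (z_form l)"
  shows "word_conv (z_form l) (\<lambda>w. r * f w + s * g w) = word_conv (\<lambda>w. r * f w + s * g w) (z_form l)"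
proof
  fix w
  have "wsplit w (\<lambda>a b. z_form l a * f b) = wsplit w (\<lambda>a b. f a * z_form l b)"
    "wsplit w (\<lambda>a b. z_form l a * g b) = wsplit w (\<lambda>a b. g a * z_form l b)"
    using assms by (simp_all add: word_conv_def fun_eq_iff)
  then show "word_conv (z_form l) (\<lambda>w. r * f w + s * g w) w = word_conv (\<lambda>w. r * f w + s * g w) (z_form l) w"
    by (simp add: word_conv_def distrib_left distrib_right wsplit_add mult.left_commute mult.assoc wsplit_mult_left)
qed

definition letters_conv :: "idx list \<Rightarrow> idx list \<Rightarrow> 'k" where
  "letters_conv w = foldr (\<lambda>i. word_conv (letter i)) w word_unit"

lemma z_form_letters_conv:
  "word_conv (z_form l) (letters_conv w) = word_conv (letters_conv w) (z_form l)"
  by (induction w) (simp_all add: letters_conv_def z_form_commute_conv z_form_letter)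

lemma letter_len: "length w \<noteq> 1 \<Longrightarrow> letter i w = 0"
  by (auto simp: letter_def)

lemma letters_conv_len: "length v \<noteq> length w \<Longrightarrow> letters_conv w v = 0"
proof (induction w arbitrary: v)
  case (Cons i w)
  then show ?case
    using conv_eq_0_length[of 1 "letter i" "length w" "letters_conv w" v] letter_len[of _ i]
    by (auto simp: letters_conv_def)
qed (auto simp: letters_conv_def word_unit_def)

text \<open>Shows that \<open>z_form\<close> with its first letter removed is generated by letters
  under convolution. The coefficients solve the linear system obtained by expanding the two products
  on the words of length five.\<close>

lemma z_form_tail:
  "z_form l (One # w) = (- l * (2 + q) / 3) * letters_conv [One, Two, One, Two, Two] w
     + (l / 3) * letters_conv [Two, One, Two, One, Two] w"
proof (cases "length w = 5")
  case True
  then obtain a b c d e where w: "w = [a, b, c, d, e]"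
    by (auto simp: numeral_eq_Suc length_Suc_conv)
  have "3 * z_form l (One # w) = - l * (2 + q) * letters_conv [One, Two, One, Two, Two] w
     + l * letters_conv [Two, One, Two, One, Two] w"
    unfolding w z_form_def letters_conv_def
    by (cases a; cases b; cases c; cases d; cases e;
        simp add: conv_letter_list letter_def q_power_small; simp add: algebra_simps q_square q_mult_left)
  then show ?thesis by (simp add: field_simps)
next
  case False
  then show ?thesis by (simp add: letters_conv_len z_form_len)
qed

lemma z_form_tail_commute:
  "word_conv (z_form l) (\<lambda>w. z_form l (i # w)) = word_conv (\<lambda>w. z_form l (i # w)) (z_form l)"
proof (cases i)
  case One
  show ?thesis unfolding One z_form_tail
    by (rule z_form_commute_linear) (rule z_form_letters_conv)+
next
  case Two
  have "(\<lambda>w. z_form l (Two # w)) = (\<lambda>w. 0)" by (simp add: z_form_def fun_eq_iff)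
  then show ?thesis by (simp add: Two word_conv_def fun_eq_iff)
qed

lemma z_form_commute_1:
  assumes "\<And>w. length w \<noteq> 1 \<Longrightarrow> f w = 0"
  shows "word_conv (z_form l) f = word_conv f (z_form l)"
proof -
  have f_eq: "f = (\<lambda>w. f [One] * letter One w + f [Two] * letter Two w)"
  proof
    fix w
    show "f w = f [One] * letter One w + f [Two] * letter Two w"
    proof (cases "length w = 1")
      case True
      then obtain a where "w = [a]" by (auto simp: length_Suc_conv)
      then show ?thesis by (cases a) (simp_all add: letter_def)
    qed (use assms in \<open>auto simp: letter_def\<close>)
  qed
  have "word_conv (z_form l) (\<lambda>w. f [One] * letter One w + f [Two] * letter Two w) =
      word_conv (\<lambda>w. f [One] * letter One w + f [Two] * letter Two w) (z_form l)"
    by (rule z_form_commute_linear) (rule z_form_letter)+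
  then show ?thesis unfolding f_eq[symmetric] .
qed

text \<open>Every functional in degree two is a combination of products of two letters: the system f
  [a, b] = g a b + q g b a has determinant 1 - q^2, which is nonzero.\<close>

lemma z_form_commute_2:
  assumes "\<And>w. length w \<noteq> 2 \<Longrightarrow> f w = 0"
  shows "word_conv (z_form l) f = word_conv f (z_form l)"
proof -
  define g where "g i j = (f [i, j] - q * f [j, i]) / (1 - q * q)" for i j
  define h where "h i w = g i One * letters_conv [i, One] w + g i Two * letters_conv [i, Two] w" for i w
  have qq: "1 - q * q \<noteq> 0"
    using q_power_eq_1_iff[of 2] by (simp add: power2_eq_square)
  have f_eq: "f = (\<lambda>w. 1 * h One w + 1 * h Two w)"
  proof
    fix w
    show "f w = 1 * h One w + 1 * h Two w"
    proof (cases "length w = 2")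
      case True
      then obtain a b where w: "w = [a, b]" by (auto simp: length_Suc_conv numeral_eq_Suc)
      have "h One w + h Two w = g a b + q * g b a"
        unfolding w by (cases a; cases b) (simp_all add: h_def letters_conv_def conv_letter_list letter_def algebra_simps)
      also have "\<dots> = (f [a, b] * (1 - q * q)) / (1 - q * q)"
        by (simp add: g_def algebra_simps flip: add_divide_distrib diff_divide_distrib)
      finally show ?thesis using qq by (simp add: w)
    qed (use assms in \<open>auto simp: h_def letters_conv_len\<close>)
  qed
  have "word_conv (z_form l) (h i) = word_conv (h i) (z_form l)" for i
    unfolding h_def by (rule z_form_commute_linear) (rule z_form_letters_conv)+
  then show ?thesis unfolding f_eq by (intro z_form_commute_linear)
qed

end

text \<open>What \<sigma> satisfies when \<lambda>12 is the only parameter; the bounds 8 and 9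
  reflect the top degree 8 of the Nichols algebra. The heuristic is that \<phi> is exp(z), that
  pulling z back along multiplication gives P + \<eta> with P and \<eta> commuting, and hence
  \<sigma> = exp(-P) exp(P + \<eta>) = exp(\<eta>).\<close>

locale word_cocycle_z = word_cocycle q \<sigma> for q :: "'k::field_char_0" and \<sigma> +
  fixes l :: 'k
  assumes \<sigma>_3: "length u + length v = 3 \<Longrightarrow> \<sigma> u v = 0"
    and \<sigma>_long: "9 \<le> length v \<Longrightarrow> \<sigma> u v = 0"
    and \<sigma>_8: "length w = 8 \<Longrightarrow> \<sigma> [i] w = 0"
    and \<phi>_6: "length w = 6 \<Longrightarrow> \<phi> w = z_form l w"
begin

definition \<eta> :: "idx list \<Rightarrow> idx list \<Rightarrow> 'k" where
  "\<eta> u v = (if length u + length v = 6 then \<sigma> u v else 0)"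

lemma \<phi>_letter: "\<phi> [i] = 0" "\<phi> [i, j] = 0" "\<phi> [i, j, k] = 0"
proof -
  have 2: "\<not> 3 dvd Suc (Suc 0)" by presburger
  show 0: "\<phi> [i] = 0" "\<phi> [i, j] = 0" for i j
    using \<phi>_supp[of "[i]"] \<phi>_supp[of "[i, j]"] 2 by auto
  show "\<phi> [i, j, k] = 0"
    using \<sigma>_3[of "[i]" "[j, k]"] by (simp add: \<phi>_Cons[of i "[j, k]"] wsplit_Cons 0)
qed

lemma \<phi>_3: "length w = 3 \<Longrightarrow> \<phi> w = 0"
  by (auto simp: numeral_eq_Suc length_Suc_conv \<phi>_letter)

lemma \<phi>_cases:
  assumes "length w < 9"
  shows "\<phi> w = word_unit w + z_form l w"
proof (cases "3 dvd length w")
  case True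
  then have "length w = 0 \<or> length w = 3 \<or> length w = 6" using assms by presburger
  then show ?thesis using \<phi>_3[of w] \<phi>_6[of w] z_form_len[of w l] by (auto simp: word_unit_def)
next
  case False
  then have "length w \<noteq> 0" "length w \<noteq> 6" by (auto intro: ccontr)
  then show ?thesis using \<phi>_supp[of w] False z_form_len[of w l] by (auto simp: word_unit_def)
qed

text \<open>The support forces the length of w to be 2 modulo 3; the locale excludes 2, 8 and all
  lengths from 9 on, and in length five no nonempty word can go to \<phi> in the recursion.\<close>

lemma \<sigma>_letter: "\<sigma> [i] w = z_form l (i # w)"
proof (cases "length w = 5")
  case True
  have "\<phi> (i # w) = wsplit w (\<lambda>a b. (if a = [] then 1 else 0) * \<sigma> [i] b)"
    unfolding \<phi>_Cons
  proof (rule wsplit_cong)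
    fix a b :: "idx list"
    assume *: "length a + length b = length w"
    then have "\<phi> a = word_unit a" using True by (simp add: \<phi>_cases z_form_len)
    then show "\<phi> a * \<sigma> [i] b = (if a = [] then 1 else 0) * \<sigma> [i] b" by (simp add: word_unit_def)
  qed
  then show ?thesis using True by (simp add: \<phi>_6 wsplit_left_Nil)
next
  case False
  have "\<sigma> [i] w = 0"
  proof (rule ccontr)
    assume *: "\<sigma> [i] w \<noteq> 0"
    then have "3 dvd Suc (length w)" using \<sigma>_supp[of "[i]" w] by simp
    moreover have "length w < 9" using * \<sigma>_long[of w] by (meson not_le)
    moreover have "length w \<noteq> 2" "length w \<noteq> 8" using * \<sigma>_3[of "[i]" w] \<sigma>_8[of w i] by auto
    ultimately show False using False by presburger
  qed
  then show ?thesis using False by (simp add: z_form_len)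
qed

text \<open>In z convolved with itself the first letter belongs to the first or to the second
  factor. Both contributions equal \<phi> w, because z commutes with its own tail.\<close>

lemma \<phi>_12:
  assumes "length w = 12"
  shows "2 * \<phi> w = word_conv (z_form l) (z_form l) w"
proof -
  obtain i v where w: "w = i # v" "length v = 11"
    using assms by (auto simp: numeral_eq_Suc length_Suc_conv)
  have "\<phi> w = wsplit v (\<lambda>a b. \<phi> a * z_form l (i # b))"
    by (simp add: w \<phi>_Cons \<sigma>_letter)
  also have "\<dots> = wsplit v (\<lambda>a b. z_form l a * z_form l (i # b))"
  proof (rule wsplit_cong)
    fix a b :: "idx list"
    assume *: "length a + length b = length v"
    show "\<phi> a * z_form l (i # b) = z_form l a * z_form l (i # b)"
      using * w by (cases "length b = 5") (simp_all add: \<phi>_6 z_form_len)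
  qed
  finally have 1: "\<phi> w = word_conv (z_form l) (\<lambda>b. z_form l (i # b)) v"
    by (simp add: word_conv_def)
  have "wsplit v (\<lambda>a b. q ^ length a * (z_form l a * z_form l (i # b))) = \<phi> w"
    unfolding 1 word_conv_def
  proof (rule wsplit_cong)
    fix a b :: "idx list"
    show "q ^ length a * (z_form l a * z_form l (i # b)) = z_form l a * z_form l (i # b)"
      by (cases "length a = 6") (simp_all add: z_form_len q_power_dvd)
  qed
  moreover have "wsplit v (\<lambda>a b. z_form l (i # a) * z_form l b) = \<phi> w"
    unfolding 1 z_form_tail_commute by (simp add: word_conv_def)
  ultimately show ?thesis by (simp add: word_conv_def w wsplit_Cons)
qed

lemma \<phi>_6_dvd: "\<phi> w \<noteq> 0 \<Longrightarrow> 6 dvd length w"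
proof (induction "length w" arbitrary: w rule: less_induct)
  case less
  show ?case
  proof (cases w)
    case (Cons i v)
    show ?thesis
    proof (rule ccontr)
      assume nd: "\<not> 6 dvd length w"
      have "wsplit v (\<lambda>a b. \<phi> a * z_form l (i # b)) = 0"
      proof (rule wsplit_eq_0)
        fix a b :: "idx list"
        assume *: "length a + length b = length v"
        have "length b \<noteq> 5 \<or> \<not> 6 dvd length a"
        proof (rule ccontr)
          assume "\<not> ?thesis"
          then have "6 dvd length a + 6" "length w = length a + 6" using * Cons by auto
          then show False using nd by simp
        qed
        moreover have "length a < length w" using * Cons by simp
        ultimately show "\<phi> a * z_form l (i # b) = 0"
          using less.hyps[of a] by (auto simp: z_form_len)
      qed
      then show False using less.prems by (simp add: Cons \<phi>_Cons \<sigma>_letter)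
    qed
  qed simp
qed

lemma \<sigma>_6_dvd: "\<sigma> u v \<noteq> 0 \<Longrightarrow> 6 dvd length u + length v"
proof (induction "length u + length v" arbitrary: u v rule: less_induct)
  case less
  show ?case
  proof (rule ccontr)
    assume nd: "\<not> 6 dvd length u + length v"
    have "\<phi> (u @ v) = word_conv2 (\<lambda>u v. \<phi> u * \<phi> v) \<sigma> u v"
      using \<phi>_append by (simp add: fun_eq_iff)
    also have "\<dots> = word_conv2 word_unit2 \<sigma> u v"
      unfolding word_conv2_def
    proof (rule wsplit2_cong, goal_cases)
      case (1 a b c d)
      show ?case
      proof (cases "a = [] \<and> b = []")
        case True
        then show ?thesis by (simp add: word_unit2_def word_unit_def)
      next
        case False
        then have lt: "length c + length d < length u + length v" using 1 by (cases a; cases b) auto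
        have "\<phi> a * \<phi> b * \<sigma> c d = 0"
        proof (rule ccontr)
          assume nz: "\<phi> a * \<phi> b * \<sigma> c d \<noteq> 0"
          then have "6 dvd length a" "6 dvd length b" "6 dvd length c + length d"
            using \<phi>_6_dvd[of a] \<phi>_6_dvd[of b] less.hyps[OF lt] by auto
          then have "6 dvd length a + length b + (length c + length d)" by (meson dvd_add)
          moreover have "length a + length b + (length c + length d) = length u + length v"
            using 1 by linarith
          ultimately show False using nd by simp
        qed
        then show ?thesis using False by (auto simp: word_unit2_def word_unit_def)
      qed
    qed
    finally have "\<sigma> u v = \<phi> (u @ v)" by simp
    then show False using less.prems \<phi>_6_dvd[of "u @ v"] nd by simp
  qed
qed

lemma \<sigma>_6:
  assumes "length u + length v = 6" "u \<noteq> []" "v \<noteq> []"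
  shows "\<sigma> u v = z_form l (u @ v)"
proof -
  have "\<phi> (u @ v) = word_conv2 (\<lambda>u v. \<phi> u * \<phi> v) \<sigma> u v"
    using \<phi>_append by (simp add: fun_eq_iff)
  also have "\<dots> = word_conv2 word_unit2 \<sigma> u v"
    unfolding word_conv2_def
  proof (rule wsplit2_cong, goal_cases)
    case (1 a b c d)
    have "length a < 6" "length b < 6" using 1 assms by (cases u; cases v; auto)+
    then show ?case by (simp add: \<phi>_cases z_form_len word_unit2_def)
  qed
  finally show ?thesis using assms(1) by (simp add: \<phi>_6)
qed

lemma z_form_append:
  "z_form l (u @ v) = z_form l u * word_unit v + word_unit u * z_form l v + \<eta> u v"
proof (cases "length u + length v = 6")
  case True
  then show ?thesis
    using \<sigma>_6[of u v] by (cases "u = []"; cases "v = []")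
      (auto simp: \<eta>_def word_unit_def \<sigma>_Nil_left \<sigma>_Nil_right)
next
  case False
  then show ?thesis
    by (cases "u = []"; cases "v = []") (auto simp: \<eta>_def word_unit_def z_form_len)
qed

text \<open>The value that z would have on u @ v if it were primitive; \<eta> is the deviation by
  \<open>z_form_append\<close>.\<close>

definition P :: "idx list \<Rightarrow> idx list \<Rightarrow> 'k" where
  "P u v = z_form l u * word_unit v + word_unit u * z_form l v"

lemma word_conv2_add_left: "word_conv2 (\<lambda>u v. s u v + s' u v) t u v = word_conv2 s t u v + word_conv2 s' t u v"
  and word_conv2_add_right: "word_conv2 t (\<lambda>u v. s u v + s' u v) u v = word_conv2 t s u v + word_conv2 t s' u v"
  by (simp_all add: word_conv2_def distrib_left distrib_right wsplit2_add)

lemma supp3_z_form: "supp3 (z_form l)" and supp3_unit: "supp3 word_unit"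
proof -
  have "length w = 6" if "z_form l w \<noteq> 0" for w using that z_form_len by blast
  then show "supp3 (z_form l)" by (auto simp: supp3_def)
qed (auto simp: supp3_def word_unit_def)

lemma conv_A_left: "word_conv2 (\<lambda>u v. z_form l u * word_unit v) s u v = word_conv (z_form l) (\<lambda>a. s a v) u"
  unfolding word_conv2_tensor_left[OF supp3_unit] word_conv_def
  by (simp add: word_unit_def mult.assoc wsplit_mult_left wsplit_left_Nil del: mult_eq_0_iff)

lemma conv_C_left: "word_conv2 (\<lambda>u v. word_unit u * z_form l v) s u v = word_conv (z_form l) (s u) v"
proof -
  have "wsplit u (\<lambda>a c. wsplit v (\<lambda>b d. word_unit a * z_form l b * s c d)) =
      wsplit u (\<lambda>a c. (if a = [] then 1 else 0) * wsplit v (\<lambda>b d. z_form l b * s c d))"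
    unfolding word_unit_def wsplit_mult_left[symmetric] mult.assoc ..
  then show ?thesis
    by (simp add: word_conv2_tensor_left[OF supp3_z_form] wsplit_left_Nil word_conv_def)
qed

lemma conv_A_right: "word_conv2 s (\<lambda>u v. z_form l u * word_unit v) u v = word_conv (\<lambda>a. s a v) (z_form l) u"
proof -
  have "word_conv2 s (\<lambda>u v. z_form l u * word_unit v) u v =
      wsplit u (\<lambda>a c. wsplit v (\<lambda>b d. s a b * z_form l c * (if d = [] then 1 else 0)))"
    unfolding word_conv2_def wsplit2_def
  proof (intro wsplit_cong, goal_cases)
    case (1 a c b d)
    show ?case by (cases "length c = 6") (simp_all add: z_form_len word_unit_def q_power_dvd)
  qed
  then show ?thesis by (simp only: wsplit_right_Nil word_conv_def)
qed

lemma conv_C_right: "word_conv2 s (\<lambda>u v. word_unit u * z_form l v) u v = word_conv (s u) (z_form l) v"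
proof -
  have "word_conv2 s (\<lambda>u v. word_unit u * z_form l v) u v =
      wsplit u (\<lambda>a c. wsplit v (\<lambda>b d. s a b * z_form l d) * (if c = [] then 1 else 0))"
    unfolding word_conv2_def wsplit2_def wsplit_mult_right[symmetric]
    by (intro wsplit_cong) (simp add: word_unit_def)
  then show ?thesis by (simp only: wsplit_right_Nil word_conv_def)
qed

text \<open>Degrees one and two are covered by the commutation lemmas; from degree three on both
  products live in length at least nine, beyond the words considered.\<close>

lemma conv_short_commute:
  assumes f: "\<And>w. length w \<noteq> n \<Longrightarrow> f w = 0" "f [] = 0" and len: "length w \<le> 8"
  shows "word_conv (z_form l) f w = word_conv f (z_form l) w"
proof -
  consider "n = 0" | "n = 1" | "n = 2" | "n > 2" by linarith
  then show ?thesis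
  proof cases
    case 1
    then have "f = (\<lambda>w. 0)" using f by (metis length_0_conv)
    then show ?thesis by (simp add: word_conv_def)
  next
    case 4
    then have "word_conv (z_form l) f w = 0" "word_conv f (z_form l) w = 0"
      using conv_eq_0_length[of 6 "z_form l" n f w] conv_eq_0_length[of n f 6 "z_form l" w] f len z_form_len
      by auto
    then show ?thesis by simp
  qed (use z_form_commute_1[of f l] z_form_commute_2[of f l] f in auto)
qed

lemma P_\<eta>_commute:
  assumes "length u \<le> 8" "length v \<le> 8"
  shows "word_conv2 P \<eta> u v = word_conv2 \<eta> P u v"
proof -
  have "word_conv (z_form l) (\<lambda>a. \<eta> a v) u = word_conv (\<lambda>a. \<eta> a v) (z_form l) u"
    by (rule conv_short_commute[of "6 - length v"]) (use assms in \<open>auto simp: \<eta>_def \<sigma>_Nil_left word_unit_def\<close>)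
  moreover have "word_conv (z_form l) (\<eta> u) v = word_conv (\<eta> u) (z_form l) v"
    by (rule conv_short_commute[of "6 - length u"]) (use assms in \<open>auto simp: \<eta>_def \<sigma>_Nil_right word_unit_def\<close>)
  ultimately show ?thesis
    unfolding P_def word_conv2_add_left word_conv2_add_right conv_A_left conv_C_left conv_A_right conv_C_right
    by simp
qed

text \<open>The pullback of \<phi> is (P + \<eta>)^2 / 2 with P and \<eta> commuting and P^2 = 2 z
  \<otimes> z, whereas the coboundary formula expresses it as \<sigma> + P \<eta> + z \<otimes>
  z.\<close>

lemma \<sigma>_12:
  assumes len: "length u + length v = 12" "length u \<le> 8" "length v \<le> 8"
  shows "2 * \<sigma> u v = word_conv2 \<eta> \<eta> u v"
proof -
  have ne: "u \<noteq> []" "v \<noteq> []" using len by auto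
  have M: "(\<lambda>u v. z_form l (u @ v)) = (\<lambda>u v. P u v + \<eta> u v)"
    by (simp add: fun_eq_iff z_form_append P_def)
  have PP: "word_conv2 P P u v = 2 * (z_form l u * z_form l v)"
  proof -
    have "word_conv2 P P u v = word_conv (z_form l) (\<lambda>a. P a v) u + word_conv (z_form l) (P u) v"
      unfolding P_def[of _ _, abs_def] word_conv2_add_left conv_A_left conv_C_left ..
    moreover have "(\<lambda>a. P a v) = (\<lambda>a. word_unit a * z_form l v)" "P u = (\<lambda>b. z_form l u * word_unit b)"
      using ne by (auto simp: P_def word_unit_def fun_eq_iff)
    moreover have U: "wsplit w (\<lambda>a b. z_form l a * word_unit b) = z_form l w" for w
      using fun_cong[OF word_conv_unit(2)[of "z_form l"], of w] unfolding word_conv_def .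
    have "word_conv (z_form l) (\<lambda>a. word_unit a * z_form l v) u = z_form l u * z_form l v"
      by (simp add: word_conv_def wsplit_mult_right U flip: mult.assoc)
    moreover have "word_conv (z_form l) (\<lambda>b. z_form l u * word_unit b) v = z_form l u * z_form l v"
      unfolding word_conv_def by (subst mult.left_commute) (simp add: wsplit_mult_left U)
    ultimately show ?thesis by simp
  qed
  have "2 * \<phi> (u @ v) = word_conv2 (\<lambda>u v. z_form l (u @ v)) (\<lambda>u v. z_form l (u @ v)) u v"
    using \<phi>_12[of "u @ v"] len by (simp add: word_conv2_append)
  also have "\<dots> = 2 * (z_form l u * z_form l v) + word_conv2 P \<eta> u v + word_conv2 \<eta> P u v + word_conv2 \<eta> \<eta> u v"
    unfolding M by (simp add: word_conv2_add_left word_conv2_add_right PP)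
  finally have 1: "2 * \<phi> (u @ v) = 2 * (z_form l u * z_form l v) + 2 * word_conv2 P \<eta> u v + word_conv2 \<eta> \<eta> u v"
    using P_\<eta>_commute[OF len(2,3)] by simp
  have "\<phi> (u @ v) = word_conv2 (\<lambda>u v. \<phi> u * \<phi> v) \<sigma> u v"
    using \<phi>_append by (simp add: fun_eq_iff)
  also have "\<dots> = wsplit2 u v (\<lambda>a b c d. word_unit2 a b * \<sigma> c d + P a b * \<eta> c d +
      z_form l a * z_form l b * word_unit2 c d)"
    unfolding word_conv2_def
  proof (rule wsplit2_cong, goal_cases)
    case (1 a b c d)
    \<comment> \<open>The bound leaves only the lengths 0 and 6 for the arguments of \<phi>.\<close>
    have "length a \<le> 8" "length b \<le> 8" using 1 len by auto
    then have ab: "\<phi> a = word_unit a + z_form l a" "\<phi> b = word_unit b + z_form l b"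
      by (simp_all add: \<phi>_cases)
    have "c = [] \<and> d = []" if "length a = 6" "length b = 6"
    proof -
      have "length c + length d = 0" using that 1 len by linarith
      then show ?thesis by simp
    qed
    then show ?case
      using 1 len by (cases "length a = 6"; cases "length b = 6")
       (auto simp: ab z_form_len word_unit2_def word_unit_def P_def \<eta>_def \<sigma>_Nil_left)
  qed
  also have "\<dots> = word_conv2 word_unit2 \<sigma> u v + word_conv2 P \<eta> u v +
      word_conv2 (\<lambda>u v. z_form l u * z_form l v) word_unit2 u v"
    by (simp only: word_conv2_def wsplit2_add)
  finally have "\<phi> (u @ v) = \<sigma> u v + word_conv2 P \<eta> u v + z_form l u * z_form l v" by simp
  with 1 show ?thesis by (simp add: algebra_simps)
qed

lemma \<eta>_low: "\<eta> u v \<noteq> 0 \<Longrightarrow> length u + length v = 6"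
  by (auto simp: \<eta>_def split: if_splits)

text \<open>The total length is at most 16 and \<sigma> needs it divisible by six, so only 0, 6 and
  12 occur.\<close>

lemma \<sigma>_exp:
  assumes "length u \<le> 8" "length v \<le> 8"
  shows "\<sigma> u v = word_unit2 u v + \<eta> u v + word_conv2 \<eta> \<eta> u v / 2"
proof -
  have \<eta>2: "word_conv2 \<eta> \<eta> u v = 0" if "length u + length v \<noteq> 12"
    unfolding word_conv2_def
  proof (rule wsplit2_eq_0)
    fix a b c d :: "idx list"
    assume *: "length a + length c = length u" "length b + length d = length v"
    show "\<eta> a b * \<eta> c d = 0"
      using \<eta>_low[of a b] \<eta>_low[of c d] * that by (cases "\<eta> a b = 0"; cases "\<eta> c d = 0") auto
  qed
  show ?thesis
  proof (cases "length u + length v = 12")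
    case True
    then have "\<sigma> u v = word_conv2 \<eta> \<eta> u v / 2" using \<sigma>_12[OF True assms] by (simp add: field_simps)
    moreover have "word_unit2 u v = 0" using True by (auto simp: word_unit2_def word_unit_def)
    ultimately show ?thesis using True by (simp add: \<eta>_def)
  next
    case False
    show ?thesis
    proof (cases "u = [] \<or> v = []")
      case True
      then show ?thesis
        using \<eta>2[OF False] by (auto simp: \<sigma>_Nil_left \<sigma>_Nil_right \<eta>_def word_unit2_def word_unit_def)
    next
      case ne: False
      then have "length u > 0" "length v > 0" by auto
      have "\<sigma> u v = \<eta> u v"
      proof (rule ccontr)
        assume *: "\<sigma> u v \<noteq> \<eta> u v"
        then have nz: "\<sigma> u v \<noteq> 0" "length u + length v \<noteq> 6" by (auto simp: \<eta>_def split: if_splits)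
        then have "6 dvd length u + length v" using \<sigma>_6_dvd by blast
        then show False using nz assms False \<open>length u > 0\<close> by presburger
      qed
      then show ?thesis using \<eta>2[OF False] ne by (auto simp: word_unit2_def word_unit_def)
    qed
  qed
qed

end

section \<open>Linear maps out of presented algebras\<close>

lemma vector_space_mult: "vector_space ((*) :: 'k::field \<Rightarrow> 'k \<Rightarrow> 'k)"
  by standard (simp_all add: algebra_simps)

lemma linear_formI:
  assumes "vector_space s" "\<And>a b. f (a + b) = f a + f b" "\<And>c a. f (s c a) = c * f a"
  shows "linear_form s f"
  using assms vector_space_mult by (auto simp: Vector_Spaces.linear_iff)

lemma linear_form_add: "linear_form s f \<Longrightarrow> f (a + b) = f a + f b"
  and linear_form_scale: "linear_form s f \<Longrightarrow> f (s c a) = c * f a"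
  and linear_form_space: "linear_form s f \<Longrightarrow> vector_space s"
  by (simp_all add: Vector_Spaces.linear_iff)

lemma linear_form_zero: "linear_form s f \<Longrightarrow> f 0 = 0"
  using linear_form_add[of s f 0 0] by (metis add.right_neutral add_left_cancel)

lemma linear_form_sum_list: "linear_form s f \<Longrightarrow> f (sum_list (map g xs)) = (\<Sum>x\<leftarrow>xs. f (g x))"
  by (induction xs) (simp_all add: linear_form_zero linear_form_add)

lemma linear_form_comp:
  "Vector_Spaces.linear s t f \<Longrightarrow> linear_form t g \<Longrightarrow> linear_form s (\<lambda>a. g (f a))"
  by (auto simp: Vector_Spaces.linear_iff)

lemma linear_form_mult_left: "linear_form s f \<Longrightarrow> linear_form s (\<lambda>a. c * f a)"
  and linear_form_mult_right: "linear_form s f \<Longrightarrow> linear_form s (\<lambda>a. f a * c)"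
  by (auto simp: Vector_Spaces.linear_iff algebra_simps)

lemma linear_form_plus: "linear_form s f \<Longrightarrow> linear_form s g \<Longrightarrow> linear_form s (\<lambda>a. f a + g a)"
  by (auto simp: Vector_Spaces.linear_iff algebra_simps)

lemma linear_form_sums:
  assumes "vector_space s" "\<And>x. linear_form s (f x)"
  shows "linear_form s (\<lambda>a. \<Sum>x\<leftarrow>xs. f x a)"
proof (induction xs)
  case Nil
  show ?case using assms(1) by (auto intro: linear_formI)
next
  case (Cons x xs)
  then show ?case using linear_form_plus[OF assms(2)[of x]] by simp
qed

text \<open>A basis of the span of S stays independent after adding a, so values on it may be
  prescribed. This recovers equality of vectors from the forms in which tensors are encoded.\<close>

lemma linear_form_separates:
  assumes "vector_space s" "\<not> a \<in> module.span s S"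
  shows "\<exists>f. linear_form s f \<and> (\<forall>b\<in>S. f b = 0) \<and> f a = 1"
proof -
  interpret vector_space s by fact
  interpret vector_space_pair s "(*)"
    using assms(1) vector_space_mult by (simp add: vector_space_pair_def)
  obtain T where T: "T \<subseteq> S" "independent T" "S \<subseteq> span T"
    using maximal_independent_subset[of S] by blast
  have aT: "a \<notin> span T" using assms(2) T(1) span_mono by blast
  then have "independent (insert a T)" using T(2) by (rule independent_insertI)
  then obtain f where f: "linear_form s f" "\<forall>b\<in>insert a T. f b = (if b = a then 1 else 0)"
    using linear_independent_extend[of "insert a T" "\<lambda>b. if b = a then 1 else 0"] by blast
  have "a \<notin> T" using aT span_base by blast
  then have fT: "f b = 0" if "b \<in> T" for b using f(2) that by auto
  have "f b = 0" if "b \<in> span T" for b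
    using that
  proof (induction rule: span_induct_alt)
    case base
    then show ?case by (rule linear_form_zero[OF f(1)])
  next
    case (step c x y)
    then show ?case by (simp add: linear_form_add[OF f(1)] linear_form_scale[OF f(1)] fT)
  qed
  then show ?thesis using f T(3) by auto
qed

lemma linear_form_eqI:
  assumes "vector_space s" "\<And>f. linear_form s f \<Longrightarrow> f a = f b"
  shows "a = b"
proof (rule ccontr)
  interpret vector_space s by fact
  assume "a \<noteq> b"
  then have "a - b \<notin> span {}" by simp
  then obtain f where f: "linear_form s f" "f (a - b) = 1"
    using linear_form_separates[OF assms(1)] by blast
  have "f a = f (a - b + b)" by simp
  also have "\<dots> = 1 + f b" using f by (simp only: linear_form_add)
  finally show False using assms(2)[OF f(1)] by simp
qed

section \<open>Extension from words to the free algebra and its quotients\<close>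

definition word_prod :: "(idx \<Rightarrow> 'a::ring_1) \<Rightarrow> idx list \<Rightarrow> 'a" where
  "word_prod x w = prod_list (map x w)"

lemma word_prod_simps [simp]:
  "word_prod x [] = 1" "word_prod x (i # w) = x i * word_prod x w"
  "word_prod x (u @ v) = word_prod x u * word_prod x v"
  by (simp_all add: word_prod_def)

definition free_ext :: "('k::field \<Rightarrow> 'v::ab_group_add \<Rightarrow> 'v) \<Rightarrow> (idx list \<Rightarrow> 'v) \<Rightarrow> 'k free_algebra \<Rightarrow> 'v" where
  "free_ext t f p = (\<Sum>w\<in>Poly_Mapping.keys p. t (Poly_Mapping.lookup p w) (f (letters w)))"

lemma free_eval_eq: "free_eval s x = free_ext s (word_prod x)"
  by (simp add: fun_eq_iff free_eval_def free_ext_def word_prod_def)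

abbreviation wmono :: "idx list \<Rightarrow> 'k::field \<Rightarrow> 'k free_algebra" where
  "wmono w c \<equiv> Poly_Mapping.single (Word w) c"

lemma mono_mult: "wmono u a * wmono v b = wmono (u @ v) (a * b)"
  by (simp add: mult_single plus_idx_word_def)

lemma free_algebra_sum_mono:
  "p = (\<Sum>w\<in>Poly_Mapping.keys p. wmono (letters w) (Poly_Mapping.lookup p w))"
proof (rule poly_mapping_eqI)
  fix w
  have "Poly_Mapping.lookup (\<Sum>w\<in>Poly_Mapping.keys p. wmono (letters w) (Poly_Mapping.lookup p w)) w
      = (\<Sum>v\<in>Poly_Mapping.keys p. if v = w then Poly_Mapping.lookup p w else 0)"
    by (simp add: lookup_sum lookup_single when_def)
  also have "\<dots> = Poly_Mapping.lookup p w" by (simp add: in_keys_iff)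
  finally show "Poly_Mapping.lookup p w =
    Poly_Mapping.lookup (\<Sum>w\<in>Poly_Mapping.keys p. wmono (letters w) (Poly_Mapping.lookup p w)) w" by simp
qed

context
  fixes t :: "'k::field \<Rightarrow> 'v::ab_group_add \<Rightarrow> 'v" and f :: "idx list \<Rightarrow> 'v"
  assumes t: "vector_space t"
begin

interpretation vector_space t by (rule t)

lemma free_ext_superset:
  assumes "finite S" "Poly_Mapping.keys p \<subseteq> S"
  shows "free_ext t f p = (\<Sum>w\<in>S. t (Poly_Mapping.lookup p w) (f (letters w)))"
  unfolding free_ext_def using assms
  by (intro sum.mono_neutral_left) (auto simp: in_keys_iff)

lemma free_ext_add: "free_ext t f (p + r) = free_ext t f p + free_ext t f r"
proof -
  let ?S = "Poly_Mapping.keys p \<union> Poly_Mapping.keys r"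
  have "free_ext t f (p + r) = (\<Sum>w\<in>?S. t (Poly_Mapping.lookup (p + r) w) (f (letters w)))"
    by (rule free_ext_superset) (simp_all add: keys_add)
  also have "\<dots> = free_ext t f p + free_ext t f r"
    using free_ext_superset[of ?S p] free_ext_superset[of ?S r]
    by (simp add: lookup_add scale_left_distrib sum.distrib)
  finally show ?thesis .
qed

lemma free_ext_mono: "free_ext t f (wmono w c) = t c (f w)"
  by (simp add: free_ext_def)

lemma free_ext_zero: "free_ext t f 0 = 0"
  by (simp add: free_ext_def)

lemma free_ext_uminus: "free_ext t f (- p) = - free_ext t f p"
  using free_ext_add[of p "- p"] by (simp add: free_ext_zero eq_neg_iff_add_eq_0 add.commute)

lemma free_ext_diff: "free_ext t f (p - r) = free_ext t f p - free_ext t f r"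
  using free_ext_add[of p "- r"] by (simp add: free_ext_uminus)

lemma free_ext_sum: "free_ext t f (\<Sum>a\<in>A. p a) = (\<Sum>a\<in>A. free_ext t f (p a))"
  by (induction A rule: infinite_finite_induct) (simp_all add: free_ext_zero free_ext_add)

lemma free_ext_mono_mult: "free_ext t f (wmono [] c * p) = t c (free_ext t f p)"
proof -
  have "wmono [] c * p = (\<Sum>w\<in>Poly_Mapping.keys p. wmono (letters w) (c * Poly_Mapping.lookup p w))"
    by (subst (1) free_algebra_sum_mono[of p]) (simp add: sum_distrib_left mono_mult del: idx_word.collapse)
  then show ?thesis
    by (simp add: free_ext_sum free_ext_mono del: idx_word.collapse) (simp add: free_ext_def scale_sum_right)
qed

text \<open>The elements all of whose two-sided multiples by words are killed form an ideal, which
  therefore contains the generated one.\<close>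

lemma kernel_ideal:
  assumes R: "\<And>r u v. r \<in> R \<Longrightarrow> free_ext t f (wmono u 1 * r * wmono v 1) = 0"
    and p: "p \<in> ideal_generated R"
  shows "free_ext t f p = 0"
proof -
  define K where "K = {p. \<forall>u v. free_ext t f (wmono u 1 * p * wmono v 1) = 0}"
  have expand: "free_ext t f (wmono u 1 * (r * p) * wmono v 1) =
      (\<Sum>w\<in>Poly_Mapping.keys r. t (Poly_Mapping.lookup r w) (free_ext t f (wmono (u @ letters w) 1 * p * wmono v 1)))"
    for u v r p
  proof -
    have "wmono u 1 * (r * p) * wmono v 1 =
      (\<Sum>w\<in>Poly_Mapping.keys r. wmono u 1 * (wmono (letters w) (Poly_Mapping.lookup r w) * p) * wmono v 1)"
      by (subst (1) free_algebra_sum_mono[of r]) (simp add: sum_distrib_left sum_distrib_right del: idx_word.collapse)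
    also have "\<dots> = (\<Sum>w\<in>Poly_Mapping.keys r.
        wmono [] (Poly_Mapping.lookup r w) * (wmono (u @ letters w) 1 * p * wmono v 1))"
      by (simp add: mult.assoc[symmetric] mono_mult del: idx_word.collapse)
    finally show ?thesis by (simp add: free_ext_sum free_ext_mono_mult del: idx_word.collapse)
  qed
  have expand': "free_ext t f (wmono u 1 * (p * r) * wmono v 1) =
      (\<Sum>w\<in>Poly_Mapping.keys r. t (Poly_Mapping.lookup r w) (free_ext t f (wmono u 1 * p * wmono (letters w @ v) 1)))"
    for u v r p
  proof -
    \<comment> \<open>Constants are central because the field is commutative; this moves the
      coefficient of a right factor to the front.\<close>
    have mc: "m * wmono w c = wmono [] c * m * wmono w 1" for m :: "'k free_algebra" and w c
    proof -
      have "m * wmono w c = (\<Sum>v\<in>Poly_Mapping.keys m. wmono (letters v) (Poly_Mapping.lookup m v) * wmono w c)"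
        by (subst (1) free_algebra_sum_mono[of m]) (simp add: sum_distrib_right del: idx_word.collapse)
      also have "\<dots> = (\<Sum>v\<in>Poly_Mapping.keys m. wmono [] c * wmono (letters v) (Poly_Mapping.lookup m v) * wmono w 1)"
        by (simp add: mono_mult mult.commute del: idx_word.collapse)
      also have "\<dots> = wmono [] c * m * wmono w 1"
        by (subst (3) free_algebra_sum_mono[of m]) (simp add: sum_distrib_left sum_distrib_right del: idx_word.collapse)
      finally show ?thesis .
    qed
    have "wmono u 1 * (p * r) * wmono v 1 =
      (\<Sum>w\<in>Poly_Mapping.keys r. (wmono u 1 * p) * wmono (letters w @ v) (Poly_Mapping.lookup r w))"
      by (subst (1) free_algebra_sum_mono[of r]) (simp add: sum_distrib_left sum_distrib_right mult.assoc mono_mult del: idx_word.collapse)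
    also have "\<dots> = (\<Sum>w\<in>Poly_Mapping.keys r.
        wmono [] (Poly_Mapping.lookup r w) * (wmono u 1 * p * wmono (letters w @ v) 1))"
      by (subst mc) (simp add: mult.assoc)
    finally show ?thesis by (simp add: free_ext_sum free_ext_mono_mult del: idx_word.collapse)
  qed
  have "ideal_generated R \<subseteq> K"
    unfolding ideal_generated_def
  proof (rule Inter_lower, simp, intro conjI)
    show "R \<subseteq> K" using R by (auto simp: K_def)
    show "0 \<in> K" by (simp add: K_def free_ext_zero)
    show "\<forall>a\<in>K. \<forall>b\<in>K. a + b \<in> K"
      by (simp add: K_def distrib_left distrib_right free_ext_add)
    show "\<forall>r. \<forall>a\<in>K. r * a \<in> K \<and> a * r \<in> K"
    proof (intro allI ballI conjI)
      fix r a
      assume "a \<in> K"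
      then show "r * a \<in> K" "a * r \<in> K"
        by (simp_all add: K_def expand[of _ r a] expand'[of _ a r])
    qed
  qed
  then have "free_ext t f (wmono [] 1 * p * wmono [] 1) = 0" using p by (auto simp: K_def)
  then show ?thesis by (simp flip: zero_idx_word_def)
qed

end

lemma presented_lift:
  fixes s :: "'k::field \<Rightarrow> 'a::ring_1 \<Rightarrow> 'a" and t :: "'k \<Rightarrow> 'v::ab_group_add \<Rightarrow> 'v"
  assumes pres: "presented_by s x R" and t: "vector_space t"
    and R: "\<And>r u v. r \<in> R \<Longrightarrow> free_ext t f (wmono u 1 * r * wmono v 1) = 0"
  shows "\<exists>F. Vector_Spaces.linear s t F \<and> (\<forall>w. F (word_prod x w) = f w)"
proof -
  have s: "vector_space s" using pres by (simp add: presented_by_def algebra_over_def)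
  interpret s: vector_space s by (rule s)
  interpret t: vector_space t by (rule t)
  define rep where "rep a = (SOME p. free_eval s x p = a)" for a
  have rep: "free_eval s x (rep a) = a" for a
  proof -
    have "\<exists>p. free_eval s x p = a" using pres by (metis presented_by_def surjD)
    then show ?thesis unfolding rep_def by (rule someI_ex)
  qed
  define F where "F a = free_ext t f (rep a)" for a
  have wd: "F a = free_ext t f p" if "free_eval s x p = a" for a p
  proof -
    have "free_eval s x (rep a - p) = 0"
      using rep[of a] that by (simp add: free_eval_eq free_ext_diff[OF s])
    then have "rep a - p \<in> ideal_generated R" using pres by (auto simp: presented_by_def)
    then have "free_ext t f (rep a - p) = 0" using kernel_ideal[OF t] R by blast
    then show ?thesis by (simp add: F_def free_ext_diff[OF t])
  qed
  have "F (a + b) = F a + F b" for a b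
    using wd[of "rep a + rep b" "a + b"] rep
    by (simp add: free_eval_eq free_ext_add[OF s] free_ext_add[OF t] F_def)
  moreover have "F (s c a) = t c (F a)" for c a
    using wd[of "wmono [] c * rep a" "s c a"] rep
    by (simp add: free_eval_eq free_ext_mono_mult[OF s] free_ext_mono_mult[OF t] F_def)
  moreover have "F (word_prod x w) = f w" for w
    using wd[of "wmono w 1" "word_prod x w"]
    by (simp add: free_eval_eq free_ext_mono[OF s] free_ext_mono[OF t])
  ultimately show ?thesis
    using s t by (intro exI[of _ F]) (simp add: Vector_Spaces.linear_iff)
qed

lemma presented_kernel:
  assumes pres: "presented_by s x R" and "r \<in> R"
  shows "free_ext s (word_prod x) (wmono u 1 * r * wmono v 1) = 0"
proof -
  have "wmono u 1 * r * wmono v 1 \<in> ideal_generated R"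
    using assms(2) by (auto simp: ideal_generated_def)
  then show ?thesis using pres by (auto simp: presented_by_def free_eval_eq)
qed

lemma free_ext_A2_relations:
  fixes t :: "'k::field_char_0 \<Rightarrow> 'v::ab_group_add \<Rightarrow> 'v"
  assumes t: "vector_space t" and q: "q ^ 3 = 1" "q \<noteq> 1"
  shows "(\<forall>r\<in>A2_relations q l1 l2 l12 l112 l122. \<forall>u v. free_ext t f (wmono u 1 * r * wmono v 1) = 0) \<longleftrightarrow>
    word_relations t q l1 l2 l12 l112 l122 f"
proof -
  interpret word_split q by standard (fact q)+
  interpret vector_space t by (rule t)
  note ext = free_ext_add[OF t] free_ext_diff[OF t] free_ext_uminus[OF t] free_ext_mono[OF t]
  have one: "(1 :: 'k free_algebra) = wmono [] 1" by (simp flip: zero_idx_word_def)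
  have scl: "free_scl c p = wmono [] c * p" for c p by (simp add: free_scl_def zero_idx_word_def)
  have g12: "gen12 free_scl q free_gen = wmono [One, Two] 1 - wmono [Two, One] q"
    by (simp add: gen12_def free_gen_def scl mono_mult)
  have g111: "(free_gen i :: 'k free_algebra) ^ 3 = wmono [i, i, i] 1" for i
    by (simp add: free_gen_def power3_eq_cube mono_mult)
  have qq: "q + q\<^sup>2 = - 1" using q_sum by (simp add: eq_neg_iff_add_eq_0 add_ac)
  have g112: "gen112 free_scl q free_gen = wmono [One, One, Two] 1 + wmono [One, Two, One] 1 + wmono [Two, One, One] 1"
  proof -
    have "gen112 free_scl q free_gen = wmono [One, One, Two] 1 - (wmono [One, Two, One] q + wmono [One, Two, One] (q\<^sup>2))
        + wmono [Two, One, One] (q ^ 3)"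
      by (simp add: gen112_def g12 free_gen_def scl mono_mult algebra_simps power2_eq_square power3_eq_cube)
    also have "wmono [One, Two, One] q + wmono [One, Two, One] (q\<^sup>2) = wmono [One, Two, One] (- 1)"
      by (simp only: single_add[symmetric] qq)
    finally show ?thesis by (simp add: q(1) single_uminus)
  qed
  have g122: "gen122 free_scl q free_gen = wmono [One, Two, Two] 1 + wmono [Two, One, Two] 1 + wmono [Two, Two, One] 1"
  proof -
    have "gen122 free_scl q free_gen = wmono [One, Two, Two] 1 - (wmono [Two, One, Two] q + wmono [Two, One, Two] (q\<^sup>2))
        + wmono [Two, Two, One] (q ^ 3)"
      by (simp add: gen122_def g12 free_gen_def scl mono_mult algebra_simps power2_eq_square power3_eq_cube)
    also have "wmono [Two, One, Two] q + wmono [Two, One, Two] (q\<^sup>2) = wmono [Two, One, Two] (- 1)"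
      by (simp only: single_add[symmetric] qq)
    finally show ?thesis by (simp add: q(1) single_uminus)
  qed
  have 1: "free_ext t f (wmono u 1 * (free_gen i ^ 3 - free_scl l 1) * wmono v 1) =
      f (u @ [i, i, i] @ v) - t l (f (u @ v))" for i l u v
    by (simp add: g111 scl one mono_mult algebra_simps ext)
  have 112: "free_ext t f (wmono u 1 * (gen112 free_scl q free_gen - free_scl l 1) * wmono v 1) =
      f (u @ [One, One, Two] @ v) + f (u @ [One, Two, One] @ v) + f (u @ [Two, One, One] @ v) - t l (f (u @ v))" for l u v
    by (simp add: g112 scl one mono_mult distrib_left distrib_right left_diff_distrib right_diff_distrib ext)
  have 122: "free_ext t f (wmono u 1 * (gen122 free_scl q free_gen - free_scl l 1) * wmono v 1) =
      f (u @ [One, Two, Two] @ v) + f (u @ [Two, One, Two] @ v) + f (u @ [Two, Two, One] @ v) - t l (f (u @ v))" for l u v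
    by (simp add: g122 scl one mono_mult distrib_left distrib_right left_diff_distrib right_diff_distrib ext)
  have 12: "free_ext t f (wmono u 1 * (gen12 free_scl q free_gen ^ 3 - free_scl l 1) * wmono v 1) =
     f (u @ [One, Two, One, Two, One, Two] @ v)
       - t q (f (u @ [One, Two, One, Two, Two, One] @ v) + f (u @ [One, Two, Two, One, One, Two] @ v)
            + f (u @ [Two, One, One, Two, One, Two] @ v))
       + t (q\<^sup>2) (f (u @ [One, Two, Two, One, Two, One] @ v) + f (u @ [Two, One, One, Two, Two, One] @ v)
            + f (u @ [Two, One, Two, One, One, Two] @ v))
       - f (u @ [Two, One, Two, One, Two, One] @ v) - t l (f (u @ v))" for l u v
    using q(1) by (simp add: g12 power3_eq_cube power2_eq_square scl one mono_mult distrib_left distrib_right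
        left_diff_distrib right_diff_distrib ext scale_right_distrib mult.assoc)
  show ?thesis
    unfolding A2_relations_def word_relations_def
    by (auto simp: 1 12 112 122)
qed

section \<open>Convolution on words\<close>

lemma sum_list_concat_map: "sum_list (map f (concat (map g xs))) = (\<Sum>x\<leftarrow>xs. \<Sum>y\<leftarrow>g x. f y)"
  by (induction xs) auto

lemma bilinear_formI:
  "(\<And>b. linear_form s (\<lambda>a. f a b)) \<Longrightarrow> (\<And>a. linear_form t (\<lambda>b. f a b)) \<Longrightarrow> bilinear_form s t f"
  by (simp add: bilinear_form_def)

lemma bilinear_formD:
  "bilinear_form s t f \<Longrightarrow> linear_form s (\<lambda>a. f a b)" "bilinear_form s t f \<Longrightarrow> linear_form t (f a)"
  by (simp_all add: bilinear_form_def)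

lemma bilinear_form_tensor:
  "linear_form s f \<Longrightarrow> linear_form t g \<Longrightarrow> bilinear_form s t (\<lambda>a b. f a * g b)"
  by (intro bilinear_formI linear_form_mult_left linear_form_mult_right)

lemma tensor_eqD:
  "tensor_eq s t ps qs \<Longrightarrow> bilinear_form s t f \<Longrightarrow> (\<Sum>(a, b)\<leftarrow>ps. f a b) = (\<Sum>(a, b)\<leftarrow>qs. f a b)"
  by (simp add: tensor_eq_def)

lemma coalgebra_space: "coalgebra C \<Longrightarrow> vector_space (scl C)"
  by (simp add: coalgebra_def)

lemma cop_linear:
  assumes C: "coalgebra C" and f: "bilinear_form (scl C) (scl C) f"
  shows "linear_form (scl C) (\<lambda>a. \<Sum>(u, v)\<leftarrow>cop C a. f u v)"
proof (rule linear_formI[OF coalgebra_space[OF C]])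
  fix a b
  show "(\<Sum>(u, v)\<leftarrow>cop C (a + b). f u v) = (\<Sum>(u, v)\<leftarrow>cop C a. f u v) + (\<Sum>(u, v)\<leftarrow>cop C b. f u v)"
    using tensor_eqD[OF _ f, of "cop C (a + b)" "cop C a @ cop C b"] C by (simp add: coalgebra_def)
next
  fix c a
  have "(\<Sum>(u, v)\<leftarrow>cop C (scl C c a). f u v) = (\<Sum>(u, v)\<leftarrow>cop C a. f (scl C c u) v)"
    using tensor_eqD[OF _ f, of "cop C (scl C c a)" "[(scl C c u, v). (u, v) \<leftarrow> cop C a]"] C
    by (simp add: coalgebra_def sum_list_concat_map case_prod_unfold o_def)
  also have "\<dots> = c * (\<Sum>(u, v)\<leftarrow>cop C a. f u v)"
    by (simp add: linear_form_scale[OF bilinear_formD(1)[OF f]] case_prod_unfold sum_list_const_mult)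
  finally show "(\<Sum>(u, v)\<leftarrow>cop C (scl C c a). f u v) = c * (\<Sum>(u, v)\<leftarrow>cop C a. f u v)" .
qed

lemma conv_linear:
  "coalgebra C \<Longrightarrow> linear_form (scl C) f \<Longrightarrow> linear_form (scl C) g \<Longrightarrow> linear_form (scl C) (conv C f g)"
  unfolding conv_def by (intro cop_linear bilinear_form_tensor)

lemma conv_assoc:
  assumes C: "coalgebra C" and "linear_form (scl C) f" "linear_form (scl C) g" "linear_form (scl C) h"
  shows "conv C (conv C f g) h = conv C f (conv C g h)"
proof
  fix a
  have tri: "trilinear_form (scl C) (scl C) (scl C) (\<lambda>u v w. f u * g v * h w)"
    unfolding trilinear_form_def using assms
    by (auto intro: linear_form_mult_left linear_form_mult_right)
  have "(\<Sum>(u, v, w)\<leftarrow>[(u, v, w). (b, w) \<leftarrow> cop C a, (u, v) \<leftarrow> cop C b]. f u * g v * h w) =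
      (\<Sum>(u, v, w)\<leftarrow>cop3 C a. f u * g v * h w)"
    using C tri unfolding coalgebra_def tensor3_eq_def by blast
  moreover have "conv C (conv C f g) h a = (\<Sum>(b, w)\<leftarrow>cop C a. \<Sum>(u, v)\<leftarrow>cop C b. f u * g v * h w)"
    by (simp add: conv_def case_prod_unfold sum_list_mult_const)
  moreover have "conv C f (conv C g h) a = (\<Sum>(u, b)\<leftarrow>cop C a. \<Sum>(v, w)\<leftarrow>cop C b. f u * g v * h w)"
    by (simp add: conv_def case_prod_unfold sum_list_const_mult mult.assoc)
  ultimately show "conv C (conv C f g) h a = conv C f (conv C g h) a"
    by (simp add: cop3_def sum_list_concat_map case_prod_unfold o_def)
qed

lemma cop_counit:
  assumes C: "coalgebra C" and f: "linear_form (scl C) f"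
  shows "conv C (cou C) f = f" "conv C f (cou C) = f"
proof -
  have *: "f a = (\<Sum>(u, v)\<leftarrow>cop C a. cou C u * f v)" "f a = (\<Sum>(u, v)\<leftarrow>cop C a. f u * cou C v)" for a
  proof -
    have "f a = f (\<Sum>(u, v)\<leftarrow>cop C a. scl C (cou C u) v)" using C by (simp add: coalgebra_def)
    then show "f a = (\<Sum>(u, v)\<leftarrow>cop C a. cou C u * f v)"
      by (simp add: case_prod_unfold linear_form_sum_list[OF f] linear_form_scale[OF f])
    have "f a = f (\<Sum>(u, v)\<leftarrow>cop C a. scl C (cou C v) u)" using C by (simp add: coalgebra_def)
    then show "f a = (\<Sum>(u, v)\<leftarrow>cop C a. f u * cou C v)"
      by (simp add: case_prod_unfold linear_form_sum_list[OF f] linear_form_scale[OF f] mult.commute)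
  qed
  show "conv C (cou C) f = f" "conv C f (cou C) = f"
    unfolding conv_def by (intro ext *[symmetric])+
qed

text \<open>Evaluates the definite description in \<open>gauge\<close>.\<close>

lemma conv_inverse_unique:
  assumes C: "coalgebra C" and "linear_form (scl C) \<alpha>" "conv_inverse C \<alpha> \<beta>"
  shows "(THE \<beta>. conv_inverse C \<alpha> \<beta>) = \<beta>"
proof (rule the_equality)
  show "conv_inverse C \<alpha> \<beta>" by fact
  fix \<beta>'
  assume "conv_inverse C \<alpha> \<beta>'"
  then have b: "linear_form (scl C) \<beta>" "linear_form (scl C) \<beta>'" "conv C \<beta>' \<alpha> = cou C" "conv C \<alpha> \<beta> = cou C"
    using assms(3) by (simp_all add: conv_inverse_def)
  have "\<beta>' = conv C \<beta>' (conv C \<alpha> \<beta>)" using b C by (simp add: cop_counit)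
  also have "\<dots> = conv C (conv C \<beta>' \<alpha>) \<beta>" using conv_assoc[OF C b(2) assms(2) b(1)] by simp
  also have "\<dots> = \<beta>" using b C by (simp add: cop_counit)
  finally show "\<beta>' = \<beta>" .
qed

section \<open>Structure maps of the Nichols algebra on words\<close>

locale nichols = word_split q for q :: "'k::field_char_0" +
  fixes H :: "('k, 'h::ring_1) hopf" and g :: "idx \<Rightarrow> 'h" and chi :: "idx \<Rightarrow> 'h \<Rightarrow> 'k"
    and B :: "('k, 'b::ring_1, 'h) yd_hopf" and x :: "idx \<Rightarrow> 'b"
  assumes hopf: "hopf_algebra H"
    and realization: "principal_yd_realization H g chi (\<lambda>i j. q)"
    and nichols: "nichols_algebra_A2 q H g chi B x"
begin

abbreviation X :: "idx list \<Rightarrow> 'b" where "X \<equiv> word_prod x"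

lemma braided: "braided_hopf_algebra H B" and presB: "presented_by (scl B) x (A2_relations q 0 0 0 0 0)"
  and pbwB: "pbw_basis (scl B) q x" and act_x: "act B h (x i) = scl B (chi i h) (x i)"
  and coact_x: "tensor_eq (scl H) (scl B) (coact B (x i)) [(g i, x i)]"
  and cop_x: "tensor_eq (scl B) (scl B) (cop B (x i)) [(x i, 1), (1, x i)]"
  using nichols by (simp_all add: nichols_algebra_A2_def)

lemma ydm: "yd_module H B" and yda: "yd_algebra H B" and ydc: "yd_coalgebra H B"
  and cou_char: "character (scl B) (cou B)" and cop_1: "tensor_eq (scl B) (scl B) (cop B 1) [(1, 1)]"
  and cop_mult: "tensor_eq (scl B) (scl B) (cop B (a * b))
        [(u * v, u' * v'). ((u, v), (u', v')) \<leftarrow> braided_cop B a b]"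
  using braided by (simp_all add: braided_hopf_algebra_def)

lemma coH: "coalgebra H" and couH: "character (scl H) (cou H)"
  using hopf by (simp_all add: hopf_algebra_def)

lemma coB: "coalgebra B"
  using ydc by (simp add: yd_coalgebra_def)

lemma algB: "algebra_over (scl B)"
  using yda by (simp add: yd_algebra_def)

lemma vsB: "vector_space (scl B)" and vsH: "vector_space (scl H)"
  by (simp_all add: coalgebra_space coB coH)

sublocale vB: vector_space "scl B" by (rule vsB)

lemma scl_mult_left [simp]: "scl B c a * b = scl B c (a * b)" and scl_mult_right [simp]: "a * scl B c b = scl B c (a * b)"
  using algB by (simp_all add: algebra_over_def)

lemma cou_linear: "linear_form (scl B) (cou B)" and cou_1: "cou B 1 = 1" and cou_mult: "cou B (a * b) = cou B a * cou B b"
  using cou_char by (simp_all add: character_def)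

lemma glike: "g i \<noteq> 0" "tensor_eq (scl H) (scl H) (cop H (g i)) [(g i, g i)]"
  and chi_char: "character (scl H) (chi i)" and chi_g: "chi j (g i) = q"
  using realization by (simp_all add: principal_yd_realization_def group_like_def)

lemma chi_linear: "linear_form (scl H) (chi i)" and couH_linear: "linear_form (scl H) (cou H)"
  using chi_char couH by (simp_all add: character_def)

text \<open>The counit axiom at g \<otimes> g shows that g is \<epsilon>(g) times itself, and a
  group-like element is nonzero.\<close>

lemma cou_g: "cou H (g i) = 1"
proof -
  interpret vector_space "scl H" by (rule vsH)
  have "f (g i) = cou H (g i) * f (g i)" if f: "linear_form (scl H) f" for f
    using fun_cong[OF cop_counit(1)[OF coH f], of "g i"]
      tensor_eqD[OF glike(2)[of i] bilinear_form_tensor[OF couH_linear f]] by (simp add: conv_def)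
  then have "g i = scl H (cou H (g i)) (g i)"
    by (intro linear_form_eqI[OF vsH]) (metis linear_form_scale)
  then have "scl H (1 - cou H (g i)) (g i) = 0" by (simp add: scale_left_diff_distrib)
  then show ?thesis using glike(1)[of i] by simp
qed

primrec chiw :: "idx list \<Rightarrow> 'h \<Rightarrow> 'k" where
  "chiw [] = cou H"
| "chiw (i # w) = conv H (chi i) (chiw w)"

lemma chiw_linear: "linear_form (scl H) (chiw w)"
  by (induction w) (simp_all add: couH_linear conv_linear coH chi_linear)

lemma chiw_g: "chiw w (g i) = q ^ length w"
proof (induction w)
  case (Cons j w)
  then show ?case
    using tensor_eqD[OF glike(2)[of i] bilinear_form_tensor[OF chi_linear chiw_linear]]
    by (simp add: conv_def chi_g)
qed (simp add: cou_g)

lemma scl_sum_list: "scl B (\<Sum>y\<leftarrow>ys. f y) a = (\<Sum>y\<leftarrow>ys. scl B (f y) a)"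
  by (induction ys) (simp_all add: vB.scale_left_distrib)

lemma act_word: "act B h (X w) = scl B (chiw w h) (X w)"
proof (induction w arbitrary: h)
  case Nil
  then show ?case using yda by (simp add: yd_algebra_def)
next
  case (Cons i w)
  have "act B h (X (i # w)) = (\<Sum>(h1, h2)\<leftarrow>cop H h. act B h1 (x i) * act B h2 (X w))"
    using yda by (simp add: yd_algebra_def)
  also have "\<dots> = scl B (chiw (i # w) h) (X (i # w))"
    by (simp add: Cons.IH act_x conv_def scl_sum_list case_prod_unfold mult.commute)
  finally show ?case .
qed

primrec gw :: "idx list \<Rightarrow> 'h" where
  "gw [] = 1"
| "gw (i # w) = g i * gw w"

lemma act_gw: "act B (gw u) (X v) = scl B (q ^ (length u * length v)) (X v)"
proof (induction u)
  case Nil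
  then show ?case using ydm by (simp add: yd_module_def)
next
  case (Cons i u)
  have lin: "Vector_Spaces.linear (scl B) (scl B) (act B h)" for h
    using ydm by (simp add: yd_module_def)
  have "act B (gw (i # u)) (X v) = act B (g i) (act B (gw u) (X v))"
    using ydm by (simp add: yd_module_def)
  also have "\<dots> = scl B (q ^ (length u * length v)) (act B (g i) (X v))"
    using lin[of "g i"] by (simp add: Cons.IH Vector_Spaces.linear_iff)
  finally show ?case by (simp add: act_word chiw_g power_add mult.commute)
qed

lemma act_linear: "Vector_Spaces.linear (scl B) (scl B) (act B h)"
  and act_linear2: "Vector_Spaces.linear (scl H) (scl B) (\<lambda>h. act B h a)"
  using ydm by (simp_all add: yd_module_def)

lemma coact_linear:
  assumes f: "bilinear_form (scl H) (scl B) f"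
  shows "linear_form (scl B) (\<lambda>a. \<Sum>(h, u)\<leftarrow>coact B a. f h u)"
proof (rule linear_formI[OF vsB])
  fix a b
  show "(\<Sum>(h, u)\<leftarrow>coact B (a + b). f h u) = (\<Sum>(h, u)\<leftarrow>coact B a. f h u) + (\<Sum>(h, u)\<leftarrow>coact B b. f h u)"
    using tensor_eqD[OF _ f, of "coact B (a + b)" "coact B a @ coact B b"] ydm by (simp add: yd_module_def)
next
  fix c a
  have "(\<Sum>(h, u)\<leftarrow>coact B (scl B c a). f h u) = (\<Sum>(h, u)\<leftarrow>coact B a. f h (scl B c u))"
    using tensor_eqD[OF _ f, of "coact B (scl B c a)" "[(h, scl B c u). (h, u) \<leftarrow> coact B a]"] ydm
    by (simp add: yd_module_def sum_list_concat_map case_prod_unfold o_def)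
  also have "\<dots> = c * (\<Sum>(h, u)\<leftarrow>coact B a. f h u)"
    by (simp add: linear_form_scale[OF bilinear_formD(2)[OF f]] case_prod_unfold sum_list_const_mult)
  finally show "(\<Sum>(h, u)\<leftarrow>coact B (scl B c a). f h u) = c * (\<Sum>(h, u)\<leftarrow>coact B a. f h u)" .
qed

lemma coact_word:
  "bilinear_form (scl H) (scl B) f \<Longrightarrow> (\<Sum>(h, u)\<leftarrow>coact B (X w). f h u) = f (gw w) (X w)"
proof (induction w arbitrary: f)
  case Nil
  have "tensor_eq (scl H) (scl B) (coact B 1) [(1, 1)]" using yda by (simp add: yd_algebra_def)
  from tensor_eqD[OF this Nil] show ?case by simp
next
  case (Cons i w)
  have "tensor_eq (scl H) (scl B) (coact B (x i * X w))
      [(h * k, u * v). (h, u) \<leftarrow> coact B (x i), (k, v) \<leftarrow> coact B (X w)]"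
    using yda by (simp add: yd_algebra_def)
  from tensor_eqD[OF this Cons.prems]
  have "(\<Sum>(h, u)\<leftarrow>coact B (X (i # w)). f h u) =
      (\<Sum>(h, u)\<leftarrow>coact B (x i). \<Sum>(k, v)\<leftarrow>coact B (X w). f (h * k) (u * v))"
    by (simp add: sum_list_concat_map case_prod_unfold o_def)
  also have "\<dots> = (\<Sum>(h, u)\<leftarrow>coact B (x i). f (h * gw w) (u * X w))"
  proof -
    have "bilinear_form (scl H) (scl B) (\<lambda>k v. f (h * k) (u * v))" for h u
    proof -
      have H: "h * scl H c k = scl H c (h * k)" for c k
        using hopf by (simp add: hopf_algebra_def algebra_over_def)
      show ?thesis
        using bilinear_formD[OF Cons.prems]
        by (intro bilinear_formI linear_formI) (auto simp: vsH vsB H distrib_left Vector_Spaces.linear_iff)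
    qed
    from Cons.IH[OF this] show ?thesis by (simp add: case_prod_unfold)
  qed
  also have "\<dots> = f (g i * gw w) (x i * X w)"
  proof -
    have "bilinear_form (scl H) (scl B) (\<lambda>h u. f (h * gw w) (u * X w))"
    proof -
      have H: "scl H c h * k = scl H c (h * k)" for c h k
        using hopf by (simp add: hopf_algebra_def algebra_over_def)
      show ?thesis
        using bilinear_formD[OF Cons.prems]
        by (intro bilinear_formI linear_formI) (auto simp: vsH vsB H distrib_right Vector_Spaces.linear_iff)
    qed
    from tensor_eqD[OF coact_x this] show ?thesis by simp
  qed
  finally show ?case by simp
qed

lemma braided_sum:
  "(\<Sum>((u, v), (u', v'))\<leftarrow>braided_cop B a b. F u v u' v') =
   (\<Sum>(a1, a2)\<leftarrow>cop B a. \<Sum>(b1, b2)\<leftarrow>cop B b. \<Sum>(h, c)\<leftarrow>coact B a2. F a1 (act B h b1) c b2)"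
  by (simp add: braided_cop_def sum_list_concat_map case_prod_unfold o_def)

text \<open>The list \<open>braided_cop\<close> represents a tensor only up to equality of tensors;
  sums over it are meaningful for forms that are linear in all four legs.\<close>

definition four_linear :: "('b \<Rightarrow> 'b \<Rightarrow> 'b \<Rightarrow> 'b \<Rightarrow> 'k) \<Rightarrow> bool" where
  "four_linear F \<longleftrightarrow> (\<forall>b c d. linear_form (scl B) (\<lambda>a. F a b c d)) \<and> (\<forall>a c d. linear_form (scl B) (\<lambda>b. F a b c d)) \<and>
     (\<forall>a b d. linear_form (scl B) (\<lambda>c. F a b c d)) \<and> (\<forall>a b c. linear_form (scl B) (\<lambda>d. F a b c d))"

lemma four_linearD:
  assumes "four_linear F"
  shows "linear_form (scl B) (\<lambda>a. F a b c d)" "linear_form (scl B) (\<lambda>b. F a b c d)"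
    "linear_form (scl B) (\<lambda>c. F a b c d)" "linear_form (scl B) (\<lambda>d. F a b c d)"
  using assms by (simp_all add: four_linear_def)

lemma coact_bilinear:
  assumes F: "four_linear F"
  shows "bilinear_form (scl H) (scl B) (\<lambda>h c. F a1 (act B h b1) c b2)"
  using four_linearD[OF F] by (intro bilinear_formI) (auto intro: linear_form_comp[OF act_linear2])

lemma braided_inner:
  assumes F: "four_linear F"
  shows "bilinear_form (scl B) (scl B) (\<lambda>a1 a2. \<Sum>(h, c)\<leftarrow>coact B a2. F a1 (act B h b1) c b2)"
    and "bilinear_form (scl B) (scl B) (\<lambda>b1 b2. \<Sum>(h, c)\<leftarrow>coact B a2. F a1 (act B h b1) c b2)"
proof -
  show "bilinear_form (scl B) (scl B) (\<lambda>a1 a2. \<Sum>(h, c)\<leftarrow>coact B a2. F a1 (act B h b1) c b2)"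
  proof (rule bilinear_formI)
    show "linear_form (scl B) (\<lambda>a2. \<Sum>(h, c)\<leftarrow>coact B a2. F a1 (act B h b1) c b2)" for a1
      by (rule coact_linear[OF coact_bilinear[OF F]])
    show "linear_form (scl B) (\<lambda>a1. \<Sum>(h, c)\<leftarrow>coact B a2. F a1 (act B h b1) c b2)" for a2
      unfolding case_prod_unfold by (rule linear_form_sums[OF vsB four_linearD(1)[OF F]])
  qed
  show "bilinear_form (scl B) (scl B) (\<lambda>b1 b2. \<Sum>(h, c)\<leftarrow>coact B a2. F a1 (act B h b1) c b2)"
    unfolding case_prod_unfold
    by (intro bilinear_formI linear_form_sums vsB four_linearD(4)[OF F]
        linear_form_comp[OF act_linear four_linearD(2)[OF F]])
qed

lemma braided_middle:
  assumes F: "four_linear F"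
  shows "bilinear_form (scl B) (scl B)
    (\<lambda>a1 a2. \<Sum>(b1, b2)\<leftarrow>cop B b. \<Sum>(h, c)\<leftarrow>coact B a2. F a1 (act B h b1) c b2)"
  unfolding case_prod_unfold
  by (intro bilinear_formI linear_form_sums vsB
      bilinear_formD[OF braided_inner(1)[OF F], unfolded case_prod_unfold])

lemma braided_bilinear:
  assumes F: "four_linear F"
  shows "bilinear_form (scl B) (scl B) (\<lambda>a b. \<Sum>((u, v), (u', v'))\<leftarrow>braided_cop B a b. F u v u' v')"
  unfolding braided_sum
proof (rule bilinear_formI)
  show "linear_form (scl B) (\<lambda>a. \<Sum>(a1, a2)\<leftarrow>cop B a. \<Sum>(b1, b2)\<leftarrow>cop B b. \<Sum>(h, c)\<leftarrow>coact B a2.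
      F a1 (act B h b1) c b2)" for b
    by (rule cop_linear[OF coB braided_middle[OF F]])
  show "linear_form (scl B) (\<lambda>b. \<Sum>(a1, a2)\<leftarrow>cop B a. \<Sum>(b1, b2)\<leftarrow>cop B b. \<Sum>(h, c)\<leftarrow>coact B a2.
      F a1 (act B h b1) c b2)" for a
    unfolding case_prod_unfold
    by (intro linear_form_sums vsB) (rule cop_linear[OF coB braided_inner(2)[OF F], unfolded case_prod_unfold])
qed

text \<open>Multiplicativity of the coproduct reduces to primitive letters. A letter that goes right
  acts on the left factor through its coaction g_i, which gives q to the length of that
  factor.\<close>

lemma cop_word:
  "bilinear_form (scl B) (scl B) F \<Longrightarrow> (\<Sum>(u, v)\<leftarrow>cop B (X w). F u v) = wsplit w (\<lambda>a b. F (X a) (X b))"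
proof (induction w arbitrary: F)
  case Nil
  from tensor_eqD[OF cop_1 Nil] show ?case by simp
next
  case (Cons i w)
  let ?F = "\<lambda>u v u' v'. F (u * v) (u' * v')"
  have F: "four_linear ?F"
    unfolding four_linear_def using bilinear_formD[OF Cons.prems]
    by (auto intro!: linear_formI simp: vsB distrib_left distrib_right Vector_Spaces.linear_iff)
  have "(\<Sum>(u, v)\<leftarrow>cop B (X (i # w)). F u v) =
      (\<Sum>((u, v), (u', v'))\<leftarrow>braided_cop B (x i) (X w). F (u * v) (u' * v'))"
    using tensor_eqD[OF cop_mult Cons.prems, of "x i" "X w"]
    by (simp add: sum_list_concat_map case_prod_unfold o_def)
  also have "\<dots> = (\<Sum>(b1, b2)\<leftarrow>cop B (X w). \<Sum>(h, c)\<leftarrow>coact B 1. F (x i * act B h b1) (c * b2)) +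
      (\<Sum>(b1, b2)\<leftarrow>cop B (X w). \<Sum>(h, c)\<leftarrow>coact B (x i). F (1 * act B h b1) (c * b2))"
    unfolding braided_sum using tensor_eqD[OF cop_x[of i] braided_middle[OF F, of "X w"]] by simp
  also have "(\<Sum>(b1, b2)\<leftarrow>cop B (X w). \<Sum>(h, c)\<leftarrow>coact B 1. F (x i * act B h b1) (c * b2)) =
      (\<Sum>(b1, b2)\<leftarrow>cop B (X w). F (x i * b1) b2)"
    using coact_word[OF coact_bilinear[OF F], of _ _ _ "[]"] ydm by (simp add: yd_module_def)
  also have "\<dots> = wsplit w (\<lambda>a b. F (X (i # a)) (X b))"
    using Cons.IH[of "\<lambda>u v. F (x i * u) v"] bilinear_formD[OF Cons.prems]
    by (simp add: bilinear_form_def Vector_Spaces.linear_iff distrib_left)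
  also have "(\<Sum>(b1, b2)\<leftarrow>cop B (X w). \<Sum>(h, c)\<leftarrow>coact B (x i). F (1 * act B h b1) (c * b2)) =
      (\<Sum>(b1, b2)\<leftarrow>cop B (X w). F (act B (g i) b1) (x i * b2))"
    using coact_word[OF coact_bilinear[OF F], of 1 _ _ "[i]"] by simp
  also have "\<dots> = wsplit w (\<lambda>a b. F (act B (g i) (X a)) (x i * X b))"
    using Cons.IH[of "\<lambda>u v. F (act B (g i) u) (x i * v)"] bilinear_formD[OF Cons.prems] act_linear[of "g i"]
    by (simp add: bilinear_form_def Vector_Spaces.linear_iff distrib_left)
  also have "\<dots> = wsplit w (\<lambda>a b. q ^ length a * F (X a) (X (i # b)))"
    by (simp add: act_word chiw_g linear_form_scale[OF bilinear_formD(1)[OF Cons.prems]])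
  finally show ?case by (simp add: wsplit_Cons)
qed

lemma braided_word:
  assumes F: "four_linear F"
  shows "(\<Sum>((a, b), (c, d))\<leftarrow>braided_cop B (X u) (X v). F a b c d) =
    wsplit2 u v (\<lambda>a b c d. F (X a) (X b) (X c) (X d))"
proof -
  have inner: "(\<Sum>(b1, b2)\<leftarrow>cop B (X v). \<Sum>(h, c)\<leftarrow>coact B (X u2). F (X u1) (act B h b1) c b2) =
    wsplit v (\<lambda>v1 v2. F (X u1) (act B (gw u2) (X v1)) (X u2) (X v2))" for u1 u2
  proof -
    have "(\<Sum>(h, c)\<leftarrow>coact B (X u2). F (X u1) (act B h b1) c b2) = F (X u1) (act B (gw u2) b1) (X u2) b2" for b1 b2
      by (rule coact_word[OF coact_bilinear[OF F]])
    then show ?thesis using cop_word[OF braided_inner(2)[OF F, of "X u1" "X u2"], of v] by (simp only:)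
  qed
  have "(\<Sum>((a, b), (c, d))\<leftarrow>braided_cop B (X u) (X v). F a b c d) =
    wsplit u (\<lambda>u1 u2. \<Sum>(b1, b2)\<leftarrow>cop B (X v). \<Sum>(h, c)\<leftarrow>coact B (X u2). F (X u1) (act B h b1) c b2)"
    unfolding braided_sum by (rule cop_word[OF braided_middle[OF F]])
  also have "\<dots> = wsplit u (\<lambda>u1 u2. wsplit v (\<lambda>v1 v2. F (X u1) (act B (gw u2) (X v1)) (X u2) (X v2)))"
    by (simp only: inner)
  also have "\<dots> = wsplit2 u v (\<lambda>a b c d. F (X a) (X b) (X c) (X d))"
    by (simp only: wsplit2_def act_gw linear_form_scale[OF four_linearD(2)[OF F]])
  finally show ?thesis .
qed

lemma four_linear_tensor:
  assumes "bilinear_form (scl B) (scl B) s" "bilinear_form (scl B) (scl B) t"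
  shows "four_linear (\<lambda>a b c d. s a b * t c d)"
  using linear_form_mult_right[OF bilinear_formD(1)[OF assms(1)]]
    linear_form_mult_right[OF bilinear_formD(2)[OF assms(1)]]
    linear_form_mult_left[OF bilinear_formD(1)[OF assms(2)]]
    linear_form_mult_left[OF bilinear_formD(2)[OF assms(2)]]
  unfolding four_linear_def by blast

lemma conv2_bilinear:
  "bilinear_form (scl B) (scl B) s \<Longrightarrow> bilinear_form (scl B) (scl B) t \<Longrightarrow> bilinear_form (scl B) (scl B) (conv2 B s t)"
  unfolding conv2_def by (intro braided_bilinear four_linear_tensor)

lemma conv2_word:
  assumes "bilinear_form (scl B) (scl B) s" "bilinear_form (scl B) (scl B) t"
  shows "conv2 B s t (X u) (X v) = word_conv2 (\<lambda>u v. s (X u) (X v)) (\<lambda>u v. t (X u) (X v)) u v"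
  unfolding conv2_def word_conv2_def by (rule braided_word[OF four_linear_tensor[OF assms]])

lemma conv_word:
  assumes "linear_form (scl B) f" "linear_form (scl B) f'"
  shows "conv B f f' (X w) = word_conv (\<lambda>w. f (X w)) (\<lambda>w. f' (X w)) w"
  unfolding conv_def word_conv_def by (rule cop_word[OF bilinear_form_tensor[OF assms]])

text \<open>The counit is H-linear and a group-like acts on x_i by q, so \<epsilon>(x_i) = q
  \<epsilon>(x_i) is zero.\<close>

lemma cou_word: "cou B (X w) = word_unit w"
proof -
  have "cou B (x i) = 0" for i
  proof -
    have "cou B (act B (g One) (x i)) = cou H (g One) * cou B (x i)" using ydc by (simp add: yd_coalgebra_def)
    then have "q * cou B (x i) = cou B (x i)"
      using linear_form_scale[OF cou_linear] by (simp add: act_x chi_g cou_g)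
    then show ?thesis using q_neq_1 by simp
  qed
  then show ?thesis by (cases w) (simp_all add: word_unit_def cou_1 cou_mult)
qed

lemma span_words: "vB.span (range X) = UNIV"
proof -
  have "a \<in> vB.span (range X)" for a
  proof -
    obtain p where "a = free_eval (scl B) x p" using presB by (metis presented_by_def surjD)
    then have a: "a = (\<Sum>w\<in>Poly_Mapping.keys p. scl B (Poly_Mapping.lookup p w) (X (letters w)))"
      by (simp add: free_eval_eq free_ext_def)
    show ?thesis
      unfolding a by (intro vB.span_sum vB.span_scale vB.span_base rangeI)
  qed
  then show ?thesis by auto
qed

lemma mult_form_bilinear:
  assumes "linear_form (scl B) F"
  shows "bilinear_form (scl B) (scl B) (\<lambda>u v. F (u * v))"
  using assms by (intro bilinear_formI linear_formI)
    (simp_all add: vsB distrib_left distrib_right Vector_Spaces.linear_iff)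

lemma linear_form_eq_words:
  assumes "linear_form (scl B) f" "linear_form (scl B) f'" "\<And>w. f (X w) = f' (X w)"
  shows "f = f'"
proof
  fix a
  have "a \<in> vB.span (range X)" by (simp add: span_words)
  then show "f a = f' a"
  proof (induction rule: vB.span_induct_alt)
    case base
    then show ?case by (simp add: linear_form_zero[OF assms(1)] linear_form_zero[OF assms(2)])
  next
    case (step c b y)
    then show ?case
      using assms(3) by (auto simp: linear_form_add[OF assms(1)] linear_form_add[OF assms(2)]
          linear_form_scale[OF assms(1)] linear_form_scale[OF assms(2)])
  qed
qed

lemma bilinear_form_eq_words:
  assumes "bilinear_form (scl B) (scl B) s" "bilinear_form (scl B) (scl B) t"
    and "\<And>u v. s (X u) (X v) = t (X u) (X v)"
  shows "s = t"
proof
  fix a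
  show "s a = t a"
  proof (rule linear_form_eq_words)
    fix v
    have "(\<lambda>a. s a (X v)) = (\<lambda>a. t a (X v))"
      by (rule linear_form_eq_words)
        (rule bilinear_formD(1)[OF assms(1)] bilinear_formD(1)[OF assms(2)] assms(3))+
    then show "s a (X v) = t a (X v)" by (rule fun_cong)
  qed (rule bilinear_formD(2)[OF assms(1)] bilinear_formD(2)[OF assms(2)])+
qed

lemma H_linear2_supp:
  assumes "H_linear2 H B s" "s (X u) (X v) \<noteq> 0"
  shows "3 dvd length u + length v"
proof -
  have bil: "bilinear_form (scl B) (scl B) s" using assms(1) by (simp add: H_linear2_def)
  have "bilinear_form (scl H) (scl H) (\<lambda>h k. s (act B h (X u)) (act B k (X v)))"
    using bilinear_formD[OF bil] by (intro bilinear_formI) (auto intro: linear_form_comp[OF act_linear2])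
  from tensor_eqD[OF glike(2)[of One] this]
  have "s (act B (g One) (X u)) (act B (g One) (X v)) = cou H (g One) * s (X u) (X v)"
    using assms(1) by (simp add: H_linear2_def)
  then have "q ^ length u * (q ^ length v * s (X u) (X v)) = s (X u) (X v)"
    by (simp add: act_word chiw_g cou_g linear_form_scale[OF bilinear_formD(1)[OF bil]]
        linear_form_scale[OF bilinear_formD(2)[OF bil]] mult_ac)
  then have "q ^ (length u + length v) = 1" using assms(2) by (simp add: power_add)
  then show ?thesis by (simp add: q_power_eq_1_iff)
qed

lemma H_linear_supp:
  assumes "linear_form (scl B) f" "\<And>h a. f (act B h a) = cou H h * f a"
  shows "supp3 (\<lambda>w. f (X w))"
  unfolding supp3_def
proof (intro allI impI)
  fix w
  assume "f (X w) \<noteq> 0"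
  moreover have "q ^ length w * f (X w) = f (X w)"
    using assms(2)[of "g One" "X w"] by (simp add: act_word chiw_g cou_g linear_form_scale[OF assms(1)])
  ultimately have "q ^ length w = 1" by simp
  then show "3 dvd length w" by (simp add: q_power_eq_1_iff)
qed

lemma word_cocycleI:
  assumes "\<sigma> \<in> hopf_2_cocycles H B"
  shows "word_cocycle q (\<lambda>u v. \<sigma> (X u) (X v))"
proof -
  have bil: "bilinear_form (scl B) (scl B) \<sigma>" and HL: "H_linear2 H B \<sigma>"
    and unit: "\<sigma> a 1 = cou B a" "\<sigma> 1 a = cou B a"
    and coc: "conv2 B \<sigma> (\<lambda>u v. \<sigma> (u * v) c) a b = conv2 B \<sigma> (\<lambda>u v. \<sigma> a (u * v)) b c" for a b c
    using assms by (auto simp: hopf_2_cocycles_def H_linear2_def)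
  have b1: "bilinear_form (scl B) (scl B) (\<lambda>u v. \<sigma> (u * v) c)" and b2: "bilinear_form (scl B) (scl B) (\<lambda>u v. \<sigma> c (u * v))" for c
    using bilinear_formD[OF bil]
    by (intro bilinear_formI linear_formI;
        simp add: vsB distrib_left distrib_right Vector_Spaces.linear_iff)+
  show ?thesis
  proof
    show "\<sigma> (X u) (X v) \<noteq> 0 \<Longrightarrow> 3 dvd length u + length v" for u v
      by (rule H_linear2_supp[OF HL])
    show "\<sigma> (X []) (X v) = word_unit v" "\<sigma> (X u) (X []) = word_unit u" for u v
      by (simp_all add: unit cou_word)
    show "wsplit2 a b (\<lambda>a1 b1 a2 b2. \<sigma> (X a1) (X b1) * \<sigma> (X (a2 @ b2)) (X c)) =
          wsplit2 b c (\<lambda>b1 c1 b2 c2. \<sigma> (X b1) (X c1) * \<sigma> (X a) (X (b2 @ c2)))" for a b c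
      using coc[of "X c" "X a" "X b"] conv2_word[OF bil b1] conv2_word[OF bil b2]
      by (simp add: word_conv2_def)
  qed
qed

end

section \<open>Straightening in the presented algebras\<close>

locale A2_algebra = word_split q for q :: "'k::field_char_0" +
  fixes s :: "'k \<Rightarrow> 'a::ring_1 \<Rightarrow> 'a" and y :: "idx \<Rightarrow> 'a" and l1 l2 l12 l112 l122 :: 'k
  assumes pres: "presented_by s y (A2_relations q l1 l2 l12 l112 l122)"
begin

lemma alg: "algebra_over s"
  using pres by (simp add: presented_by_def)

sublocale vector_space s
  using alg by (simp add: algebra_over_def)

lemma smult [simp]: "s c a * b = s c (a * b)" "a * s c b = s c (a * b)"
  using alg by (simp_all add: algebra_over_def)

lemma relations: "word_relations s q l1 l2 l12 l112 l122 (word_prod y)"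
  using free_ext_A2_relations[OF vector_space_axioms q_cube q_neq_1] presented_kernel[OF pres] by blast

abbreviation z :: 'a where "z \<equiv> gen12 s q y"

lemma s_uminus_one_q: "s (- 1 - q) a = - a - s q a"
  by (simp add: scale_left_diff_distrib)

lemma y1_y2: "y One * y Two = z + s q (y Two * y One)"
  by (simp add: gen12_def)

lemma y_cubes: "y One * (y One * y One) = s l1 1" "y Two * (y Two * y Two) = s l2 1"
  and sum_112: "y One * (y One * y Two) + y One * (y Two * y One) + y Two * (y One * y One) = s l112 1"
  and sum_122: "y One * (y Two * y Two) + y Two * (y One * y Two) + y Two * (y Two * y One) = s l122 1"
  using relations[unfolded word_relations_def, rule_format, of "[]" "[]"] by simp_all

lemma y1_z: "y One * z = s (q\<^sup>2) (z * y One) + s l112 1"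
proof -
  have "y One * z - s (q\<^sup>2) (z * y One) =
      y One * (y One * y Two) - (s q (y One * (y Two * y One)) + s (q\<^sup>2) (y One * (y Two * y One)))
      + s (q ^ 3) (y Two * (y One * y One))"
    by (simp add: gen12_def algebra_simps scale_right_diff_distrib power2_eq_square power3_eq_cube)
  also have "s q (y One * (y Two * y One)) + s (q\<^sup>2) (y One * (y Two * y One)) = - (y One * (y Two * y One))"
    by (simp add: power2_eq_square q_square s_uminus_one_q)
  finally have "y One * z - s (q\<^sup>2) (z * y One) = s l112 1" by (simp add: q_cube flip: sum_112)
  then show ?thesis by (simp add: algebra_simps)
qed

lemma z_y2: "z * y Two = s (q\<^sup>2) (y Two * z) + s l122 1"
proof -
  have "z * y Two - s (q\<^sup>2) (y Two * z) =
      y One * (y Two * y Two) - (s q (y Two * (y One * y Two)) + s (q\<^sup>2) (y Two * (y One * y Two)))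
      + s (q ^ 3) (y Two * (y Two * y One))"
    by (simp add: gen12_def algebra_simps scale_right_diff_distrib power2_eq_square power3_eq_cube)
  also have "s q (y Two * (y One * y Two)) + s (q\<^sup>2) (y Two * (y One * y Two)) = - (y Two * (y One * y Two))"
    by (simp add: power2_eq_square q_square s_uminus_one_q)
  finally have "z * y Two - s (q\<^sup>2) (y Two * z) = s l122 1" by (simp add: q_cube flip: sum_122)
  then show ?thesis by (simp add: algebra_simps)
qed

lemma z_cube: "z * (z * z) = s l12 1"
proof -
  have "z * (z * z) = word_prod y [One, Two, One, Two, One, Two]
       - s q (word_prod y [One, Two, One, Two, Two, One] + word_prod y [One, Two, Two, One, One, Two]
            + word_prod y [Two, One, One, Two, One, Two])
       + s (q\<^sup>2) (word_prod y [One, Two, Two, One, Two, One] + word_prod y [Two, One, One, Two, Two, One]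
            + word_prod y [Two, One, Two, One, One, Two])
       - s (q ^ 3) (word_prod y [Two, One, Two, One, Two, One])"
    by (simp add: gen12_def algebra_simps scale_right_diff_distrib scale_right_distrib
        power2_eq_square power3_eq_cube)
  also have "\<dots> = s l12 1"
    using relations[unfolded word_relations_def, rule_format, of "[]" "[]"] by (simp add: q_cube)
  finally show ?thesis .
qed

abbreviation Y :: "nat \<times> nat \<times> nat \<Rightarrow> 'a" where "Y \<equiv> pbw s q y"

lemma y1_y2_left: "y One * (y Two * a) = z * a + s q (y Two * (y One * a))"
  and y1_z_left: "y One * (z * a) = s (q\<^sup>2) (z * (y One * a)) + s l112 a"
  and z_y2_left: "z * (y Two * a) = s (q\<^sup>2) (y Two * (z * a)) + s l122 a"
  and cube_left: "y One * (y One * (y One * a)) = s l1 a" "y Two * (y Two * (y Two * a)) = s l2 a"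
    "z * (z * (z * a)) = s l12 a"
proof -
  show "y One * (y Two * a) = z * a + s q (y Two * (y One * a))"
    using arg_cong[OF y1_y2, of "\<lambda>b. b * a"] by (simp add: distrib_right mult.assoc)
  show "y One * (z * a) = s (q\<^sup>2) (z * (y One * a)) + s l112 a"
    using arg_cong[OF y1_z, of "\<lambda>b. b * a"] by (simp add: distrib_right mult.assoc)
  show "z * (y Two * a) = s (q\<^sup>2) (y Two * (z * a)) + s l122 a"
    using arg_cong[OF z_y2, of "\<lambda>b. b * a"] by (simp add: distrib_right mult.assoc)
  show "y One * (y One * (y One * a)) = s l1 a" "y Two * (y Two * (y Two * a)) = s l2 a"
    "z * (z * (z * a)) = s l12 a"
    using arg_cong[OF y_cubes(1), of "\<lambda>b. b * a"] arg_cong[OF y_cubes(2), of "\<lambda>b. b * a"]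
      arg_cong[OF z_cube, of "\<lambda>b. b * a"] by (simp_all add: mult.assoc)
qed

definition pbw_degree :: "nat \<times> nat \<times> nat \<Rightarrow> nat" where
  "pbw_degree = (\<lambda>(a, b, c). a + 2 * b + c)"

definition degree_part :: "nat \<Rightarrow> 'a set" where
  "degree_part n = span (Y ` {e \<in> pbw_exponents. pbw_degree e = n})"

lemma degree_part_pbw: "(a, b, c) \<in> pbw_exponents \<Longrightarrow> Y (a, b, c) \<in> degree_part (a + 2 * b + c)"
  unfolding degree_part_def by (rule span_base) (auto simp: pbw_degree_def)

text \<open>For the undeformed relations straightening preserves the degree.\<close>

lemma degree_part_mult:
  assumes zero: "l1 = 0" "l2 = 0" "l12 = 0" "l112 = 0" "l122 = 0" and v: "v \<in> degree_part n"
  shows "y i * v \<in> degree_part (Suc n)"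
  using v unfolding degree_part_def[of n]
proof (induction rule: span_induct_alt)
  case base
  then show ?case by (simp add: degree_part_def span_zero)
next
  case (step r u v)
  then obtain a b c where e: "u = Y (a, b, c)" "(a, b, c) \<in> pbw_exponents" "a + 2 * b + c = n"
    by (auto simp: pbw_degree_def)
  have Suc: "Y (a', b', c') \<in> degree_part (Suc n)" if "a' \<le> 2" "b' \<le> 2" "c' \<le> 2" "a' + 2 * b' + c' = Suc n" for a' b' c'
    using degree_part_pbw[of a' b' c'] that by (simp add: pbw_exponents_def)
  have "y i * u \<in> degree_part (Suc n)"
  proof (cases i)
    case Two
    consider "a < 2" | "a = 2" using e(2) by (fastforce simp: pbw_exponents_def)
    then show ?thesis
    proof cases
      case 1
      then have "y i * u = Y (Suc a, b, c)" by (simp add: Two e(1) pbw_def mult.assoc)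
      then show ?thesis using Suc[of "Suc a" b c] e 1 by (simp add: pbw_exponents_def)
    next
      case 2
      then have "y i * u = 0" by (simp add: Two e(1) pbw_def power2_eq_square mult.assoc cube_left zero)
      then show ?thesis by (simp add: degree_part_def span_zero)
    qed
  next
    case One
    have r1: "y Two ^ a * z ^ b * (y One * y One ^ c) \<in> degree_part (Suc n)"
    proof (cases "c = 2")
      case True
      then have "y One * y One ^ c = 0" by (simp add: power2_eq_square y_cubes zero)
      then show ?thesis by (simp add: degree_part_def span_zero)
    next
      case False
      then show ?thesis using Suc[of a b "Suc c"] e by (simp add: pbw_exponents_def pbw_def)
    qed
    have zz: "y One * z ^ b = s (q ^ (2 * b)) (z ^ b * y One)"
    proof -
      consider "b = 0" | "b = 1" | "b = 2" using e(2) by (fastforce simp: pbw_exponents_def)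
      then show ?thesis
        by cases (simp_all add: y1_z y1_z_left zero power2_eq_square power4_eq_xxxx mult.assoc)
    qed
    have r1': "y Two ^ a * (y One * (z ^ b * y One ^ c)) \<in> degree_part (Suc n)"
    proof -
      have "y Two ^ a * (y One * (z ^ b * y One ^ c)) = s (q ^ (2 * b)) (y Two ^ a * z ^ b * (y One * y One ^ c))"
        using arg_cong[OF zz, of "\<lambda>t. y Two ^ a * (t * y One ^ c)"] by (simp add: mult.assoc)
      then show ?thesis using r1 by (simp add: degree_part_def span_scale)
    qed
    have r2: "y Two ^ a' * z ^ Suc b * y One ^ c \<in> degree_part (Suc n)" if "a = Suc a'" for a'
    proof (cases "b = 2")
      case True
      then have "z ^ Suc b = 0" using z_cube by (simp add: power3_eq_cube mult.assoc zero)
      then show ?thesis by (simp add: degree_part_def span_zero)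
    next
      case False
      then show ?thesis using Suc[of a' "Suc b" c] e that by (simp add: pbw_exponents_def pbw_def)
    qed
    consider "a = 0" | "a = 1" | "a = 2" using e(2) by (fastforce simp: pbw_exponents_def)
    then show ?thesis
    proof cases
      case 1
      then show ?thesis using r1' by (simp add: One e(1) pbw_def mult.assoc)
    next
      case 2
      then have "y i * u = y Two ^ 0 * z ^ Suc b * y One ^ c + s q (y Two ^ a * (y One * (z ^ b * y One ^ c)))"
        by (simp add: One e(1) pbw_def mult.assoc y1_y2_left)
      then show ?thesis using r1' r2[of 0] 2 by (simp add: degree_part_def span_add span_scale)
    next
      case 3
      \<comment> \<open>From y1 y2^2 = z y2 + q y2 y1 y2 = (q^2 + q) y2 z + q^2 y2^2 y1 in the
        undeformed algebra.\<close>
      then have "y i * u = s (q\<^sup>2 + q) (y Two ^ 1 * z ^ Suc b * y One ^ c)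
          + s (q * q) (y Two ^ a * (y One * (z ^ b * y One ^ c)))"
        by (simp add: One e(1) pbw_def mult.assoc y1_y2_left z_y2_left zero power2_eq_square
            scale_right_distrib scale_left_distrib distrib_left)
      then show ?thesis using r1' r2[of 1] 3 by (simp add: degree_part_def span_add span_scale)
    qed
  qed
  moreover have "y i * (s r u + v) = s r (y i * u) + y i * v" by (simp add: distrib_left)
  ultimately show ?case using step.IH by (simp add: degree_part_def span_add span_scale)
qed

lemma word_degree_part:
  assumes zero: "l1 = 0" "l2 = 0" "l12 = 0" "l112 = 0" "l122 = 0"
  shows "word_prod y w \<in> degree_part (length w)"
proof (induction w)
  case Nil
  have "Y (0, 0, 0) \<in> degree_part (0 + 2 * 0 + 0)"
    by (rule degree_part_pbw) (simp add: pbw_exponents_def)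
  then show ?case by (simp add: pbw_def)
next
  case (Cons i w)
  then show ?case using degree_part_mult[OF zero] by simp
qed

text \<open>The largest degree of a PBW monomial is 2 + 4 + 2 = 8.\<close>

lemma degree_part_long: "9 \<le> n \<Longrightarrow> degree_part n = {0}"
proof -
  assume "9 \<le> n"
  then have "{e \<in> pbw_exponents. pbw_degree e = n} = {}"
    by (auto simp: pbw_exponents_def pbw_degree_def)
  then show ?thesis unfolding degree_part_def by (simp only: image_empty span_empty)
qed

lemma degree_part_8: "degree_part 8 = span {Y (2, 2, 2)}"
proof -
  have "{e \<in> pbw_exponents. pbw_degree e = 8} = {(2, 2, 2)}"
    by (auto simp: pbw_exponents_def pbw_degree_def)
  then show ?thesis unfolding degree_part_def by (simp only: image_insert image_empty)
qed

end

section \<open>The twisted algebra satisfies the deformed relations\<close>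

lemma linear_form_diff: "linear_form s f \<Longrightarrow> f (a - b) = f a - f b"
  using linear_form_add[of s f "a - b" b] by simp

lemma word_relations_linear:
  assumes F: "Vector_Spaces.linear s t F" and f: "word_relations s q l1 l2 l12 l112 l122 f"
  shows "word_relations t q l1 l2 l12 l112 l122 (\<lambda>w. F (f w))"
proof -
  interpret F: Vector_Spaces.linear s t F by (rule F)
  have "F (s c a) = t c (F a)" for c a using F by (simp add: Vector_Spaces.linear_iff)
  then have eq: "F (a + b) = F a + F b" "F (a - b) = F a - F b" "F (s c a) = t c (F a)" for a b c
    by (simp_all add: F.add F.diff)
  show ?thesis
    using f unfolding word_relations_def by (simp flip: eq)
qed

locale deformation = nichols q H g chi B x
  for q :: "'k::field_char_0" and H :: "('k, 'h::ring_1) hopf" and g chi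
    and B :: "('k, 'b::ring_1, 'h) yd_hopf" and x +
  fixes sE :: "'k \<Rightarrow> 'e::ring_1 \<Rightarrow> 'e" and y :: "idx \<Rightarrow> 'e" and eps0 :: "'e \<Rightarrow> 'k"
    and \<gamma> :: "'b \<Rightarrow> 'e" and \<sigma> :: "'b \<Rightarrow> 'b \<Rightarrow> 'k" and l1 l2 l12 l112 l122 :: 'k
  assumes deformed: "deformed_algebra q l1 l2 l12 l112 l122 sE y"
    and eps0: "is_eps0 q sE y eps0"
    and section_\<gamma>: "is_section q l1 l112 (scl B) x sE y \<gamma>"
    and \<sigma>_def: "\<sigma> = (\<lambda>a b. eps0 (\<gamma> a * \<gamma> b))"
    and cocycle: "\<sigma> \<in> hopf_2_cocycles H B"
begin

sublocale E: A2_algebra q sE y l1 l2 l12 l112 l122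
  by unfold_locales (use deformed in \<open>simp add: deformed_algebra_def\<close>)

sublocale N: A2_algebra q "scl B" x 0 0 0 0 0
  by unfold_locales (rule presB)

sublocale W: word_cocycle q "\<lambda>u v. \<sigma> (X u) (X v)"
  by (rule word_cocycleI[OF cocycle])

lemma bil: "bilinear_form (scl B) (scl B) \<sigma>" and HL: "H_linear2 H B \<sigma>"
  using cocycle by (auto simp: hopf_2_cocycles_def H_linear2_def)

lemmas \<sigma>_lin = linear_form_add[OF bilinear_formD(1)[OF bil]] linear_form_add[OF bilinear_formD(2)[OF bil]]
  linear_form_diff[OF bilinear_formD(1)[OF bil]] linear_form_diff[OF bilinear_formD(2)[OF bil]]
  linear_form_scale[OF bilinear_formD(1)[OF bil]] linear_form_scale[OF bilinear_formD(2)[OF bil]]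
  linear_form_zero[OF bilinear_formD(1)[OF bil]] linear_form_zero[OF bilinear_formD(2)[OF bil]]

lemma eps0_linear: "linear_form sE eps0" and eps0_1: "eps0 1 = 1"
  and eps0_pbw: "e \<in> pbw_exponents \<Longrightarrow> e \<noteq> (0, 0, 0) \<Longrightarrow> eps0 (E.Y e) = 0"
  using eps0 by (simp_all add: is_eps0_def)

lemmas eps0_lin = linear_form_add[OF eps0_linear] linear_form_diff[OF eps0_linear]
  linear_form_scale[OF eps0_linear] linear_form_zero[OF eps0_linear]

lemma \<gamma>_linear: "Vector_Spaces.linear (scl B) sE \<gamma>"
  using section_\<gamma> by (simp add: is_section_def)

lemma \<gamma>_add: "\<gamma> (a + b) = \<gamma> a + \<gamma> b" and \<gamma>_scale: "\<gamma> (scl B c a) = sE c (\<gamma> a)"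
  using \<gamma>_linear by (simp_all add: Vector_Spaces.linear_iff)

lemma \<gamma>_pbw: "n \<in> pbw_exponents - {(0,2,0), (0,2,1), (0,1,2), (1,2,0), (1,1,2), (1,2,1), (0,2,2), (1,2,2)} \<Longrightarrow>
    \<gamma> (N.Y n) = E.Y n"
  and \<gamma>_020: "\<gamma> (N.Y (0,2,0)) = E.Y (0,2,0) - sE ((q\<^sup>2 - q) * l112) (E.Y (1,0,0))"
  using section_\<gamma> unfolding is_section_def Let_def by blast+

text \<open>On products of at most two letters the section is multiplicative; x12^2 is the only
  correction needed to evaluate \<sigma> on the relations.\<close>

lemma \<gamma>_small: "\<gamma> 1 = 1" "\<gamma> (x i) = y i" "\<gamma> (N.z) = E.z" "\<gamma> (x i * x j) = y i * y j"
  "\<gamma> (N.z * N.z) = E.z * E.z - sE ((q\<^sup>2 - q) * l112) (y Two)"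
proof -
  show "\<gamma> 1 = 1" using \<gamma>_pbw[of "(0,0,0)"] by (simp add: pbw_def pbw_exponents_def)
  have 1: "\<gamma> (x One) = y One" using \<gamma>_pbw[of "(0,0,1)"] by (simp add: pbw_def pbw_exponents_def)
  have 2: "\<gamma> (x Two) = y Two" using \<gamma>_pbw[of "(1,0,0)"] by (simp add: pbw_def pbw_exponents_def)
  show "\<gamma> (x i) = y i" using 1 2 by (cases i) simp_all
  show z: "\<gamma> (N.z) = E.z" using \<gamma>_pbw[of "(0,1,0)"] by (simp add: pbw_def pbw_exponents_def)
  have 11: "\<gamma> (x One * x One) = y One * y One" using \<gamma>_pbw[of "(0,0,2)"]
    by (simp add: pbw_def pbw_exponents_def power2_eq_square)
  have 22: "\<gamma> (x Two * x Two) = y Two * y Two" using \<gamma>_pbw[of "(2,0,0)"]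
    by (simp add: pbw_def pbw_exponents_def power2_eq_square)
  have 21: "\<gamma> (x Two * x One) = y Two * y One" using \<gamma>_pbw[of "(1,0,1)"]
    by (simp add: pbw_def pbw_exponents_def)
  have 12: "\<gamma> (x One * x Two) = y One * y Two"
    unfolding N.y1_y2 E.y1_y2 by (simp add: \<gamma>_add \<gamma>_scale z 21)
  show "\<gamma> (x i * x j) = y i * y j" using 11 22 21 12 by (cases i; cases j) simp_all
  show "\<gamma> (N.z * N.z) = E.z * E.z - sE ((q\<^sup>2 - q) * l112) (y Two)"
    using \<gamma>_020 by (simp add: pbw_def power2_eq_square)
qed

lemma eps0_small: "eps0 (E.z * y One) = 0" "eps0 (y Two * (y One * y One)) = 0" "eps0 (y Two * E.z) = 0"
  "eps0 (y Two * (y Two * y One)) = 0"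
  using eps0_pbw[of "(0,1,1)"] eps0_pbw[of "(1,0,2)"] eps0_pbw[of "(1,1,0)"] eps0_pbw[of "(2,0,1)"]
  by (simp_all add: pbw_def pbw_exponents_def power2_eq_square mult.assoc)

lemma eps0_3:
  "eps0 (y One * (y One * y One)) = l1" "eps0 (y Two * (y Two * y Two)) = l2"
  "eps0 (y One * (y One * y Two)) = l112" "eps0 (y One * (y Two * y One)) = 0" "eps0 (y Two * (y One * y One)) = 0"
  "eps0 (y One * (y Two * y Two)) = l122" "eps0 (y Two * (y One * y Two)) = 0" "eps0 (y Two * (y Two * y One)) = 0"
proof -
  show "eps0 (y One * (y One * y One)) = l1" "eps0 (y Two * (y Two * y Two)) = l2"
    by (simp_all add: E.y_cubes eps0_lin eps0_1)
  show "eps0 (y One * (y One * y Two)) = l112"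
    by (simp add: E.y1_y2 E.y1_y2_left E.y1_z distrib_left eps0_lin eps0_1 eps0_small)
  show "eps0 (y One * (y Two * y One)) = 0"
    by (simp add: E.y1_y2_left eps0_lin eps0_small)
  show "eps0 (y One * (y Two * y Two)) = l122"
    by (simp add: E.y1_y2 E.y1_y2_left E.z_y2 distrib_left eps0_lin eps0_1 eps0_small)
  show "eps0 (y Two * (y One * y Two)) = 0"
    by (simp add: E.y1_y2 distrib_left eps0_lin eps0_small)
qed (rule eps0_small)+

lemma \<phi>_0: "\<not> 3 dvd length w \<Longrightarrow> W.\<phi> w = 0"
  using W.\<phi>_supp by blast

lemma \<phi>_small: "W.\<phi> [a] = 0" "W.\<phi> [a, b] = 0" "W.\<phi> [a, b, c, d] = 0" "W.\<phi> [a, b, c, d, e] = 0"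
  by (rule \<phi>_0; simp only: list.size; presburger)+

lemma \<phi>_3: "W.\<phi> [i, j, k] = eps0 (y i * (y j * y k))"
proof -
  have "W.\<phi> [i, j, k] = \<sigma> (x i) (x j * x k)"
    using W.\<phi>_Cons[of i "[j, k]"] by (simp add: wsplit_Cons \<phi>_small)
  then show ?thesis by (simp add: \<sigma>_def \<gamma>_small)
qed

lemma \<sigma>_21: "\<sigma> (x i * x j) (x k) = W.\<phi> [i, j, k]"
  using W.\<phi>_append_wsplit[of "[i, j]" "[k]"] by (simp add: wsplit_Cons \<phi>_small)

text \<open>The letter of a b c d that joins i j crosses the letters behind it, which gives the
  weights 1, q, q^2 and q^3 = 1.\<close>

lemma \<phi>_24:
  "W.\<phi> [i, j, a, b, c, d] = \<sigma> (x i * x j) (x a * (x b * (x c * x d))) +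
     (W.\<phi> [a, b, c] * W.\<phi> [i, j, d] + q * (W.\<phi> [a, b, d] * W.\<phi> [i, j, c]) +
      q\<^sup>2 * (W.\<phi> [a, c, d] * W.\<phi> [i, j, b]) + W.\<phi> [b, c, d] * W.\<phi> [i, j, a])"
proof -
  have "\<sigma> (X u) (X []) = (if u = [] then 1 else 0)" for u
    using W.\<sigma>_Nil_right[of u] by (simp add: word_unit_def)
  from this[of "[i, j]"] have "\<sigma> (x i * x j) 1 = 0" by simp
  then show ?thesis
    using W.\<phi>_append_wsplit[of "[i, j]" "[a, b, c, d]"]
    by (simp add: wsplit_Cons \<phi>_small \<sigma>_21 q_square q_mult_left power2_eq_square algebra_simps)
qed

lemma \<sigma>_z: "\<sigma> N.z (N.z * N.z) = l12 - (q\<^sup>2 - q) * l112 * l122"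
  by (simp add: \<sigma>_def \<gamma>_small right_diff_distrib E.z_cube E.z_y2 eps0_lin eps0_1 eps0_small
      eps0_pbw[of "(1,1,0)", simplified pbw_def pbw_exponents_def, simplified])

text \<open>Expand \<sigma>(x12, x12^2) over the eight words. The products of length three values in
  \<open>\<phi>_24\<close> restore the term (q^2 - q) \<lambda>112 \<lambda>122 that the correction
  of the section removes in \<open>\<sigma>_z\<close>.\<close>

lemma \<phi>_z: "W.\<phi> [One, Two, One, Two, One, Two]
       - q * (W.\<phi> [One, Two, One, Two, Two, One] + W.\<phi> [One, Two, Two, One, One, Two]
            + W.\<phi> [Two, One, One, Two, One, Two])
       + q\<^sup>2 * (W.\<phi> [One, Two, Two, One, Two, One] + W.\<phi> [Two, One, One, Two, Two, One]
            + W.\<phi> [Two, One, Two, One, One, Two])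
       - W.\<phi> [Two, One, Two, One, Two, One] = l12"
proof -
  have "\<sigma> N.z (N.z * N.z) =
      \<sigma> (x One * x Two) (x One * (x Two * (x One * x Two)))
       - q * (\<sigma> (x One * x Two) (x One * (x Two * (x Two * x One))) + \<sigma> (x One * x Two) (x Two * (x One * (x One * x Two)))
            + \<sigma> (x Two * x One) (x One * (x Two * (x One * x Two))))
       + q\<^sup>2 * (\<sigma> (x One * x Two) (x Two * (x One * (x Two * x One))) + \<sigma> (x Two * x One) (x One * (x Two * (x Two * x One)))
            + \<sigma> (x Two * x One) (x Two * (x One * (x One * x Two))))
       - q ^ 3 * \<sigma> (x Two * x One) (x Two * (x One * (x Two * x One)))"
    by (simp add: gen12_def left_diff_distrib right_diff_distrib \<sigma>_lin mult.assoc)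
      (simp add: algebra_simps power2_eq_square power3_eq_cube)
  then show ?thesis
    using \<sigma>_z q_cube
    by (simp add: \<phi>_24 \<phi>_3 eps0_3 power2_eq_square q_square q_mult_left algebra_simps)
qed

text \<open>The product of the letters of w in the twisted algebra, as an element of B; its image
  under a linear form is \<open>twisted\<close>.\<close>

primrec p :: "idx list \<Rightarrow> 'b" where
  "p [] = 1"
| "p (i # w) = x i * p w + (\<Sum>(u, v)\<leftarrow>cop B (p w). scl B (\<sigma> (x i) u) v)"

lemma linear_p:
  assumes "linear_form (scl B) F"
  shows "F (p w) = W.twisted w (\<lambda>a. F (X a))"
  using assms
proof (induction w arbitrary: F)
  case (Cons i w)
  let ?F = "\<lambda>b. F (x i * b) + (\<Sum>(u, v)\<leftarrow>cop B b. \<sigma> (x i) u * F v)"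
  have bilF: "bilinear_form (scl B) (scl B) (\<lambda>u v. \<sigma> (x i) u * F v)"
    by (rule bilinear_form_tensor[OF bilinear_formD(2)[OF bil] Cons.prems])
  have "linear_form (scl B) (\<lambda>b. F (x i * b))"
    using Cons.prems by (intro linear_formI) (simp_all add: vsB distrib_left Vector_Spaces.linear_iff)
  then have lin: "linear_form (scl B) ?F"
    by (rule linear_form_plus[OF _ cop_linear[OF coB bilF]])
  have "F (p (i # w)) = ?F (p w)"
    by (simp add: linear_form_add[OF Cons.prems] linear_form_sum_list[OF Cons.prems] case_prod_unfold
        linear_form_scale[OF Cons.prems])
  also have "\<dots> = W.twisted w (\<lambda>a. ?F (X a))" by (rule Cons.IH[OF lin])
  also have "(\<lambda>a. ?F (X a)) = W.left_mult i (\<lambda>a. F (X a))"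
    by (simp add: fun_eq_iff W.left_mult_def cop_word[OF bilF])
  finally show ?case by simp
qed simp

declare p.simps(2) [simp del]

text \<open>The multiplication of B twisted on one side only, that is, the cleft object attached to
  \<sigma>.\<close>

definition starB :: "'b \<Rightarrow> 'b \<Rightarrow> 'b" where
  "starB a b = (\<Sum>((u, v), (u', v'))\<leftarrow>braided_cop B a b. scl B (\<sigma> u v) (u' * v'))"

lemma linear_starB:
  assumes "linear_form (scl B) F"
  shows "F (starB a b) = conv2 B \<sigma> (\<lambda>u v. F (u * v)) a b"
  by (simp add: starB_def conv2_def linear_form_sum_list[OF assms] case_prod_unfold linear_form_scale[OF assms])

lemma starB_linear:
  "starB (a + a') b = starB a b + starB a' b" "starB a (b + b') = starB a b + starB a b'"
  "starB (scl B c a) b = scl B c (starB a b)" "starB a (scl B c b) = scl B c (starB a b)"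
proof -
  have K: "bilinear_form (scl B) (scl B) (conv2 B \<sigma> (\<lambda>u v. F (u * v)))" if "linear_form (scl B) F" for F
    by (rule conv2_bilinear[OF bil mult_form_bilinear[OF that]])
  show "starB (a + a') b = starB a b + starB a' b" "starB a (b + b') = starB a b + starB a b'"
    "starB (scl B c a) b = scl B c (starB a b)" "starB a (scl B c b) = scl B c (starB a b)"
    by (rule linear_form_eqI[OF vsB]; simp add: linear_starB linear_form_add[of "scl B"] linear_form_scale[of "scl B"]
        linear_form_add[OF bilinear_formD(1)[OF K]] linear_form_add[OF bilinear_formD(2)[OF K]]
        linear_form_scale[OF bilinear_formD(1)[OF K]] linear_form_scale[OF bilinear_formD(2)[OF K]])+
qed

lemma starB_diff: "starB (a - a') b = starB a b - starB a' b" "starB a (b - b') = starB a b - starB a b'"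
  using starB_linear(1)[of "a - a'" a' b] starB_linear(2)[of a "b - b'" b'] by (simp_all add: algebra_simps)

lemma p_append: "p (u @ v) = starB (p u) (p v)"
proof (rule linear_form_eqI[OF vsB])
  fix F
  assume F: "linear_form (scl B) F"
  let ?K = "conv2 B \<sigma> (\<lambda>u v. F (u * v))"
  have K: "bilinear_form (scl B) (scl B) ?K"
    by (rule conv2_bilinear[OF bil mult_form_bilinear[OF F]])
  have star: "W.star a b (\<lambda>w. F (X w)) = ?K (X a) (X b)" for a b
    by (simp add: conv2_word[OF bil mult_form_bilinear[OF F]] W.star_def word_conv2_def)
  have "F (p (u @ v)) = W.twisted u (\<lambda>a. W.twisted v (\<lambda>b. ?K (X a) (X b)))"
    by (simp add: linear_p[OF F] W.twisted_append star)
  also have "\<dots> = W.twisted u (\<lambda>a. ?K (X a) (p v))"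
    by (simp add: linear_p[OF bilinear_formD(2)[OF K]])
  also have "\<dots> = ?K (p u) (p v)"
    by (simp add: linear_p[OF bilinear_formD(1)[OF K]])
  finally show "F (p (u @ v)) = F (starB (p u) (p v))" by (simp add: linear_starB[OF F])
qed

lemma p_3: "p [i, j, k] = X [i, j, k] + scl B (W.\<phi> [i, j, k]) 1"
proof (rule linear_form_eqI[OF vsB])
  fix F
  assume F: "linear_form (scl B) F"
  have "F (p [i, j, k]) = F (X [i, j, k]) + W.\<phi> [i, j, k] * F 1"
    unfolding linear_p[OF F] W.twisted_eq_conv word_conv_def
    by (simp add: wsplit_Cons \<phi>_small)
  then show "F (p [i, j, k]) = F (X [i, j, k] + scl B (W.\<phi> [i, j, k]) 1)"
    by (simp add: linear_form_add[OF F] linear_form_scale[OF F])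
qed

lemma p_base:
  "p [One, One, One] = scl B l1 1" "p [Two, Two, Two] = scl B l2 1"
  "p [One, One, Two] + p [One, Two, One] + p [Two, One, One] = scl B l112 1"
  "p [One, Two, Two] + p [Two, One, Two] + p [Two, Two, One] = scl B l122 1"
  using N.y_cubes N.sum_112 N.sum_122 by (simp_all add: p_3 \<phi>_3 eps0_3 algebra_simps)

lemma F_small:
  assumes F: "linear_form (scl B) F"
  shows "F (x One * (x One * x One)) = 0" "F (x Two * (x Two * x Two)) = 0"
    "F (x Two * (x One * x One)) = - (F (x One * (x One * x Two)) + F (x One * (x Two * x One)))"
    "F (x Two * (x Two * x One)) = - (F (x One * (x Two * x Two)) + F (x Two * (x One * x Two)))"
proof -
  show "F (x One * (x One * x One)) = 0" "F (x Two * (x Two * x Two)) = 0"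
    using N.y_cubes by (simp_all add: linear_form_zero[OF F])
  have "F (x One * (x One * x Two)) + F (x One * (x Two * x One)) + F (x Two * (x One * x One)) = 0"
    "F (x One * (x Two * x Two)) + F (x Two * (x One * x Two)) + F (x Two * (x Two * x One)) = 0"
    using N.sum_112 N.sum_122 by (simp_all add: linear_form_zero[OF F] flip: linear_form_add[OF F])
  then show "F (x Two * (x One * x One)) = - (F (x One * (x One * x Two)) + F (x One * (x Two * x One)))"
    "F (x Two * (x Two * x One)) = - (F (x One * (x Two * x Two)) + F (x Two * (x One * x Two)))"
    by (simp_all only: minus_unique)
qed

text \<open>Only the component of bidegree \<open>(3, 3)\<close> of the coproduct of \<open>x\<^sub>1\<^sub>2\<^sup>3\<close> contributes, and its right legs
  vanish in \<open>B\<close>.\<close>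

lemma p_z: "p [One, Two, One, Two, One, Two]
       - scl B q (p [One, Two, One, Two, Two, One] + p [One, Two, Two, One, One, Two]
            + p [Two, One, One, Two, One, Two])
       + scl B (q\<^sup>2) (p [One, Two, Two, One, Two, One] + p [Two, One, One, Two, Two, One]
            + p [Two, One, Two, One, One, Two])
       - p [Two, One, Two, One, Two, One] = scl B l12 1" (is "?P = _")
proof (rule linear_form_eqI[OF vsB])
  fix F
  assume F: "linear_form (scl B) F"
  note lin = linear_form_add[OF F] linear_form_scale[OF F] linear_form_diff[OF F]
  define f where "f w = F (X w)" for w
  have f3: "f [One, One, One] = 0" "f [Two, Two, Two] = 0"
    "f [Two, One, One] = - (f [One, One, Two] + f [One, Two, One])"
    "f [Two, Two, One] = - (f [One, Two, Two] + f [Two, One, Two])"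
    by (simp_all add: f_def F_small[OF F])
  have Fp: "F (p [i, j, k, a, b, c]) = f [i, j, k, a, b, c] +
      wsplit [i, j, k, a, b, c] (\<lambda>u v. (if length u = 3 then W.\<phi> u else 0) * (if length v = 3 then f v else 0)) +
      W.\<phi> [i, j, k, a, b, c] * f []" for i j k a b c
    unfolding linear_p[OF F] W.twisted_eq_conv word_conv_def f_def[symmetric]
    by (simp add: wsplit_Cons \<phi>_small)
  have z0: "f [One, Two, One, Two, One, Two]
       - q * (f [One, Two, One, Two, Two, One] + f [One, Two, Two, One, One, Two]
            + f [Two, One, One, Two, One, Two])
       + q\<^sup>2 * (f [One, Two, Two, One, Two, One] + f [Two, One, One, Two, Two, One]
            + f [Two, One, Two, One, One, Two])
       - f [Two, One, Two, One, Two, One] = 0"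
    using word_relations_linear[OF F N.relations, unfolded word_relations_def, rule_format, of "[]" "[]"]
    by (simp add: f_def)
  have w0: "wsplit [One, Two, One, Two, One, Two] h
       - q * (wsplit [One, Two, One, Two, Two, One] h + wsplit [One, Two, Two, One, One, Two] h
            + wsplit [Two, One, One, Two, One, Two] h)
       + q\<^sup>2 * (wsplit [One, Two, Two, One, Two, One] h + wsplit [Two, One, One, Two, Two, One] h
            + wsplit [Two, One, Two, One, One, Two] h)
       - wsplit [Two, One, Two, One, Two, One] h = 0"
    if h: "h = (\<lambda>u v. (if length u = 3 then W.\<phi> u else 0) * (if length v = 3 then f v else 0))" for h
    unfolding h
    by (simp add: wsplit_Cons f3 \<phi>_3 eps0_3) (simp add: power2_eq_square algebra_simps q_square q_mult_left)
  have "F ?P = l12 * f []"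
  proof -
    have *: "\<And>f1 f2 f3 f4 f5 f6 f7 f8 w1 w2 w3 w4 w5 w6 w7 w8 g1 g2 g3 g4 g5 g6 g7 g8 e r r' l :: 'k.
      f1 - r * (f2 + f3 + f4) + r' * (f5 + f6 + f7) - f8 = 0 \<Longrightarrow>
      w1 - r * (w2 + w3 + w4) + r' * (w5 + w6 + w7) - w8 = 0 \<Longrightarrow>
      g1 - r * (g2 + g3 + g4) + r' * (g5 + g6 + g7) - g8 = l \<Longrightarrow>
      (f1 + w1 + g1 * e) - r * ((f2 + w2 + g2 * e) + (f3 + w3 + g3 * e) + (f4 + w4 + g4 * e))
      + r' * ((f5 + w5 + g5 * e) + (f6 + w6 + g6 * e) + (f7 + w7 + g7 * e)) - (f8 + w8 + g8 * e) = l * e"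
      by algebra
    show ?thesis unfolding lin Fp by (rule *[OF z0 w0[OF refl] \<phi>_z])
  qed
  then show "F ?P = F (scl B l12 1)" by (simp add: lin f_def)
qed

text \<open>Each relation between words a and b becomes a twisted product of p a, a scalar from
  \<open>p_base\<close> or \<open>p_z\<close>, and p b.\<close>

lemma p_relations: "word_relations (scl B) q l1 l2 l12 l112 l122 p"
proof -
  have eq: "p (a @ r @ b) = starB (p a) (starB (p r) (p b))" for a r b by (simp add: p_append)
  have 1: "starB (p a) (starB (scl B c 1) (p b)) = scl B c (p (a @ b))" for a b c
    using p_append[of "[]" b] by (simp add: starB_linear p_append)
  have lin: "starB u (starB a b) + starB u (starB a' b) = starB u (starB (a + a') b)"
    "starB u (starB a b) - starB u (starB a' b) = starB u (starB (a - a') b)"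
    "scl B c (starB u (starB a b)) = starB u (starB (scl B c a) b)" for u a a' b c
    by (simp_all add: starB_linear starB_diff)
  show ?thesis
    unfolding word_relations_def eq lin p_base p_z 1 by simp
qed

end

section \<open>Exponential cocycles\<close>

text \<open>Recovers the support of a convolution inverse from that of the unit and of the counit: a
  shortest word in a bad length with nonzero value would survive in the product.\<close>

lemma (in word_split) supp3_right_factor:
  assumes f: "supp3 f" "f [] \<noteq> 0" and h: "supp3 (word_conv f g)"
  shows "supp3 g"
  unfolding supp3_def
proof (intro allI impI)
  fix w
  show "g w \<noteq> 0 \<Longrightarrow> 3 dvd length w"
  proof (induction "length w" arbitrary: w rule: less_induct)
    case less
    show ?case
    proof (rule ccontr)
      assume nd: "\<not> 3 dvd length w"
      have "word_conv f g w = wsplit w (\<lambda>a b. (if a = [] then 1 else 0) * (f [] * g b))"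
        unfolding word_conv_def
      proof (rule wsplit_cong)
        fix a b :: "idx list"
        assume len: "length a + length b = length w"
        show "f a * g b = (if a = [] then 1 else 0) * (f [] * g b)"
        proof (cases "a = [] \<or> f a = 0")
          case False
          then have "3 dvd length a" "length a > 0"
            using f(1) by (auto simp: supp3_def)
          then have "3 dvd length a" "length b < length w" using len by linarith+
          then have "g b = 0" using less.hyps[of b] nd len by (metis dvd_add)
          then show ?thesis by simp
        qed auto
      qed
      then have "word_conv f g w = f [] * g w" by (simp only: wsplit_left_Nil)
      then show False using h nd less.prems f(2) by (auto simp: supp3_def)
    qed
  qed
qed

lemma Sum_any_finite: "finite A \<Longrightarrow> (\<And>k. k \<notin> A \<Longrightarrow> f k = 0) \<Longrightarrow> Sum_any f = sum f A"
  by (rule Sum_any.expand_superset) auto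

context nichols
begin

lemma unit2_bilinear: "bilinear_form (scl B) (scl B) (conv2_unit B)"
  unfolding conv2_unit_def by (rule bilinear_form_tensor[OF cou_linear cou_linear])

lemma unit2_word: "conv2_unit B (X u) (X v) = word_unit2 u v"
  by (simp add: conv2_unit_def word_unit2_def cou_word)

lemma conv2_pow_bilinear:
  "bilinear_form (scl B) (scl B) \<eta> \<Longrightarrow> bilinear_form (scl B) (scl B) (conv2_pow B \<eta> k)"
  by (induction k) (simp_all add: unit2_bilinear conv2_bilinear)

lemma conv2_pow_low:
  assumes \<eta>: "bilinear_form (scl B) (scl B) \<eta>"
    and low: "\<And>u v. \<eta> (X u) (X v) \<noteq> 0 \<Longrightarrow> n \<le> length u + length v"
  shows "length u + length v < n * k \<Longrightarrow> conv2_pow B \<eta> k (X u) (X v) = 0"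
proof (induction k arbitrary: u v)
  case (Suc k)
  have "conv2_pow B \<eta> (Suc k) (X u) (X v) =
      wsplit2 u v (\<lambda>a b c d. \<eta> (X a) (X b) * conv2_pow B \<eta> k (X c) (X d))"
    using conv2_word[OF \<eta> conv2_pow_bilinear[OF \<eta>]] by (simp add: word_conv2_def)
  also have "\<dots> = 0"
  proof (rule wsplit2_eq_0)
    fix a b c d :: "idx list"
    assume *: "length a + length c = length u" "length b + length d = length v"
    show "\<eta> (X a) (X b) * conv2_pow B \<eta> k (X c) (X d) = 0"
    proof (cases "\<eta> (X a) (X b) = 0")
      case False
      then have "length c + length d < n * k" using low[OF False] * Suc.prems by simp
      then show ?thesis using Suc.IH by simp
    qed simp
  qed
  finally show ?case .
qed simp

lemma conv2_pow_1: "bilinear_form (scl B) (scl B) \<eta> \<Longrightarrow> conv2_pow B \<eta> 1 = \<eta>"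
proof -
  assume \<eta>: "bilinear_form (scl B) (scl B) \<eta>"
  have "conv2 B \<eta> (conv2_unit B) (X u) (X v) = \<eta> (X u) (X v)" for u v
  proof -
    have "word_conv2 (\<lambda>u v. \<eta> (X u) (X v)) (\<lambda>u v. conv2_unit B (X u) (X v)) =
        word_conv2 (\<lambda>u v. \<eta> (X u) (X v)) word_unit2"
      unfolding unit2_word ..
    then show ?thesis by (simp add: conv2_word[OF \<eta> unit2_bilinear])
  qed
  then have "conv2 B \<eta> (conv2_unit B) = \<eta>"
    by (intro bilinear_form_eq_words conv2_bilinear unit2_bilinear \<eta>)
  then show ?thesis by simp
qed

lemma inverse_words:
  assumes "linear_form (scl B) \<alpha>" "conv_inverse B \<alpha> \<beta>"
  shows "word_conv (\<lambda>w. \<alpha> (X w)) (\<lambda>w. \<beta> (X w)) = word_unit" "word_conv (\<lambda>w. \<beta> (X w)) (\<lambda>w. \<alpha> (X w)) = word_unit"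
proof -
  have \<beta>: "linear_form (scl B) \<beta>" "conv B \<alpha> \<beta> = cou B" "conv B \<beta> \<alpha> = cou B"
    using assms(2) by (simp_all add: conv_inverse_def)
  show "word_conv (\<lambda>w. \<alpha> (X w)) (\<lambda>w. \<beta> (X w)) = word_unit" "word_conv (\<lambda>w. \<beta> (X w)) (\<lambda>w. \<alpha> (X w)) = word_unit"
    using conv_word[OF assms(1) \<beta>(1)] conv_word[OF \<beta>(1) assms(1)] \<beta> by (auto simp: cou_word)
qed

lemma gauge_eq:
  assumes "linear_form (scl B) \<alpha>" "conv_inverse B \<alpha> \<beta>"
  shows "gauge B \<alpha> \<sigma> = conv2 B (conv2 B (\<lambda>a b. \<alpha> a * \<alpha> b) \<sigma>) (\<lambda>a b. \<beta> (a * b))"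
  unfolding gauge_def conv_inverse_unique[OF coB assms] ..

lemma gauge_bilinear:
  assumes "linear_form (scl B) \<alpha>" "conv_inverse B \<alpha> \<beta>" "bilinear_form (scl B) (scl B) \<sigma>"
  shows "bilinear_form (scl B) (scl B) (gauge B \<alpha> \<sigma>)"
proof -
  have "linear_form (scl B) \<beta>" using assms(2) by (simp add: conv_inverse_def)
  then show ?thesis
    unfolding gauge_eq[OF assms(1,2)]
    by (intro conv2_bilinear bilinear_form_tensor mult_form_bilinear assms)
qed

lemma gauge_word:
  assumes "linear_form (scl B) \<alpha>" "conv_inverse B \<alpha> \<beta>" "bilinear_form (scl B) (scl B) \<sigma>"
  shows "gauge B \<alpha> \<sigma> (X u) (X v) = word_conv2 (word_conv2 (\<lambda>u v. \<alpha> (X u) * \<alpha> (X v)) (\<lambda>u v. \<sigma> (X u) (X v)))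
    (\<lambda>u v. \<beta> (X (u @ v))) u v"
proof -
  have \<beta>: "linear_form (scl B) \<beta>" using assms(2) by (simp add: conv_inverse_def)
  have bil: "bilinear_form (scl B) (scl B) (\<lambda>a b. \<alpha> a * \<alpha> b)"
    by (rule bilinear_form_tensor[OF assms(1) assms(1)])
  show ?thesis
    unfolding gauge_eq[OF assms(1,2)] conv2_word[OF conv2_bilinear[OF bil assms(3)] mult_form_bilinear[OF \<beta>]]
      conv2_word[OF bil assms(3)] by simp
qed

end

section \<open>From an exponential gauge to conditions on the parameters\<close>

context deformation
begin

lemma twisted_p: "linear_form (scl B) F \<Longrightarrow> F (p w) = word_conv W.\<phi> (\<lambda>a. F (X a)) w"
  by (simp add: linear_p W.twisted_eq_conv)

text \<open>The convolution \<psi> of \<phi> with the inverse \<beta> of the gauge is to the gauged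
  cocycle what \<phi> is to \<sigma>. It equals \<beta> (p w), so it inherits the deformed relations
  from p.\<close>

lemma exponential_imp_parameters:
  assumes "exponential_cocycle H B x \<sigma>"
  shows "(l112 = 0 \<and> l122 = 0 \<and> (l1 = 0 \<and> l2 = 0 \<or> l1 = 0 \<and> l12 = 0 \<or> l2 = 0 \<and> l12 = 0)) \<or>
   (l112 * l122 \<noteq> 0 \<and> l1 = 1 / 3 * (l112\<^sup>2 / l122) \<and> l2 = 1 / 3 * (l122\<^sup>2 / l112) \<and>
     l12 = 1 / 3 * (q\<^sup>2 - q) * l112 * l122)"
proof -
  obtain \<alpha> \<eta> where \<alpha>\<eta>: "\<alpha> \<in> H_linear_units H B" "\<eta> \<in> hochschild_2_cocycles H B x" "gauge B \<alpha> \<sigma> = conv2_exp B \<eta>"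
    using assms by (auto simp: exponential_cocycle_def)
  then obtain \<beta> where \<alpha>: "linear_form (scl B) \<alpha>" "\<And>h a. \<alpha> (act B h a) = cou H h * \<alpha> a"
    and inv: "conv_inverse B \<alpha> \<beta>"
    by (auto simp: H_linear_units_def)
  have \<beta>: "linear_form (scl B) \<beta>" using inv by (simp add: conv_inverse_def)
  have \<eta>: "bilinear_form (scl B) (scl B) \<eta>" "H_linear2 H B \<eta>" "\<And>a. \<eta> 1 a = 0" "\<And>a. \<eta> a 1 = 0"
    and hoch: "\<And>a b c. a \<in> positive_part (scl B) x \<Longrightarrow> c \<in> positive_part (scl B) x \<Longrightarrow> \<eta> a (b * c) = \<eta> (a * b) c"
    using \<alpha>\<eta>(2) by (auto simp: hochschild_2_cocycles_def H_linear2_def)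
  define \<alpha>w \<beta>w \<sigma>w \<eta>w where "\<alpha>w w = \<alpha> (X w)" and "\<beta>w w = \<beta> (X w)" and "\<sigma>w u v = \<sigma> (X u) (X v)"
    and "\<eta>w u v = \<eta> (X u) (X v)" for w u v
  have ab: "word_conv \<alpha>w \<beta>w = word_unit" "word_conv \<beta>w \<alpha>w = word_unit"
    using inverse_words[OF \<alpha>(1) inv] by (simp_all add: \<alpha>w_def[abs_def] \<beta>w_def[abs_def])
  have \<alpha>0: "\<alpha>w [] * \<beta>w [] = 1"
    using fun_cong[OF ab(1), of "[]"] by (simp add: word_conv_def word_unit_def)
  have supp_\<alpha>: "supp3 \<alpha>w" unfolding \<alpha>w_def[abs_def] by (rule H_linear_supp[OF \<alpha>])
  have "supp3 (word_conv \<alpha>w \<beta>w)" unfolding ab by (auto simp: supp3_def word_unit_def)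
  moreover have "\<alpha>w [] \<noteq> 0" using \<alpha>0 by auto
  ultimately have supp_\<beta>: "supp3 \<beta>w" using supp3_right_factor[OF supp_\<alpha>] by blast
  define G where "G = word_conv2 (word_conv2 (\<lambda>u v. \<alpha>w u * \<alpha>w v) \<sigma>w) (\<lambda>u v. \<beta>w (u @ v))"
  have \<eta>_low: "3 \<le> length u + length v" if "\<eta> (X u) (X v) \<noteq> 0" for u v
  proof -
    have "u \<noteq> []" using that \<eta>(3) by auto
    then show ?thesis using H_linear2_supp[OF \<eta>(2) that] by (simp add: dvd_imp_le)
  qed
  have G: "G u v = word_unit2 u v + \<eta>w u v + word_conv2 \<eta>w \<eta>w u v / 2 + word_conv2 \<eta>w (word_conv2 \<eta>w \<eta>w) u v / 6"
    if len: "length u + length v \<le> 9" for u v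
  proof -
    let ?P = "\<lambda>k. conv2_pow B \<eta> k (X u) (X v)"
    have "G u v = gauge B \<alpha> \<sigma> (X u) (X v)"
      by (simp add: gauge_word[OF \<alpha>(1) inv bil] G_def \<alpha>w_def[abs_def] \<beta>w_def[abs_def] \<sigma>w_def[abs_def])
    also have "\<dots> = Sum_any (\<lambda>k. ?P k / fact k)"
      unfolding \<alpha>\<eta>(3) conv2_exp_def ..
    \<comment> \<open>From k = 4 on the powers live in total length at least 12.\<close>
    also have "\<dots> = (\<Sum>k\<in>{..<4}. ?P k / fact k)"
    proof (rule Sum_any_finite)
      fix k :: nat
      assume "k \<notin> {..<4}"
      then have "length u + length v < 3 * k" using len by simp
      then show "?P k / fact k = 0" using conv2_pow_low[OF \<eta>(1) \<eta>_low] by simp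
    qed simp
    also have "\<dots> = ?P 0 + ?P 1 + ?P 2 / 2 + ?P 3 / 6"
      by (simp add: eval_nat_numeral lessThan_Suc)
    also have "?P 1 = \<eta>w u v" by (simp only: conv2_pow_1[OF \<eta>(1)] \<eta>w_def)
    also have P2: "conv2_pow B \<eta> 2 (X u) (X v) = word_conv2 \<eta>w \<eta>w u v" for u v
      using conv2_word[OF \<eta>(1) \<eta>(1), of u v] conv2_pow_1[OF \<eta>(1)]
      by (simp add: numeral_2_eq_2 \<eta>w_def[abs_def])
    have P3: "conv2_pow B \<eta> 3 (X u) (X v) = word_conv2 \<eta>w (word_conv2 \<eta>w \<eta>w) u v" for u v
    proof -
      have "conv2_pow B \<eta> 3 = conv2 B \<eta> (conv2_pow B \<eta> 2)" by (simp add: numeral_3_eq_3 numeral_2_eq_2)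
      then show ?thesis
        using conv2_word[OF \<eta>(1) conv2_pow_bilinear[OF \<eta>(1)], of 2 u v] by (simp add: P2 \<eta>w_def[abs_def])
    qed
    also have "?P 0 = word_unit2 u v" by (simp add: unit2_word)
    finally show ?thesis by (simp add: P2 P3)
  qed
  \<comment> \<open>At the empty words the gauged cocycle is \<alpha>(1)^2 \<beta>(1) = \<alpha>(1),
    while the exponential is 1.\<close>
  have "\<alpha>w [] = 1"
  proof -
    have "G [] [] = 1"
      using G[of "[]" "[]"] \<eta>(3) by (simp add: word_unit2_def word_unit_def \<eta>w_def word_conv2_def)
    moreover have "\<sigma>w [] [] = 1" using W.\<sigma>_Nil_left[of "[]"] by (simp add: \<sigma>w_def word_unit_def)
    ultimately have "\<alpha>w [] * (\<alpha>w [] * \<beta>w []) = 1" by (simp add: G_def word_conv2_def mult.assoc)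
    then show ?thesis using \<alpha>0 by simp
  qed
  then have \<beta>0: "\<beta>w [] = 1" using \<alpha>0 by simp
  define \<psi> where "\<psi> = word_conv W.\<phi> \<beta>w"
  have supp_\<psi>: "supp3 \<psi>" unfolding \<psi>_def by (rule supp3_word_conv[OF W.supp3_\<phi> supp_\<beta>])
  have \<psi>_append: "(\<lambda>u v. \<psi> (u @ v)) = word_conv2 (\<lambda>u v. \<psi> u * \<psi> v) G"
  proof -
    have 1: "(\<lambda>u v. \<psi> u * \<psi> v) = word_conv2 (\<lambda>u v. W.\<phi> u * W.\<phi> v) (\<lambda>u v. \<beta>w u * \<beta>w v)"
      by (simp add: word_conv2_tensor[OF W.supp3_\<phi>] \<psi>_def)
    have 2: "word_conv2 (\<lambda>u v. \<beta>w u * \<beta>w v) (\<lambda>u v. \<alpha>w u * \<alpha>w v) = word_unit2"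
      by (simp add: word_conv2_tensor[OF supp_\<beta>] ab word_unit2_def fun_eq_iff)
    have "word_conv2 (\<lambda>u v. \<psi> u * \<psi> v) G =
        word_conv2 (\<lambda>u v. W.\<phi> u * W.\<phi> v) (word_conv2 (word_conv2 (\<lambda>u v. \<beta>w u * \<beta>w v) (\<lambda>u v. \<alpha>w u * \<alpha>w v))
          (word_conv2 \<sigma>w (\<lambda>u v. \<beta>w (u @ v))))"
      unfolding 1 G_def by (simp only: word_conv2_assoc)
    also have "\<dots> = word_conv2 (word_conv2 (\<lambda>u v. W.\<phi> u * W.\<phi> v) \<sigma>w) (\<lambda>u v. \<beta>w (u @ v))"
      unfolding 2 by (simp add: word_conv2_assoc)
    also have "\<dots> = word_conv2 (\<lambda>u v. W.\<phi> (u @ v)) (\<lambda>u v. \<beta>w (u @ v))"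
      using W.\<phi>_append by (simp add: \<sigma>w_def[abs_def])
    also have "\<dots> = (\<lambda>u v. \<psi> (u @ v))" by (simp add: word_conv2_append \<psi>_def)
    finally show ?thesis by simp
  qed
  interpret X: word_exponential q \<psi> \<eta>w
  proof
    show "\<psi> [] = 1" by (simp add: \<psi>_def word_conv_def \<beta>0)
    show "supp3 \<psi>" by (rule supp_\<psi>)
    show "3 dvd length u + length v" if "\<eta>w u v \<noteq> 0" for u v
      using that H_linear2_supp[OF \<eta>(2)] by (simp add: \<eta>w_def)
    show "\<eta>w [] v = 0" "\<eta>w u [] = 0" for u v by (simp_all add: \<eta>w_def \<eta>)
    have pos: "X w \<in> positive_part (scl B) x" if "w \<noteq> []" for w
      unfolding positive_part_def using that by (intro vB.span_base) (auto simp: word_prod_def)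
    show "\<eta>w a (b @ c) = \<eta>w (a @ b) c" if "a \<noteq> []" "c \<noteq> []" for a b c
      using hoch[OF pos[OF that(1)] pos[OF that(2)]] by (simp add: \<eta>w_def)
    show "\<psi> (u @ v) = wsplit u (\<lambda>a c. wsplit v (\<lambda>b d. \<psi> a * \<psi> b * (word_unit2 c d + \<eta>w c d
            + word_conv2 \<eta>w \<eta>w c d / 2 + word_conv2 \<eta>w (word_conv2 \<eta>w \<eta>w) c d / 6)))"
      if "length u + length v \<le> 9" for u v
    proof -
      have "\<psi> (u @ v) = wsplit u (\<lambda>a c. wsplit v (\<lambda>b d. \<psi> a * \<psi> b * G c d))"
        using fun_cong[OF fun_cong[OF \<psi>_append]] by (simp add: word_conv2_tensor_left[OF supp_\<psi>])
      also have "\<dots> = wsplit u (\<lambda>a c. wsplit v (\<lambda>b d. \<psi> a * \<psi> b * (word_unit2 c d + \<eta>w c d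
            + word_conv2 \<eta>w \<eta>w c d / 2 + word_conv2 \<eta>w (word_conv2 \<eta>w \<eta>w) c d / 6)))"
        using that by (intro wsplit_cong) (simp add: G)
      finally show ?thesis .
    qed
  qed
  have "\<psi> = (\<lambda>w. \<beta> (p w))"
    by (simp add: fun_eq_iff twisted_p[OF \<beta>] \<psi>_def \<beta>w_def[abs_def])
  then have "word_relations (*) q l1 l2 l12 l112 l122 \<psi>"
    using word_relations_linear[OF \<beta> p_relations] by simp
  then show ?thesis by (rule X.exponential_parameters)
qed

end

section \<open>Construction of the exponential cocycles\<close>

lemma (in A2_algebra) lift:
  assumes "vector_space t" "word_relations t q l1 l2 l12 l112 l122 f"
  shows "\<exists>F. Vector_Spaces.linear s t F \<and> (\<forall>w. F (word_prod y w) = f w)"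
  using presented_lift[OF pres assms(1)] free_ext_A2_relations[OF assms(1) q_cube q_neq_1] assms(2) by blast

lemma sum_list_swap: "(\<Sum>a\<leftarrow>as. \<Sum>b\<leftarrow>bs. f a b :: 'm::comm_monoid_add) = (\<Sum>b\<leftarrow>bs. \<Sum>a\<leftarrow>as. f a b)"
  by (induction as) (simp_all add: sum_list_addf)

lemma linear_form_eq_on_span:
  assumes "linear_form s f" "linear_form s f'" "\<And>a. a \<in> S \<Longrightarrow> f a = f' a" "a \<in> module.span s S"
  shows "f a = f' a"
proof -
  interpret vector_space s by (rule linear_form_space[OF assms(1)])
  show ?thesis
    using assms(4)
  proof (induction rule: span_induct_alt)
    case base
    then show ?case by (simp add: linear_form_zero[OF assms(1)] linear_form_zero[OF assms(2)])
  next
    case (step c b d)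
    then show ?case
      using assms(3) by (auto simp: linear_form_add[OF assms(1)] linear_form_add[OF assms(2)]
          linear_form_scale[OF assms(1)] linear_form_scale[OF assms(2)])
  qed
qed

context nichols
begin

lemma X_long: "9 \<le> length w \<Longrightarrow> X w = 0"
proof -
  interpret N: A2_algebra q "scl B" x 0 0 0 0 0 by unfold_locales (rule presB)
  assume "9 \<le> length w"
  then show ?thesis using N.word_degree_part[of w] N.degree_part_long[of "length w"] by simp
qed

lemma conv_pow_linear: "linear_form (scl B) \<nu> \<Longrightarrow> linear_form (scl B) (conv_pow B \<nu> k)"
  by (induction k) (simp_all add: cou_linear conv_linear coB)

lemma conv_H_linear:
  assumes "linear_form (scl B) f" "\<And>h a. f (act B h a) = cou H h * f a"
    and "linear_form (scl B) f'" "\<And>h a. f' (act B h a) = cou H h * f' a"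
  shows "conv B f f' (act B h a) = cou H h * conv B f f' a"
proof -
  have "tensor_eq (scl B) (scl B) (cop B (act B h a)) [(act B h1 u, act B h2 v). (h1, h2) \<leftarrow> cop H h, (u, v) \<leftarrow> cop B a]"
    using ydc by (simp add: yd_coalgebra_def)
  from tensor_eqD[OF this bilinear_form_tensor[OF assms(1,3)]]
  have "conv B f f' (act B h a) = (\<Sum>(h1, h2)\<leftarrow>cop H h. \<Sum>(u, v)\<leftarrow>cop B a. f (act B h1 u) * f' (act B h2 v))"
    by (simp add: conv_def sum_list_concat_map case_prod_unfold o_def)
  also have "\<dots> = (\<Sum>(h1, h2)\<leftarrow>cop H h. (cou H h1 * cou H h2) * (\<Sum>(u, v)\<leftarrow>cop B a. f u * f' v))"
    unfolding assms(2,4) by (simp add: sum_list_const_mult[symmetric] case_prod_unfold mult_ac)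
  also have "\<dots> = conv H (cou H) (cou H) h * conv B f f' a"
    by (simp add: conv_def sum_list_mult_const case_prod_unfold)
  finally show ?thesis by (simp add: cop_counit[OF coH couH_linear])
qed

lemma conv_diff_left:
  "conv B (\<lambda>a. f a - f' a) e = (\<lambda>a. conv B f e a - conv B f' e a)"
  "conv B e (\<lambda>a. f a - f' a) = (\<lambda>a. conv B e f a - conv B e f' a)"
  by (simp_all add: conv_def case_prod_unfold left_diff_distrib right_diff_distrib sum_list_subtractf fun_eq_iff)

lemma conv_sum:
  "conv B e (\<lambda>a. \<Sum>k\<in>A. f k a) = (\<lambda>a. \<Sum>k\<in>A. conv B e (f k) a)"
  "conv B (\<lambda>a. \<Sum>k\<in>A. f k a) e = (\<lambda>a. \<Sum>k\<in>A. conv B (f k) e a)"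
  by (induction A rule: infinite_finite_induct)
    (simp_all add: conv_def case_prod_unfold distrib_left distrib_right sum_list_addf fun_eq_iff)

lemma linear_form_sum: "(\<And>k. linear_form (scl B) (f k)) \<Longrightarrow> linear_form (scl B) (\<lambda>a. \<Sum>k\<in>A. f k a)"
  by (induction A rule: infinite_finite_induct) (auto intro: linear_form_plus linear_formI simp: vsB)

text \<open>The geometric series of \<open>\<epsilon> - \<beta>\<close> is finite because words of length nine vanish.\<close>

lemma convolution_inverse:
  assumes \<beta>: "linear_form (scl B) \<beta>" "\<beta> 1 = 1" and HL: "\<And>h a. \<beta> (act B h a) = cou H h * \<beta> a"
  shows "\<exists>\<alpha> \<in> H_linear_units H B. conv_inverse B \<alpha> \<beta>"
proof -
  define \<nu> where "\<nu> a = cou B a - \<beta> a" for a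
  have \<nu>: "linear_form (scl B) \<nu>"
    unfolding \<nu>_def using \<beta>(1) cou_linear by (auto simp: Vector_Spaces.linear_iff algebra_simps)
  have \<nu>H: "\<nu> (act B h a) = cou H h * \<nu> a" for h a
    using ydc HL by (simp add: \<nu>_def yd_coalgebra_def algebra_simps)
  define P where "P k = conv_pow B \<nu> k" for k
  have P: "linear_form (scl B) (P k)" for k unfolding P_def by (rule conv_pow_linear[OF \<nu>])
  have PS: "P (Suc k) = conv B \<nu> (P k)" for k by (simp add: P_def)
  have PH: "P k (act B h a) = cou H h * P k a" for k h a
  proof (induction k arbitrary: h a)
    case 0
    then show ?case using ydc by (simp add: P_def yd_coalgebra_def)
  next
    case (Suc k)
    then show ?case unfolding PS by (rule conv_H_linear[OF \<nu> \<nu>H P])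
  qed
  have low: "P k (X w) = 0" if "length w < k" for k w
    using that
  proof (induction k arbitrary: w)
    case (Suc k)
    have "P (Suc k) (X w) = wsplit w (\<lambda>a b. \<nu> (X a) * P k (X b))"
      unfolding PS by (simp add: conv_word[OF \<nu> P] word_conv_def)
    also have "\<dots> = 0"
    proof (rule wsplit_eq_0)
      fix a b :: "idx list"
      assume *: "length a + length b = length w"
      show "\<nu> (X a) * P k (X b) = 0"
      proof (cases "a = []")
        case True
        then show ?thesis by (simp add: \<nu>_def cou_1 \<beta>(2))
      next
        case False
        then have "length b < k" using * Suc.prems by (cases a) auto
        then show ?thesis using Suc.IH by simp
      qed
    qed
    finally show ?case .
  qed simp
  have "P 9 = (\<lambda>a. 0)"
  proof (rule linear_form_eq_words[OF P])
    show "linear_form (scl B) (\<lambda>a. 0)" by (intro linear_formI) (simp_all add: vsB)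
    show "P 9 (X w) = 0" for w
      using low[of w 9] X_long[of w] linear_form_zero[OF P] by (cases "9 \<le> length w") auto
  qed
  then have P9: "P 9 a = 0" for a by simp
  have PR: "conv B (P k) \<nu> = P (Suc k)" for k
  proof (induction k)
    case 0
    then show ?case by (simp add: P_def cop_counit[OF coB \<nu>])
  next
    case (Suc k)
    then show ?case unfolding PS[of "Suc k"] using conv_assoc[OF coB \<nu> P \<nu>, of k] by (simp add: PS)
  qed
  define \<alpha> where "\<alpha> a = (\<Sum>k<9. P k a)" for a
  have \<alpha>: "linear_form (scl B) \<alpha>" unfolding \<alpha>_def by (rule linear_form_sum[OF P])
  have \<beta>\<nu>: "\<beta> = (\<lambda>a. cou B a - \<nu> a)" by (simp add: \<nu>_def)
  have tele: "(\<Sum>k<9. P k a) - (\<Sum>k<9. P (Suc k) a) = cou B a" for a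
    using sum_lessThan_telescope'[of "\<lambda>k. P k a" 9] P9 by (simp add: P_def sum_subtractf)
  have "conv B \<beta> \<alpha> = cou B"
    unfolding \<beta>\<nu> conv_diff_left cop_counit(1)[OF coB \<alpha>]
    unfolding \<alpha>_def conv_sum PS[symmetric] tele ..
  moreover have "conv B \<alpha> \<beta> = cou B"
    unfolding \<beta>\<nu> conv_diff_left cop_counit(2)[OF coB \<alpha>]
    unfolding \<alpha>_def conv_sum PR tele ..
  ultimately have inv: "conv_inverse B \<alpha> \<beta>" using \<beta>(1) by (simp add: conv_inverse_def)
  moreover have "\<alpha> (act B h a) = cou H h * \<alpha> a" for h a
    by (simp add: \<alpha>_def PH sum_distrib_left)
  ultimately show ?thesis using \<alpha> by (auto simp: H_linear_units_def)
qed

lemma chiw_append: "chiw (u @ v) = conv H (chiw u) (chiw v)"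
proof (induction u)
  case Nil
  then show ?case by (simp add: cop_counit[OF coH chiw_linear])
next
  case (Cons i u)
  then show ?case by (simp add: conv_assoc[OF coH chi_linear chiw_linear chiw_linear])
qed

lemma act_pair_word:
  assumes bil: "bilinear_form (scl B) (scl B) \<eta>"
  shows "(\<Sum>(h1, h2)\<leftarrow>cop H h. \<eta> (act B h1 (X u)) (act B h2 (X v))) = chiw (u @ v) h * \<eta> (X u) (X v)"
proof -
  have "\<eta> (act B h1 (X u)) (act B h2 (X v)) = chiw u h1 * chiw v h2 * \<eta> (X u) (X v)" for h1 h2
    unfolding act_word linear_form_scale[OF bilinear_formD(1)[OF bil]] linear_form_scale[OF bilinear_formD(2)[OF bil]]
    by (simp only: mult_ac)
  then show ?thesis by (simp only: chiw_append conv_def case_prod_unfold sum_list_mult_const)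
qed

lemma H_linear2I:
  assumes bil: "bilinear_form (scl B) (scl B) \<eta>"
    and chi: "\<And>u v. \<eta> (X u) (X v) \<noteq> 0 \<Longrightarrow> chiw (u @ v) = cou H"
  shows "H_linear2 H B \<eta>"
proof -
  have "(\<lambda>a b. \<Sum>(h1, h2)\<leftarrow>cop H h. \<eta> (act B h1 a) (act B h2 b)) = (\<lambda>a b. cou H h * \<eta> a b)" for h
  proof (rule bilinear_form_eq_words)
    show "bilinear_form (scl B) (scl B) (\<lambda>a b. \<Sum>(h1, h2)\<leftarrow>cop H h. \<eta> (act B h1 a) (act B h2 b))"
      unfolding case_prod_unfold
      by (intro bilinear_formI linear_form_sums vsB linear_form_comp[OF act_linear bilinear_formD(1)[OF bil]]
          linear_form_comp[OF act_linear bilinear_formD(2)[OF bil]])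
    show "bilinear_form (scl B) (scl B) (\<lambda>a b. cou H h * \<eta> a b)"
      by (intro bilinear_formI linear_form_mult_left bilinear_formD(1)[OF bil] bilinear_formD(2)[OF bil])
    fix u v
    show "(\<Sum>(h1, h2)\<leftarrow>cop H h. \<eta> (act B h1 (X u)) (act B h2 (X v))) = cou H h * \<eta> (X u) (X v)"
      unfolding act_pair_word[OF bil] using chi[of u v] by (cases "\<eta> (X u) (X v) = 0") auto
  qed
  then have "(\<Sum>(h1, h2)\<leftarrow>cop H h. \<eta> (act B h1 a) (act B h2 b)) = cou H h * \<eta> a b" for h a b
    by (meson fun_cong)
  then show ?thesis using bil by (simp add: H_linear2_def)
qed

lemma hochschildI:
  assumes bil: "bilinear_form (scl B) (scl B) \<eta>"
    and chi: "\<And>u v. \<eta> (X u) (X v) \<noteq> 0 \<Longrightarrow> chiw (u @ v) = cou H"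
    and Nil: "\<And>w. \<eta> 1 (X w) = 0" "\<And>w. \<eta> (X w) 1 = 0"
    and hoch: "\<And>a b c. a \<noteq> [] \<Longrightarrow> c \<noteq> [] \<Longrightarrow> \<eta> (X a) (X (b @ c)) = \<eta> (X (a @ b)) (X c)"
  shows "\<eta> \<in> hochschild_2_cocycles H B x"
proof -
  have zero: "linear_form (scl B) (\<lambda>a. 0)" by (intro linear_formI) (simp_all add: vsB)
  have l: "linear_form (scl B) (\<lambda>a. \<eta> a b)" "linear_form (scl B) (\<eta> a)"
    "linear_form (scl B) (\<lambda>a. \<eta> (a * c) b)" "linear_form (scl B) (\<lambda>a. \<eta> (c * a) b)"
    "linear_form (scl B) (\<lambda>a. \<eta> b (a * c))" "linear_form (scl B) (\<lambda>a. \<eta> b (c * a))" for a b c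
    using bilinear_formD(1)[OF bil] bilinear_formD(2)[OF bil] mult_form_bilinear[OF bilinear_formD(1)[OF bil], of b]
      mult_form_bilinear[OF bilinear_formD(2)[OF bil], of b]
    by (auto dest: bilinear_formD)
  have "\<eta> 1 = (\<lambda>a. 0)" "(\<lambda>a. \<eta> a 1) = (\<lambda>a. 0)"
    by (rule linear_form_eq_words[OF _ zero]; simp add: l Nil)+
  then have "\<eta> 1 a = 0" "\<eta> a 1 = 0" for a by (simp_all add: fun_eq_iff)
  moreover have "\<eta> a (b * c) = \<eta> (a * b) c"
    if "a \<in> positive_part (scl B) x" "c \<in> positive_part (scl B) x" for a b c
  proof -
    have 1: "\<eta> (X u) (X v * X w) = \<eta> (X u * X v) (X w)" if "u \<noteq> []" "w \<noteq> []" for u v w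
      using hoch[OF that] by simp
    have 2: "\<eta> (X u) (b * X w) = \<eta> (X u * b) (X w)" if "u \<noteq> []" "w \<noteq> []" for u w
      by (rule linear_form_eq_words[OF l(5) l(4), THEN fun_cong]) (rule 1[OF that])
    have 3: "\<eta> a (b * X w) = \<eta> (a * b) (X w)" if "w \<noteq> []" for w
      by (rule linear_form_eq_on_span[OF l(1) l(3) _ \<open>a \<in> _\<close>[unfolded positive_part_def]])
        (use 2[OF _ that] in \<open>auto simp: word_prod_def\<close>)
    show ?thesis
      by (rule linear_form_eq_on_span[OF l(6) l(2) _ \<open>c \<in> _\<close>[unfolded positive_part_def]])
        (use 3 in \<open>auto simp: word_prod_def\<close>)
  qed
  ultimately show ?thesis
    using H_linear2I[OF bil chi] by (auto simp: hochschild_2_cocycles_def)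
qed

end

context deformation
begin

text \<open>p w is X w plus a combination of shorter words, so values on all p w determine a
  functional by induction on the length.\<close>

lemma form_eq_p:
  assumes "linear_form (scl B) f" "linear_form (scl B) f'" "\<And>w. f (p w) = f' (p w)"
  shows "f = f'"
proof (rule linear_form_eq_words[OF assms(1,2)])
  fix w
  show "f (X w) = f' (X w)"
  proof (induction "length w" arbitrary: w rule: less_induct)
    case less
    have "0 = f (p w) - f' (p w)" using assms(3) by simp
    also have "\<dots> = wsplit w (\<lambda>a b. W.\<phi> a * (f (X b) - f' (X b)))"
      by (simp add: twisted_p[OF assms(1)] twisted_p[OF assms(2)] word_conv_def right_diff_distrib wsplit_diff)
    also have "\<dots> = wsplit w (\<lambda>a b. (if a = [] then 1 else 0) * (f (X b) - f' (X b)))"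
    proof (rule wsplit_cong)
      fix a b :: "idx list"
      assume *: "length a + length b = length w"
      show "W.\<phi> a * (f (X b) - f' (X b)) = (if a = [] then 1 else 0) * (f (X b) - f' (X b))"
      proof (cases "a = []")
        case False
        then have "length b < length w" using * by (cases a) auto
        then show ?thesis using less by simp
      qed simp
    qed
    also have "\<dots> = f (X w) - f' (X w)" by (rule wsplit_left_Nil)
    finally show ?case by simp
  qed
qed

text \<open>Twisting by the H-linear \<sigma> does not change the character of a word. In the
  summand with \<sigma>, coassociativity of H brings the two legs acting on the arguments of
  \<sigma> together.\<close>

lemma act_p: "act B h (p w) = scl B (chiw w h) (p w)"
proof (induction w arbitrary: h)
  case Nil
  show ?case using act_word[of h "[]"] by simp
next
  case (Cons i w)
  define T where "T F b = (\<Sum>(u, v)\<leftarrow>cop B b. \<sigma> (x i) u * F v)" for F :: "'b \<Rightarrow> 'k" and b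
  have bF: "bilinear_form (scl B) (scl B) (\<lambda>u v. \<sigma> (x i) u * F v)" if "linear_form (scl B) F" for F
    by (rule bilinear_form_tensor[OF bilinear_formD(2)[OF bil] that])
  have Tlin: "linear_form (scl B) (T F)" if "linear_form (scl B) F" for F
    unfolding T_def by (rule cop_linear[OF coB bF[OF that]])
  have Fp: "F (p (i # w)) = F (x i * p w) + T F (p w)" if F: "linear_form (scl B) F" for F
    by (simp add: p.simps(2) T_def linear_form_add[OF F] linear_form_sum_list[OF F] case_prod_unfold linear_form_scale[OF F])
  show ?case
  proof (rule linear_form_eqI[OF vsB])
    fix F
    assume F: "linear_form (scl B) F"
    have Fh: "linear_form (scl B) (\<lambda>a. F (act B h a))" for h by (rule linear_form_comp[OF act_linear F])
    have 1: "F (act B h (x i * p w)) = chiw (i # w) h * F (x i * p w)"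
    proof -
      have "act B h (x i * p w) = (\<Sum>(h1, h2)\<leftarrow>cop H h. act B h1 (x i) * act B h2 (p w))"
        using yda by (simp add: yd_algebra_def)
      then have "act B h (x i * p w) = scl B (chiw (i # w) h) (x i * p w)"
        by (simp add: Cons.IH act_x conv_def scl_sum_list case_prod_unfold mult.commute)
      then show ?thesis by (simp only: linear_form_scale[OF F])
    qed
    have 2: "T (\<lambda>a. F (act B h a)) (p w) = chiw (i # w) h * T F (p w)"
    proof -
      have cop_act: "T F (act B k a) = (\<Sum>(h1, h2)\<leftarrow>cop H k. \<Sum>(u, v)\<leftarrow>cop B a. \<sigma> (x i) (act B h1 u) * F (act B h2 v))" for k a
      proof -
        have "tensor_eq (scl B) (scl B) (cop B (act B k a))
            [(act B h1 u, act B h2 v). (h1, h2) \<leftarrow> cop H k, (u, v) \<leftarrow> cop B a]"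
          using ydc by (simp add: yd_coalgebra_def)
        from tensor_eqD[OF this bF[OF F]] show ?thesis
          by (simp add: T_def sum_list_concat_map case_prod_unfold o_def)
      qed
      have "chiw (i # w) h * T F (p w) = (\<Sum>(h1, h2)\<leftarrow>cop H h. chi i h1 * T F (act B h2 (p w)))"
        by (simp add: Cons.IH linear_form_scale[OF Tlin[OF F]] conv_def case_prod_unfold sum_list_mult_const
            flip: mult.assoc)
      also have "\<dots> = (\<Sum>(h1, h, k)\<leftarrow>cop3 H h. \<Sum>(u, v)\<leftarrow>cop B (p w). chi i h1 * \<sigma> (x i) (act B h u) * F (act B k v))"
        by (simp add: cop_act cop3_def sum_list_concat_map case_prod_unfold o_def sum_list_const_mult mult.assoc)
      also have "\<dots> = (\<Sum>(h1, h, k)\<leftarrow>[(u, v, w). (b, w) \<leftarrow> cop H h, (u, v) \<leftarrow> cop H b].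
          \<Sum>(u, v)\<leftarrow>cop B (p w). chi i h1 * \<sigma> (x i) (act B h u) * F (act B k v))"
      proof -
        have "trilinear_form (scl H) (scl H) (scl H)
            (\<lambda>h1 h k. \<Sum>(u, v)\<leftarrow>cop B (p w). chi i h1 * \<sigma> (x i) (act B h u) * F (act B k v))"
          unfolding trilinear_form_def case_prod_unfold
          by (intro conjI allI linear_form_sums vsH)
            (auto intro!: linear_form_mult_left linear_form_mult_right chi_linear
              linear_form_comp[OF act_linear2 bilinear_formD(2)[OF bil]] linear_form_comp[OF act_linear2 F])
        then show ?thesis using coH unfolding coalgebra_def tensor3_eq_def by metis
      qed
      also have "\<dots> = (\<Sum>(b, k)\<leftarrow>cop H h. \<Sum>(u, v)\<leftarrow>cop B (p w).
          (\<Sum>(h1, h2)\<leftarrow>cop H b. \<sigma> (act B h1 (x i)) (act B h2 u)) * F (act B k v))"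
        by (simp add: sum_list_concat_map case_prod_unfold o_def sum_list_mult_const[symmetric] act_x
            linear_form_scale[OF bilinear_formD(1)[OF bil]] sum_list_swap[of _ "cop B (p w)"])
      also have "\<dots> = (\<Sum>(b, k)\<leftarrow>cop H h. cou H b * (\<Sum>(u, v)\<leftarrow>cop B (p w). \<sigma> (x i) u * F (act B k v)))"
        using HL by (simp add: H_linear2_def case_prod_unfold sum_list_const_mult[symmetric] mult.assoc)
      also have "\<dots> = conv H (cou H) (\<lambda>k. T (\<lambda>a. F (act B k a)) (p w)) h"
        by (simp add: conv_def T_def)
      also have "\<dots> = T (\<lambda>a. F (act B h a)) (p w)"
      proof -
        have "linear_form (scl H) (\<lambda>k. T (\<lambda>a. F (act B k a)) (p w))"
          unfolding T_def case_prod_unfold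
          by (intro linear_form_sums vsH linear_form_mult_left linear_form_comp[OF act_linear2 F])
        from cop_counit(1)[OF coH this] show ?thesis by simp
      qed
      finally show ?thesis by simp
    qed
    show "F (act B h (p (i # w))) = F (scl B (chiw (i # w) h) (p (i # w)))"
      using Fp[OF Fh[of h]] Fp[OF F] 1 2 by (simp add: linear_form_scale[OF F] distrib_left)
  qed
qed

end

lemma (in word_split) weight_form_eq:
  "u \<noteq> [] \<Longrightarrow> v \<noteq> [] \<Longrightarrow> weight_form lin u v = (if length u + length v = 3 then weight lin (u @ v) else 0)"
proof -
  assume "u \<noteq> []" "v \<noteq> []"
  then have "length u > 0" "length v > 0" by auto
  then have "length u + length v = 3 \<longleftrightarrow> length u = 1 \<and> length v = 2 \<or> length u = 2 \<and> length v = 1" by linarith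
  then show ?thesis unfolding weight_form_def weight_len_def by auto
qed

lemma (in word_split) weight_form_Nil: "weight_form lin [] v = 0" "weight_form lin u [] = 0"
  by (simp_all add: weight_form_def weight_len_def)

lemma (in nichols) conv2_exp_eq:
  assumes \<eta>: "bilinear_form (scl B) (scl B) \<eta>" and cube: "conv2 B \<eta> (conv2 B \<eta> \<eta>) = (\<lambda>a b. 0)"
  shows "conv2_exp B \<eta> = (\<lambda>a b. conv2_unit B a b + \<eta> a b + conv2 B \<eta> \<eta> a b / 2)"
proof (intro ext)
  fix a b
  have 1: "conv2_pow B \<eta> (Suc 0) = \<eta>" using conv2_pow_1[OF \<eta>] by simp
  have zero: "conv2_pow B \<eta> k = (\<lambda>a b. 0)" if "3 \<le> k" for k
    using that
  proof (induction k rule: dec_induct)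
    case base
    have "conv2_pow B \<eta> 3 = conv2 B \<eta> (conv2 B \<eta> (conv2_pow B \<eta> (Suc 0)))"
      by (simp only: numeral_3_eq_3 conv2_pow.simps)
    then show ?case by (simp only: 1 cube)
  next
    case (step k)
    then show ?case by (simp add: conv2_def case_prod_unfold)
  qed
  have "conv2_exp B \<eta> a b = (\<Sum>k\<in>{..<3}. conv2_pow B \<eta> k a b / fact k)"
    unfolding conv2_exp_def by (rule Sum_any_finite) (simp_all add: zero)
  also have "\<dots> = conv2_unit B a b + conv2_pow B \<eta> (Suc 0) a b + conv2 B \<eta> (conv2_pow B \<eta> (Suc 0)) a b / 2"
    by (simp add: eval_nat_numeral lessThan_Suc)
  finally show "conv2_exp B \<eta> a b = conv2_unit B a b + \<eta> a b + conv2 B \<eta> \<eta> a b / 2" by (simp only: 1)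
qed

section \<open>Gauging to the cube of a linear form\<close>

context deformation
begin

lemma span_p: "vB.span (range p) = UNIV"
proof (rule ccontr)
  assume "vB.span (range p) \<noteq> UNIV"
  then obtain a where "a \<notin> vB.span (range p)" by auto
  then obtain f where f: "linear_form (scl B) f" "\<forall>b\<in>range p. f b = 0" "f a = 1"
    using linear_form_separates[OF vsB] by blast
  have "linear_form (scl B) (\<lambda>a. 0)" by (intro linear_formI) (simp_all add: vsB)
  then have "f = (\<lambda>a. 0)" using form_eq_p[OF f(1)] f(2) by simp
  then show False using f(3) by simp
qed

text \<open>The twisted algebra is a quotient of \<open>E\<close> of the same dimension 27, hence isomorphic to it.\<close>

lemma lift_p:
  assumes "word_relations (*) q l1 l2 l12 l112 l122 f"
  shows "\<exists>\<beta>. linear_form (scl B) \<beta> \<and> (\<forall>w. \<beta> (p w) = f w)"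
proof -
  obtain P where P: "Vector_Spaces.linear sE (scl B) P" "\<And>w. P (word_prod y w) = p w"
    using E.lift[OF vsB p_relations] by blast
  obtain T where T: "linear_form sE T" "\<And>w. T (word_prod y w) = f w"
    using E.lift[OF vector_space_mult assms] by blast
  interpret P: Vector_Spaces.linear sE "scl B" P by (rule P(1))
  have "surj P"
  proof -
    have "range p \<subseteq> range P" using P(2) by (metis image_subsetI rangeI)
    moreover have "vB.subspace (range P)" by (rule P.subspace_image[OF E.subspace_UNIV])
    ultimately have "vB.span (range p) \<subseteq> range P" by (rule vB.span_minimal)
    then show ?thesis using span_p by auto
  qed
  have basis: "inj_on E.Y pbw_exponents" "E.independent (E.Y ` pbw_exponents)" "E.span (E.Y ` pbw_exponents) = UNIV"
    "inj_on N.Y pbw_exponents" "vB.independent (N.Y ` pbw_exponents)" "vB.span (N.Y ` pbw_exponents) = UNIV"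
    using deformed pbwB by (simp_all add: deformed_algebra_def pbw_basis_def)
  have fin: "finite pbw_exponents" by (simp add: pbw_exponents_def)
  interpret FE: finite_dimensional_vector_space sE "E.Y ` pbw_exponents"
    by unfold_locales (simp_all add: basis fin)
  interpret FB: finite_dimensional_vector_space "scl B" "N.Y ` pbw_exponents"
    by unfold_locales (simp_all add: basis fin)
  interpret F: finite_dimensional_vector_space_pair sE "E.Y ` pbw_exponents" "scl B" "N.Y ` pbw_exponents" ..
  have "vB.dim UNIV = E.dim UNIV"
    unfolding FE.dim_UNIV FB.dim_UNIV by (simp only: card_image basis)
  from F.linear_surjective_isomorphism[OF P(1) \<open>surj P\<close> this]
  obtain P' where P': "Vector_Spaces.linear (scl B) sE P'" "\<And>a. P' (P a) = a" by blast
  have "linear_form (scl B) (\<lambda>a. T (P' a))" by (rule linear_form_comp[OF P'(1) T(1)])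
  moreover have "T (P' (p w)) = f w" for w using P'(2)[of "word_prod y w"] P(2) T(2) by simp
  ultimately show ?thesis by blast
qed

text \<open>The geometric series \<theta> satisfies the deformed relations, so \<theta> w = \<beta>
  (p w) for a functional \<beta> on B. Gauging by its inverse replaces \<phi> by \<theta>, whose
  coboundary is 1 + \<eta> with \<eta> of square zero.\<close>

lemma exponential_cube:
  assumes l: "l1 = lin One ^ 3" "l2 = lin Two ^ 3" "l12 = 3 * (q\<^sup>2 - q) * lin One ^ 3 * lin Two ^ 3"
      "l112 = 3 * (lin One)\<^sup>2 * lin Two" "l122 = 3 * lin One * (lin Two)\<^sup>2"
    and chi: "\<And>w. weight_mod lin 0 w \<noteq> 0 \<Longrightarrow> chiw w = cou H"
  shows "exponential_cocycle H B x \<sigma>"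
proof -
  let ?\<theta> = "weight_mod lin 0"
  have "word_relations (*) q l1 l2 l12 l112 l122 ?\<theta>"
    unfolding l by (rule weight_mod_relations)
  then obtain \<beta> where \<beta>: "linear_form (scl B) \<beta>" and \<beta>p: "\<And>w. \<beta> (p w) = ?\<theta> w"
    using lift_p by blast
  have "\<beta> 1 = 1" using \<beta>p[of "[]"] by (simp add: weight_mod_def)
  moreover have "\<beta> (act B h a) = cou H h * \<beta> a" for h a
  proof -
    have "(\<lambda>a. \<beta> (act B h a)) = (\<lambda>a. cou H h * \<beta> a)"
    proof (rule form_eq_p[OF linear_form_comp[OF act_linear \<beta>] linear_form_mult_left[OF \<beta>]])
      fix w
      show "\<beta> (act B h (p w)) = cou H h * \<beta> (p w)"
        unfolding act_p linear_form_scale[OF \<beta>] \<beta>p using chi[of w] by (cases "?\<theta> w = 0") auto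
    qed
    then show ?thesis by (rule fun_cong)
  qed
  ultimately obtain \<alpha> where "\<alpha> \<in> H_linear_units H B" and inv: "conv_inverse B \<alpha> \<beta>"
    using convolution_inverse[OF \<beta>] by blast
  then have \<alpha>: "linear_form (scl B) \<alpha>" "\<And>h a. \<alpha> (act B h a) = cou H h * \<alpha> a"
    by (auto simp: H_linear_units_def)
  \<comment> \<open>The relations start in degree three, so the first two powers of the linear form
    descend to B.\<close>
  have rel: "word_relations (*) q 0 0 0 0 0 (weight_len lin n)" if "n < 3" for n
    using that by (simp add: word_relations_def weight_len_def)
  obtain L1 L2 where L: "linear_form (scl B) L1" "linear_form (scl B) L2"
    and L1: "\<And>w. L1 (X w) = weight_len lin 1 w" and L2: "\<And>w. L2 (X w) = weight_len lin 2 w"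
    using N.lift[OF vector_space_mult rel[of 1]] N.lift[OF vector_space_mult rel[of 2]] by auto
  define \<eta> where "\<eta> a b = L1 a * L2 b + L2 a * L1 b" for a b
  have \<eta>: "bilinear_form (scl B) (scl B) \<eta>"
    unfolding \<eta>_def by (intro bilinear_formI linear_form_plus linear_form_mult_left linear_form_mult_right L)
  have \<eta>w: "\<eta> (X u) (X v) = weight_form lin u v" for u v
    by (simp add: \<eta>_def weight_form_def L1 L2)
  have hoch: "\<eta> \<in> hochschild_2_cocycles H B x"
  proof (rule hochschildI[OF \<eta>])
    fix u v
    assume "\<eta> (X u) (X v) \<noteq> 0"
    then have "weight_form lin u v \<noteq> 0" by (simp add: \<eta>w)
    then have "?\<theta> (u @ v) \<noteq> 0"
      by (cases "u = []"; cases "v = []") (auto simp: weight_form_Nil weight_form_eq weight_mod_def split: if_splits)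
    then show "chiw (u @ v) = cou H" by (rule chi)
  next
    show "\<eta> 1 (X w) = 0" "\<eta> (X w) 1 = 0" for w
      using \<eta>w[of "[]" w] \<eta>w[of w "[]"] by (simp_all add: weight_form_Nil)
    show "\<eta> (X a) (X (b @ c)) = \<eta> (X (a @ b)) (X c)" if "a \<noteq> []" "c \<noteq> []" for a b c
      unfolding \<eta>w using that by (simp add: weight_form_eq add.assoc mult.assoc)
  qed
  have "conv2 B \<eta> \<eta> = (\<lambda>a b. 0)"
  proof (rule bilinear_form_eq_words[OF conv2_bilinear[OF \<eta> \<eta>]])
    show "bilinear_form (scl B) (scl B) (\<lambda>a b. 0)"
      by (intro bilinear_formI linear_formI) (simp_all add: vsB)
    show "conv2 B \<eta> \<eta> (X u) (X v) = 0" for u v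
      unfolding conv2_word[OF \<eta> \<eta>] \<eta>w by (rule weight_form_square)
  qed
  moreover from this have "conv2 B \<eta> (conv2 B \<eta> \<eta>) = (\<lambda>a b. 0)"
    by (simp add: conv2_def[of B \<eta> "\<lambda>a b. 0"] case_prod_unfold)
  ultimately have exp: "conv2_exp B \<eta> = (\<lambda>a b. conv2_unit B a b + \<eta> a b)"
    using conv2_exp_eq[OF \<eta>] by simp
  have "gauge B \<alpha> \<sigma> = (\<lambda>a b. conv2_unit B a b + \<eta> a b)"
  proof (rule bilinear_form_eq_words[OF gauge_bilinear[OF \<alpha>(1) inv bil]])
    show "bilinear_form (scl B) (scl B) (\<lambda>a b. conv2_unit B a b + \<eta> a b)"
      by (intro bilinear_formI linear_form_plus bilinear_formD[OF \<eta>] bilinear_formD[OF unit2_bilinear])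
    fix u v
    define \<alpha>w \<beta>w \<sigma>w where "\<alpha>w w = \<alpha> (X w)" and "\<beta>w w = \<beta> (X w)" and "\<sigma>w u v = \<sigma> (X u) (X v)" for w u v
    define K where "K u v = word_unit2 u v + weight_form lin u v" for u v
    have ab: "word_conv \<alpha>w \<beta>w = word_unit"
      using inverse_words[OF \<alpha>(1) inv] by (simp add: \<alpha>w_def[abs_def] \<beta>w_def[abs_def])
    have \<theta>: "?\<theta> = word_conv W.\<phi> \<beta>w"
      using \<beta>p by (simp add: fun_eq_iff twisted_p[OF \<beta>] \<beta>w_def[abs_def])
    have "word_conv2 (\<lambda>u v. W.\<phi> u * W.\<phi> v) (word_conv2 \<sigma>w (\<lambda>u v. \<beta>w (u @ v))) =
        word_conv2 (\<lambda>u v. W.\<phi> (u @ v)) (\<lambda>u v. \<beta>w (u @ v))"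
      using W.\<phi>_append by (simp add: \<sigma>w_def[abs_def] word_conv2_assoc[symmetric])
    also have "\<dots> = (\<lambda>u v. ?\<theta> (u @ v))" by (simp add: word_conv2_append \<theta>)
    also have "\<dots> = word_conv2 (\<lambda>u v. ?\<theta> u * ?\<theta> v) K"
      unfolding K_def by (rule weight_mod_coboundary)
    also have "\<dots> = word_conv2 (\<lambda>u v. W.\<phi> u * W.\<phi> v) (word_conv2 (\<lambda>u v. \<beta>w u * \<beta>w v) K)"
      by (simp add: \<theta> word_conv2_tensor[OF W.supp3_\<phi>, symmetric] word_conv2_assoc)
    finally have "word_conv2 \<sigma>w (\<lambda>u v. \<beta>w (u @ v)) u v = word_conv2 (\<lambda>u v. \<beta>w u * \<beta>w v) K u v" for u v
      by (rule word_conv2_left_cancel[rotated]) simp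
    then have 1: "word_conv2 \<sigma>w (\<lambda>u v. \<beta>w (u @ v)) = word_conv2 (\<lambda>u v. \<beta>w u * \<beta>w v) K" by (intro ext)
    have supp: "supp3 \<alpha>w" unfolding \<alpha>w_def[abs_def] by (rule H_linear_supp[OF \<alpha>])
    have 2: "word_conv2 (\<lambda>u v. \<alpha>w u * \<alpha>w v) (\<lambda>u v. \<beta>w u * \<beta>w v) = word_unit2"
      by (simp add: word_conv2_tensor[OF supp] ab word_unit2_def fun_eq_iff)
    have "gauge B \<alpha> \<sigma> (X u) (X v) = word_conv2 (word_conv2 (\<lambda>u v. \<alpha>w u * \<alpha>w v) \<sigma>w) (\<lambda>u v. \<beta>w (u @ v)) u v"
      by (simp only: gauge_word[OF \<alpha>(1) inv bil] \<alpha>w_def \<beta>w_def \<sigma>w_def[abs_def])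
    also have "\<dots> = word_conv2 (word_conv2 (\<lambda>u v. \<alpha>w u * \<alpha>w v) (\<lambda>u v. \<beta>w u * \<beta>w v)) K u v"
      by (simp only: word_conv2_assoc 1)
    finally show "gauge B \<alpha> \<sigma> (X u) (X v) = conv2_unit B (X u) (X v) + \<eta> (X u) (X v)"
      by (simp add: 2 K_def unit2_word \<eta>w)
  qed
  then have "gauge B \<alpha> \<sigma> = conv2_exp B \<eta>" by (simp only: exp)
  with \<open>\<alpha> \<in> H_linear_units H B\<close> hoch show ?thesis unfolding exponential_cocycle_def by blast
qed

end

text \<open>On words beginning with One and ending with Two the relations of degree three express f
  through its value at 112122, and the relation of degree six makes this value l.\<close>

lemma (in word_split) z_form_unique:
  assumes rel: "word_relations (*) q 0 0 l 0 0 f" and Nil: "f [] = 1"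
    and Two: "\<And>w. f (Two # w) = 0" and One: "\<And>w. f (w @ [One]) = 0" and len: "length w = 6"
  shows "f w = z_form l w"
proof -
  have r: "f (a @ [One, One, One] @ b) = 0" "f (a @ [Two, Two, Two] @ b) = 0"
    "f (a @ [One, One, Two] @ b) + f (a @ [One, Two, One] @ b) + f (a @ [Two, One, One] @ b) = 0"
    "f (a @ [One, Two, Two] @ b) + f (a @ [Two, One, Two] @ b) + f (a @ [Two, Two, One] @ b) = 0" for a b
    using rel by (simp_all add: word_relations_def)
  have 111: "f [One, One, One, i, j, k] = 0" "f [i, One, One, One, j, k] = 0" "f [i, j, One, One, One, k] = 0" for i j k
    using r(1)[of "[]" "[i, j, k]"] r(1)[of "[i]" "[j, k]"] r(1)[of "[i, j]" "[k]"] by simp_all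
  have 222: "f [i, Two, Two, Two, j, k] = 0" "f [i, j, Two, Two, Two, k] = 0" "f [i, j, k, Two, Two, Two] = 0" for i j k
    using r(2)[of "[i, j, k]" "[]"] r(2)[of "[i]" "[j, k]"] r(2)[of "[i, j]" "[k]"] by simp_all
  have end1: "f [i, j, k, a, b, One] = 0" for i j k a b
    using One[of "[i, j, k, a, b]"] by simp
  note zero = 111 222 end1 Two
  have "f [One, One, Two, One, One, Two] = 0"
    using r(3)[of "[One]" "[One, Two]"] by (simp add: zero)
  moreover have "f [One, Two, Two, One, Two, Two] = 0"
    using r(4)[of "[One, Two]" "[Two]"] by (simp add: zero)
  moreover have a: "f [One, Two, One, One, Two, Two] = - f [One, One, Two, One, Two, Two]"
    using r(3)[of "[One]" "[Two, Two]"] by (simp add: zero add_eq_0_iff)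
  moreover have b: "f [One, One, Two, Two, One, Two] = - f [One, One, Two, One, Two, Two]"
    using r(4)[of "[One, One]" "[Two]"] by (simp add: zero add_eq_0_iff)
  moreover have c: "f [One, Two, One, Two, One, Two] = f [One, One, Two, One, Two, Two]"
    using r(3)[of "[]" "[Two, One, Two]"] by (simp add: zero b)
  moreover have d: "f [One, Two, Two, One, One, Two] = 0"
    using r(4)[of "[One]" "[One, Two]"] by (simp add: zero b c)
  moreover have "f [One, One, Two, One, Two, Two] = l"
    using rel[unfolded word_relations_def, rule_format, of "[]" "[]"] by (simp add: zero c d Nil)
  moreover obtain a b c d e g where "w = [a, b, c, d, e, g]"
    using len by (auto simp: numeral_eq_Suc length_Suc_conv)
  ultimately show ?thesis
    unfolding z_form_def
    by (cases a; cases b; cases c; cases d; cases e; cases g; simp add: zero)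
qed

section \<open>The case of \<lambda>12 alone\<close>

context deformation
begin

lemma \<phi>_relations: "word_relations (*) q l1 l2 l12 l112 l122 W.\<phi>"
proof -
  have "cou B (p w) = W.\<phi> w" for w by (simp add: twisted_p[OF cou_linear] cou_word)
  then show ?thesis using word_relations_linear[OF cou_linear p_relations] by simp
qed

lemma homogeneous_projection:
  "\<exists>\<pi>. Vector_Spaces.linear (scl B) (scl B) \<pi> \<and> (\<forall>w. \<pi> (X w) = (if length w = n then X w else 0))"
proof (rule N.lift[OF vsB])
  have len: "length (a @ [i, j, k] @ b) = length a + length b + 3"
    "length (a @ [i, j, k, i', j', k'] @ b) = length a + length b + 6" for a b :: "idx list" and i j k i' j' k'
    by simp_all
  show "word_relations (scl B) q 0 0 0 0 0 (\<lambda>w. if length w = n then X w else 0)"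
    using N.relations unfolding word_relations_def len by (simp del: word_prod_simps)
qed

context
  assumes zero: "l1 = 0" "l2 = 0" "l112 = 0" "l122 = 0"
begin

text \<open>Every correction term of the section contains l1 or l112.\<close>

lemma \<gamma>_Y: "n \<in> pbw_exponents \<Longrightarrow> \<gamma> (N.Y n) = E.Y n"
  using section_\<gamma> unfolding is_section_def Let_def zero
  by (cases "n \<in> {(0,2,0), (0,2,1), (0,1,2), (1,2,0), (1,1,2), (1,2,1), (0,2,2), (1,2,2)}") auto

lemma linear_form_eq_0:
  assumes "linear_form (scl B) f" "\<And>n. n \<in> pbw_exponents \<Longrightarrow> f (N.Y n) = 0"
  shows "f a = 0"
proof -
  have "vB.span (N.Y ` pbw_exponents) = UNIV" using pbwB by (simp add: pbw_basis_def)
  then have mem: "a \<in> vB.span (N.Y ` pbw_exponents)" by simp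
  have z: "linear_form (scl B) (\<lambda>a. 0)" by (intro linear_formI) (simp_all add: vsB)
  show ?thesis
    by (rule linear_form_eq_on_span[OF assms(1) z _ mem]) (use assms(2) in blast)
qed

text \<open>Left multiplication by y2 sends a PBW monomial to a nonconstant one or, as l2 = 0, to 0.
  Together with the mirror statement for y1 this gives the boundary conditions of
  \<open>z_form_unique\<close>.\<close>

lemma eps0_y2: "eps0 (y Two * \<gamma> a) = 0"
proof (rule linear_form_eq_0)
  show "linear_form (scl B) (\<lambda>a. eps0 (y Two * \<gamma> a))"
    by (rule linear_formI[OF vsB]) (simp_all add: \<gamma>_add \<gamma>_scale distrib_left eps0_lin)
  fix n
  assume n: "n \<in> pbw_exponents"
  obtain a b c where abc: "n = (a, b, c)" by (cases n)
  show "eps0 (y Two * \<gamma> (N.Y n)) = 0"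
  proof (cases "a = 2")
    case True
    then show ?thesis unfolding \<gamma>_Y[OF n]
      by (simp add: abc pbw_def power2_eq_square mult.assoc E.cube_left zero eps0_lin)
  next
    case False
    then have "(Suc a, b, c) \<in> pbw_exponents" using n by (simp add: abc pbw_exponents_def)
    moreover have "y Two * E.Y n = E.Y (Suc a, b, c)" by (simp add: abc pbw_def mult.assoc)
    ultimately show ?thesis unfolding \<gamma>_Y[OF n] using eps0_pbw[of "(Suc a, b, c)"] by simp
  qed
qed

lemma eps0_y1: "eps0 (\<gamma> a * y One) = 0"
proof (rule linear_form_eq_0)
  show "linear_form (scl B) (\<lambda>a. eps0 (\<gamma> a * y One))"
    by (rule linear_formI[OF vsB]) (simp_all add: \<gamma>_add \<gamma>_scale distrib_right eps0_lin)
  fix n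
  assume n: "n \<in> pbw_exponents"
  obtain a b c where abc: "n = (a, b, c)" by (cases n)
  show "eps0 (\<gamma> (N.Y n) * y One) = 0"
  proof (cases "c = 2")
    case True
    then show ?thesis unfolding \<gamma>_Y[OF n]
      by (simp add: abc pbw_def power2_eq_square mult.assoc E.y_cubes zero eps0_lin)
  next
    case False
    then have "(a, b, Suc c) \<in> pbw_exponents" using n by (simp add: abc pbw_exponents_def)
    moreover have "E.Y n * y One = E.Y (a, b, Suc c)" by (simp add: abc pbw_def mult.assoc power_Suc2 del: power_Suc)
    ultimately show ?thesis unfolding \<gamma>_Y[OF n] using eps0_pbw[of "(a, b, Suc c)"] by simp
  qed
qed

lemma \<sigma>_x2: "\<sigma> (x Two) a = 0" and \<sigma>_x1: "\<sigma> a (x One) = 0"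
  by (simp_all add: \<sigma>_def \<gamma>_small eps0_y1 eps0_y2)

lemma \<phi>_z_form: "length w = 6 \<Longrightarrow> W.\<phi> w = z_form l12 w"
proof (rule z_form_unique)
  show "word_relations (*) q 0 0 l12 0 0 W.\<phi>" using \<phi>_relations unfolding zero .
  show "W.\<phi> (Two # w) = 0" for w
    by (simp add: W.\<phi>_Cons \<sigma>_x2)
  show "W.\<phi> (w @ [One]) = 0" for w
    by (simp add: W.\<phi>_append_wsplit wsplit_Cons \<phi>_small \<sigma>_x1)
qed simp_all

lemma word_cocycle_z: "word_cocycle_z q (\<lambda>u v. \<sigma> (X u) (X v)) l12"
proof unfold_locales
  fix u v w :: "idx list" and i
  show "\<sigma> (X u) (X v) = 0" if len: "length u + length v = 3"
  proof -
    have s12: "\<sigma> (x i) (x j * x k) = 0" for i j k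
      by (cases i; cases j; cases k; simp add: \<sigma>_def \<gamma>_small eps0_3 zero)
    have s21: "\<sigma> (x i * x j) (x k) = 0" for i j k
      by (cases i; cases j; cases k; simp add: \<sigma>_21 \<phi>_3 eps0_3 zero)
    have "length u = 0 \<or> length v = 0 \<or> length u = 1 \<and> length v = 2 \<or> length u = 2 \<and> length v = 1"
      using len by linarith
    then consider "u = []" | "v = []" | i j k where "u = [i]" "v = [j, k]" | i j k where "u = [i, j]" "v = [k]"
      by (auto simp: numeral_eq_Suc length_Suc_conv)
    then show ?thesis
      using len W.\<sigma>_Nil_left[of v] W.\<sigma>_Nil_right[of u]
      by cases (auto simp: word_unit_def s12 s21)
  qed
  show "\<sigma> (X u) (X v) = 0" if "9 \<le> length v"
    using X_long[OF that] by (simp add: \<sigma>_lin)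
  show "\<sigma> (X [i]) (X w) = 0" if "length w = 8"
  proof (cases i)
    case Two
    then show ?thesis by (simp add: \<sigma>_x2)
  next
    case One
    have mem: "X w \<in> vB.span {N.Y (2, 2, 2)}"
      using N.word_degree_part[of w] that by (simp add: N.degree_part_8)
    have z: "linear_form (scl B) (\<lambda>a. 0)" by (intro linear_formI) (simp_all add: vsB)
    \<comment> \<open>Degree eight of B is the line through this monomial, so a single straightening
      in E decides.\<close>
    have 222: "\<sigma> (x One) (N.Y (2, 2, 2)) = 0"
    proof -
      have "(2, 2, 2) \<in> pbw_exponents" by (simp add: pbw_exponents_def)
      then have "\<sigma> (x One) (N.Y (2, 2, 2)) = eps0 (y One * E.Y (2, 2, 2))" by (simp add: \<sigma>_def \<gamma>_small \<gamma>_Y)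
      also have "\<dots> = 0"
        by (simp add: pbw_def power2_eq_square mult.assoc E.y1_y2_left E.z_y2_left E.y1_z_left E.cube_left
            E.y_cubes zero distrib_left eps0_lin eps0_small)
      finally show ?thesis .
    qed
    have "\<sigma> (x One) (X w) = 0"
      by (rule linear_form_eq_on_span[OF bilinear_formD(2)[OF bil] z _ mem]) (use 222 in blast)
    then show ?thesis by (simp add: One)
  qed
  show "W.\<phi> w = z_form l12 w" if "length w = 6" by (rule \<phi>_z_form[OF that])
qed

text \<open>The gauge is the counit. Words of length nine vanish in B, so \<sigma> and the
  exponential are compared on words of length at most eight, where \<open>\<sigma>_exp\<close>
  applies and the third power of \<eta>, of total length 18, is zero.\<close>

lemma exponential_z: "exponential_cocycle H B x \<sigma>"
proof -
  interpret Z: word_cocycle_z q "\<lambda>u v. \<sigma> (X u) (X v)" l12 by (rule word_cocycle_z)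
  obtain \<pi> where \<pi>: "\<And>n. Vector_Spaces.linear (scl B) (scl B) (\<pi> n)"
    and \<pi>_word: "\<And>n w. \<pi> n (X w) = (if length w = n then X w else 0)"
    using homogeneous_projection by metis
  \<comment> \<open>The part of \<sigma> of total degree six, cut out by homogeneous projections so
    that it is bilinear on B.\<close>
  define \<eta> where "\<eta> a b = (\<Sum>i\<le>6. \<sigma> (\<pi> i a) (\<pi> (6 - i) b))" for a b
  have \<eta>: "bilinear_form (scl B) (scl B) \<eta>"
    unfolding \<eta>_def
    by (intro bilinear_formI linear_form_sum linear_form_comp[OF \<pi> bilinear_formD(1)[OF bil]]
        linear_form_comp[OF \<pi> bilinear_formD(2)[OF bil]])
  have \<eta>w: "\<eta> (X u) (X v) = Z.\<eta> u v" for u v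
  proof -
    have "\<eta> (X u) (X v) = (\<Sum>i\<le>6. if i = length u then (if length v = 6 - i then \<sigma> (X u) (X v) else 0) else 0)"
      unfolding \<eta>_def by (intro sum.cong refl) (simp add: \<pi>_word \<sigma>_lin)
    also have "\<dots> = (if length u \<le> 6 \<and> length v = 6 - length u then \<sigma> (X u) (X v) else 0)"
      by (simp add: sum.delta)
    finally show ?thesis by (auto simp: Z.\<eta>_def)
  qed
  have Nil: "Z.\<eta> [] w = 0" "Z.\<eta> w [] = 0" for w
    by (simp_all add: Z.\<eta>_def W.\<sigma>_Nil_left[simplified] W.\<sigma>_Nil_right[simplified] word_unit_def)
  have hoch: "\<eta> \<in> hochschild_2_cocycles H B x"
  proof (rule hochschildI[OF \<eta>])
    fix u v
    assume "\<eta> (X u) (X v) \<noteq> 0"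
    then have nz: "\<sigma> (X u) (X v) \<noteq> 0" by (auto simp: \<eta>w Z.\<eta>_def split: if_splits)
    have "chiw (u @ v) h * \<sigma> (X u) (X v) = cou H h * \<sigma> (X u) (X v)" for h
      using HL act_pair_word[OF bil, of u v h] by (auto simp: H_linear2_def)
    then show "chiw (u @ v) = cou H" using nz by auto
  next
    show "\<eta> 1 (X w) = 0" "\<eta> (X w) 1 = 0" for w
      using \<eta>w[of "[]" w] \<eta>w[of w "[]"] by (simp_all add: Nil)
    show "\<eta> (X a) (X (b @ c)) = \<eta> (X (a @ b)) (X c)" if "a \<noteq> []" "c \<noteq> []" for a b c
      unfolding \<eta>w using Z.z_form_append[of a "b @ c"] Z.z_form_append[of "a @ b" c] that
      by (simp add: word_unit_def)
  qed
  have \<eta>2: "conv2 B \<eta> \<eta> (X u) (X v) = word_conv2 Z.\<eta> Z.\<eta> u v" for u v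
    unfolding conv2_word[OF \<eta> \<eta>] \<eta>w ..
  have long: "s (X u) (X v) = 0" if "bilinear_form (scl B) (scl B) s" "\<not> (length u \<le> 8 \<and> length v \<le> 8)" for s u v
  proof -
    have "X u = 0 \<or> X v = 0" using X_long[of u] X_long[of v] that(2) by linarith
    then show ?thesis
      using linear_form_zero[OF bilinear_formD(1)[OF that(1)]] linear_form_zero[OF bilinear_formD(2)[OF that(1)]]
      by auto
  qed
  have cube: "conv2 B \<eta> (conv2 B \<eta> \<eta>) = (\<lambda>a b. 0)"
  proof (rule bilinear_form_eq_words)
    show b: "bilinear_form (scl B) (scl B) (conv2 B \<eta> (conv2 B \<eta> \<eta>))" by (intro conv2_bilinear \<eta>)
    show "bilinear_form (scl B) (scl B) (\<lambda>a b. 0)"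
      by (intro bilinear_formI linear_formI) (simp_all add: vsB)
    fix u v
    have pow: "conv2_pow B \<eta> 3 = conv2 B \<eta> (conv2 B \<eta> \<eta>)"
      using conv2_pow_1[OF \<eta>] by (simp add: numeral_3_eq_3)
    have "6 \<le> length u + length v" if "\<eta> (X u) (X v) \<noteq> 0" for u v
      using that by (auto simp: \<eta>w Z.\<eta>_def split: if_splits)
    from conv2_pow_low[OF \<eta> this, of u v 3]
    show "conv2 B \<eta> (conv2 B \<eta> \<eta>) (X u) (X v) = 0"
      using long[OF b, of u v] by (cases "length u \<le> 8 \<and> length v \<le> 8") (auto simp: pow)
  qed
  have exp: "conv2_exp B \<eta> = \<sigma>"
    unfolding conv2_exp_eq[OF \<eta> cube]
  proof (rule bilinear_form_eq_words[OF _ bil])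
    have half: "(\<lambda>a b. conv2 B \<eta> \<eta> a b / 2) = (\<lambda>a b. (1 / 2) * conv2 B \<eta> \<eta> a b)" by simp
    have "bilinear_form (scl B) (scl B) (\<lambda>a b. conv2_unit B a b + \<eta> a b + (1 / 2) * conv2 B \<eta> \<eta> a b)"
      by (intro bilinear_formI linear_form_plus linear_form_mult_left bilinear_formD[OF \<eta>]
          bilinear_formD[OF unit2_bilinear] bilinear_formD[OF conv2_bilinear[OF \<eta> \<eta>]])
    then show b: "bilinear_form (scl B) (scl B) (\<lambda>a b. conv2_unit B a b + \<eta> a b + conv2 B \<eta> \<eta> a b / 2)" by simp
    show "conv2_unit B (X u) (X v) + \<eta> (X u) (X v) + conv2 B \<eta> \<eta> (X u) (X v) / 2 = \<sigma> (X u) (X v)" for u v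
      using Z.\<sigma>_exp[of u v] long[OF b, of u v] long[OF bil, of u v]
      by (cases "length u \<le> 8 \<and> length v \<le> 8") (auto simp: unit2_word \<eta>w \<eta>2)
  qed
  have inv: "conv_inverse B (cou B) (cou B)"
    by (simp add: conv_inverse_def cou_linear cop_counit[OF coB cou_linear])
  have "gauge B (cou B) \<sigma> = \<sigma>"
  proof (rule bilinear_form_eq_words[OF gauge_bilinear[OF cou_linear inv bil] bil])
    have "(\<lambda>u v. word_unit u * word_unit v) = word_unit2" "(\<lambda>u v. word_unit (u @ v)) = word_unit2"
      by (simp_all add: fun_eq_iff word_unit2_def word_unit_def)
    then show "gauge B (cou B) \<sigma> (X u) (X v) = \<sigma> (X u) (X v)" for u v
      unfolding gauge_word[OF cou_linear inv bil] cou_word by simp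
  qed
  moreover have "cou B \<in> H_linear_units H B"
    using cou_linear inv ydc by (auto simp: H_linear_units_def yd_coalgebra_def)
  ultimately show ?thesis using hoch exp unfolding exponential_cocycle_def by metis
qed

end

end

section \<open>Triviality of the characters on the words that occur\<close>

context nichols
begin

lemma chiw_weight:
  assumes "\<And>i j k. lin i \<noteq> 0 \<Longrightarrow> lin j \<noteq> 0 \<Longrightarrow> lin k \<noteq> 0 \<Longrightarrow> chiw [i, j, k] = cou H"
  shows "weight_mod lin 0 w \<noteq> 0 \<Longrightarrow> chiw w = cou H"
proof (induction "length w" arbitrary: w rule: less_induct)
  case less
  then have len: "length w mod 3 = 0" and wt: "weight lin w \<noteq> 0" by (auto simp: weight_mod_def split: if_splits)
  show ?case
  proof (cases "w = []")
    case False
    then have "length w \<ge> 3" using len by (cases w) (auto, presburger)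
    then obtain i j k v where w: "w = [i, j, k] @ v" by (auto simp: numeral_3_eq_3 Suc_le_length_iff)
    have nz: "lin i \<noteq> 0" "lin j \<noteq> 0" "lin k \<noteq> 0" "weight lin v \<noteq> 0" using wt by (auto simp: w)
    have "length v mod 3 = 0" using len by (simp add: w)
    then have "chiw v = cou H" using nz less.hyps[of v] by (simp add: w weight_mod_def)
    moreover have "chiw w = conv H (chiw [i, j, k]) (chiw v)" unfolding w by (rule chiw_append)
    ultimately show ?thesis
      using assms[OF nz(1-3)] by (simp only: cop_counit[OF coH couH_linear])
  qed simp
qed

text \<open>The product \<chi>1^2 \<chi>2^2 equals both \<chi>1 and \<chi>2, so the two characters
  agree and every triple product is trivial.\<close>

lemma chi_equal:
  assumes "conv H (conv_pow H (chi One) 2) (chi Two) = cou H" "conv H (chi One) (conv_pow H (chi Two) 2) = cou H"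
  shows "chiw [i, j, k] = cou H"
proof -
  have 1: "chiw [i] = chi i" for i by (simp add: cop_counit[OF coH chi_linear])
  have "chiw [One, One] = conv_pow H (chi One) 2" "chiw [Two, Two] = conv_pow H (chi Two) 2"
    by (simp_all only: numeral_2_eq_2 conv_pow.simps chiw.simps)
  then have 112: "chiw ([One, One] @ [Two]) = cou H" and 122: "chiw ([One] @ [Two, Two]) = cou H"
    unfolding chiw_append using assms by (simp_all only: 1)
  have "chiw ([One] @ [One, Two, Two]) = chiw [One]"
    unfolding chiw_append using 122 by (simp add: cop_counit[OF coH] conv_linear chi_linear couH_linear coH)
  moreover have "chiw ([One, One, Two] @ [Two]) = chiw [Two]"
    unfolding chiw_append using 112 by (simp add: cop_counit[OF coH] conv_linear chi_linear couH_linear coH)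
  ultimately have "chi One = chi Two" by (simp add: 1[simplified])
  then have *: "chi i = chi One" for i by (cases i) simp_all
  have "chiw [i, j, k] = chiw [One, Two, Two]" by (simp only: chiw.simps *[of i] *[of j] *[of k] *[of Two])
  with 122 show ?thesis by simp
qed

end

theorem proposition5p4:
  fixes q l1 l2 l12 l112 l122 :: "'k::{alg_closed_field, field_char_0}"
    and H :: "('k, 'h::ring_1) hopf"
    and g :: "idx \<Rightarrow> 'h" and chi :: "idx \<Rightarrow> 'h \<Rightarrow> 'k"
    and B :: "('k, 'b::ring_1, 'h) yd_hopf" and x :: "idx \<Rightarrow> 'b"
    and sE :: "'k \<Rightarrow> 'e::ring_1 \<Rightarrow> 'e" and y :: "idx \<Rightarrow> 'e"
    and eps0 :: "'e \<Rightarrow> 'k" and \<gamma> :: "'b \<Rightarrow> 'e" and \<sigma> :: "'b \<Rightarrow> 'b \<Rightarrow> 'k"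
  assumes "q ^ 3 = 1" and "\<forall>m. 0 < m \<and> m < 3 \<longrightarrow> q ^ m \<noteq> 1"
    and "semisimple_hopf_algebra H"
    and "principal_yd_realization H g chi (\<lambda>i j. q)"
    and "nichols_algebra_A2 q H g chi B x"
    and "admissible H chi l1 l2 l12 l112 l122"
    and "deformed_algebra q l1 l2 l12 l112 l122 sE y"
    and "is_eps0 q sE y eps0"
    and "is_section q l1 l112 (scl B) x sE y \<gamma>"
    and "\<sigma> = (\<lambda>a b. eps0 (\<gamma> a * \<gamma> b))"
    and "\<sigma> \<in> hopf_2_cocycles H B"
  shows "exponential_cocycle H B x \<sigma> \<longleftrightarrow>
    (l112 = 0 \<and> l122 = 0 \<and>
       (l1 = 0 \<and> l2 = 0 \<or> l1 = 0 \<and> l12 = 0 \<or> l2 = 0 \<and> l12 = 0)) \<or>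
    (l112 * l122 \<noteq> 0 \<and>
       l1 = 1 / 3 * (l112\<^sup>2 / l122) \<and> l2 = 1 / 3 * (l122\<^sup>2 / l112) \<and>
       l12 = 1 / 3 * (q\<^sup>2 - q) * l112 * l122)"
proof -
  have q: "q \<noteq> 1" using assms(2)[rule_format, of 1] by simp
  have H: "hopf_algebra H" using assms(3) by (simp add: semisimple_hopf_algebra_def)
  interpret deformation q H g chi B x sE y eps0 \<gamma> \<sigma> l1 l2 l12 l112 l122
    by unfold_locales (rule assms q H)+
  note adm = assms(6)[unfolded admissible_def]
  show ?thesis
  proof
    assume "exponential_cocycle H B x \<sigma>"
    then show "(l112 = 0 \<and> l122 = 0 \<and>
         (l1 = 0 \<and> l2 = 0 \<or> l1 = 0 \<and> l12 = 0 \<or> l2 = 0 \<and> l12 = 0)) \<or>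
      (l112 * l122 \<noteq> 0 \<and>
         l1 = 1 / 3 * (l112\<^sup>2 / l122) \<and> l2 = 1 / 3 * (l122\<^sup>2 / l112) \<and>
         l12 = 1 / 3 * (q\<^sup>2 - q) * l112 * l122)"
      by (rule exponential_imp_parameters)
  next
    assume "(l112 = 0 \<and> l122 = 0 \<and>
         (l1 = 0 \<and> l2 = 0 \<or> l1 = 0 \<and> l12 = 0 \<or> l2 = 0 \<and> l12 = 0)) \<or>
      (l112 * l122 \<noteq> 0 \<and>
         l1 = 1 / 3 * (l112\<^sup>2 / l122) \<and> l2 = 1 / 3 * (l122\<^sup>2 / l112) \<and>
         l12 = 1 / 3 * (q\<^sup>2 - q) * l112 * l122)"
    then consider (z) "l1 = 0" "l2 = 0" "l112 = 0" "l122 = 0"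
      | (second) "l1 = 0" "l12 = 0" "l112 = 0" "l122 = 0"
      | (first) "l2 = 0" "l12 = 0" "l112 = 0" "l122 = 0"
      | (both) "l112 \<noteq> 0" "l122 \<noteq> 0" "l1 = 1 / 3 * (l112\<^sup>2 / l122)" "l2 = 1 / 3 * (l122\<^sup>2 / l112)"
        "l12 = 1 / 3 * (q\<^sup>2 - q) * l112 * l122"
      by auto
    then show "exponential_cocycle H B x \<sigma>"
    proof cases
      case z
      then show ?thesis by (rule exponential_z)
    next
      case first
      \<comment> \<open>The linear form s X has the required cube; the root exists because the field
        is algebraically closed.\<close>
      obtain s where s: "s ^ 3 = l1" using nth_root_exists[of 3 l1] by auto
      show ?thesis
      proof (rule exponential_cube[of "case_idx s 0"])
        show "chiw w = cou H" if "weight_mod (case_idx s 0) 0 w \<noteq> 0" for w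
        proof (rule chiw_weight[OF _ that])
          fix i j k
          assume nz: "case_idx s 0 i \<noteq> 0" "case_idx s 0 j \<noteq> 0" "case_idx s 0 k \<noteq> 0"
          then have "i = One" "j = One" "k = One" "s \<noteq> 0" by (cases i; cases j; cases k; simp)+
          moreover from this s have "l1 \<noteq> 0" by auto
          ultimately show "chiw [i, j, k] = cou H" using adm by (simp add: numeral_3_eq_3)
        qed
      qed (simp_all add: s first)
    next
      case second
      obtain s where s: "s ^ 3 = l2" using nth_root_exists[of 3 l2] by auto
      show ?thesis
      proof (rule exponential_cube[of "case_idx 0 s"])
        show "chiw w = cou H" if "weight_mod (case_idx 0 s) 0 w \<noteq> 0" for w
        proof (rule chiw_weight[OF _ that])
          fix i j k
          assume nz: "case_idx 0 s i \<noteq> 0" "case_idx 0 s j \<noteq> 0" "case_idx 0 s k \<noteq> 0"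
          then have "i = Two" "j = Two" "k = Two" "s \<noteq> 0" by (cases i; cases j; cases k; simp)+
          moreover from this s have "l2 \<noteq> 0" by auto
          ultimately show "chiw [i, j, k] = cou H" using adm by (simp add: numeral_3_eq_3)
        qed
      qed (simp_all add: s second)
    next
      case both
      obtain s where s: "s ^ 3 = l1" using nth_root_exists[of 3 l1] by auto
      \<comment> \<open>Forced by the coefficient 3 s^2 t = l112 in the cube of s X + t Y; condition
        (b) then gives the other coefficients.\<close>
      define t where "t = l112 / (3 * s\<^sup>2)"
      have "l1 \<noteq> 0" using both by simp
      then have s0: "s \<noteq> 0" using s by auto
      have e112: "l112 = 3 * s\<^sup>2 * t" using s0 by (simp add: t_def)
      have l1: "l1 * (3 * l122) = l112\<^sup>2" using both by simp
      have e122: "l122 = 3 * s * t\<^sup>2"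
      proof -
        have "s ^ 3 * (3 * l122) = s ^ 3 * (3 * (3 * s * t\<^sup>2))"
          using l1 unfolding s e112 by (simp add: power2_eq_square power3_eq_cube mult_ac flip: s)
        then show ?thesis using s0 by simp
      qed
      have t0: "t \<noteq> 0" using both(1) unfolding e112 by auto
      have e2: "l2 = t ^ 3"
        unfolding both(4) e112 e122 using s0 t0 by (simp add: power2_eq_square power3_eq_cube field_simps)
      have e12: "l12 = 3 * (q\<^sup>2 - q) * s ^ 3 * t ^ 3"
        unfolding both(5) e112 e122 by (simp add: power2_eq_square power3_eq_cube)
      show ?thesis
      proof (rule exponential_cube[of "case_idx s t"])
        show "chiw w = cou H" if "weight_mod (case_idx s t) 0 w \<noteq> 0" for w
          by (rule chiw_weight[OF chi_equal that]) (use adm both in auto)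
      qed (simp only: idx.case, rule s[symmetric] e2 e12 e112 e122)+
    qed
  qed
qed

end
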